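(* Let $\mathcal{T}$ be a conforming, face-connected simplicial mesh of a polyhedral domain $\Omega\subset\mathbb{R}^d$ in which every element has at least one interelement face, and let $S=S^{\ell,0}(\mathcal{T})$ with $\ell\ge 1$. There is a constant $C$ such that for any $\varepsilon>0$ and every $u\in H^1(\Omega)$ it holds $$ \inf_{v\in S}|||u-v|||_\Omega \le C\Big(\sum_{E\in\mathcal{E}_i}\ \inf_{P\in S|_{\omega_{\mathcal{T}}(E)}}|||u-P|||^2_{\omega_{\mathcal{T}}(E)}\Big)^{1/2} \le C(d+1)\inf_{v\in S}|||u-v|||_\Omega , $$ where $|||\cdot|||_\omega=(\|\cdot\|_\omega^2+\varepsilon\|\nabla\cdot\|_\omega^2)^{1/2}$. The constant $C$ is bounded in terms of the polynomial degree $\ell$, the dimension $d$, $\bar n$, $\mu_{\mathcal{T}}$ and the shape parameter $\sigma_{\mathcal{T}}$ only (in particular it is independent of $\varepsilon$). If $\varepsilon$ is small with respect to $\min_{K\in\mathcal{T}}\rho_K^2$, the dependence on $\sigma_{\mathcal{T}}$ disappears, i.e. for $\varepsilon\le c\,\min_{K\in\mathcal{T}}\rho_K^2$ with a constant $c>0$, the inequalities hold with a constant $C$ bounded in terms of $\ell$, $d$, $\bar n$, $\mu_{\mathcal{T}}$ and $c$ only.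
   Context: $\|\cdot\|_\omega$ denotes the $L^2(\omega)$-norm. $\mathcal{E}$ is the set of faces ($(d-1)$-dimensional subsimplices) of the elements of $\mathcal{T}$ and $\mathcal{E}_i\subset\mathcal{E}$ the set of faces not contained in $\partial\Omega$ (interelement faces). For $E\in\mathcal{E}$, $\omega_{\mathcal{T}}(E)=\bigcup\{K\in\mathcal{T}:\partial K\supseteq E\}$ (two elements if $E\in\mathcal{E}_i$). $S^{\ell,0}(\mathcal{T})$ is the space of continuous functions on $\Omega$ whose restriction to each $K\in\mathcal{T}$ is a polynomial of degree at most $\ell$. $S|_\omega$ is the space of restrictions to $\omega$ of functions in $S$; thus $S|_{\omega_{\mathcal{T}}(E)}$ consists of the continuous functions on $\omega_{\mathcal{T}}(E)$ that are polynomials of degree $\le\ell$ on each of its elements. $\mathcal{N}$ is the set of (Lagrange) nodes of $S$. $\mathcal{T}$ is face-connected if for every pair $K,\widetilde K\in\mathcal{T}$ sharing a node $z\in\mathcal{N}$ there is a finite sequence of pairwise distinct elements $K_1=K,\dots,K_n=\widetilde K$ of $\mathcal{T}$ such that each $K_j\cap K_{j+1}\in\mathcal{E}_i$ is an interelement face containing $z$. Parameters: $h_K=\mathrm{diam}(K)$; $\rho_K$ is the maximum diameter of a ball inscribed in $K$; $|K|$ is the $d$-dimensional Lebesgue measure; $\bar n=\max_{z\in\mathcal{N}}\#\{K\in\mathcal{T}:K\ni z\}$; $\mu_{\mathcal{T}}=\max |K|^{1/2}/|\widetilde K|^{1/2}$ and $\sigma_{\mathcal{T}}=\max h_{\widetilde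 K}/\rho_K$, both maxima being over all $K,\widetilde K\in\mathcal{T}$ with $K\cap\widetilde K\ne\emptyset$ (including $\widetilde K=K$). *)

theory Defs
  imports "HOL-Analysis.Analysis"
begin

text \<open>Functions on subsets of \<open>\<real>\<^sup>d\<close> are total functions on \<^typ>\<open>real^'n\<close>, where
  \<open>d = CARD('n)\<close>; elements of Lebesgue and Sobolev spaces are given by representatives.\<close>

section \<open>Sobolev functions\<close>

primrec C_times :: "nat \<Rightarrow> (real^'n \<Rightarrow> real) \<Rightarrow> bool" where
  "C_times 0 f \<longleftrightarrow> continuous_on UNIV f"
| "C_times (Suc k) f \<longleftrightarrow>
     (\<exists>G. (\<forall>x. GDERIV f x :> G x) \<and> (\<forall>i. C_times k (\<lambda>x. G x $ i)))"

definition test_functions :: "(real^'n) set \<Rightarrow> (real^'n \<Rightarrow> real) set" where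
  "test_functions U =
     {\<phi>. (\<forall>k. C_times k \<phi>) \<and> (\<exists>K. compact K \<and> K \<subseteq> U \<and> (\<forall>x. x \<notin> K \<longrightarrow> \<phi> x = 0))}"

definition square_integrable_on :: "(real^'n \<Rightarrow> 'b::euclidean_space) \<Rightarrow> (real^'n) set \<Rightarrow> bool"
    (infix \<open>square'_integrable'_on\<close> 50) where
  "f square_integrable_on U \<longleftrightarrow>
     f \<in> borel_measurable (lebesgue_on U) \<and> integrable (lebesgue_on U) (\<lambda>x. (norm (f x))\<^sup>2)"

definition locally_integrable_on :: "(real^'n \<Rightarrow> 'b::euclidean_space) \<Rightarrow> (real^'n) set \<Rightarrow> bool"
    (infix \<open>locally'_integrable'_on\<close> 50) where
  "f locally_integrable_on U \<longleftrightarrow>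
     (\<forall>K. compact K \<and> K \<subseteq> U \<longrightarrow> integrable (lebesgue_on K) f)"

definition has_weak_gradient ::
    "(real^'n) set \<Rightarrow> (real^'n \<Rightarrow> real) \<Rightarrow> (real^'n \<Rightarrow> real^'n) \<Rightarrow> bool" where
  "has_weak_gradient U u g \<longleftrightarrow>
     u locally_integrable_on U \<and> g locally_integrable_on U \<and>
     (\<forall>\<phi>\<in>test_functions U. \<forall>D. (\<forall>x. GDERIV \<phi> x :> D x) \<longrightarrow>
        (LINT x|lebesgue_on U. u x *\<^sub>R D x) = - (LINT x|lebesgue_on U. \<phi> x *\<^sub>R g x))"

text \<open>On an open set \<open>U\<close> the weak gradient is unique almost everywhere; the choice below picks a
  representative.\<close>

definition weak_gradient :: "(real^'n) set \<Rightarrow> (real^'n \<Rightarrow> real) \<Rightarrow> real^'n \<Rightarrow> real^'n" where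
  "weak_gradient U u = (SOME g. has_weak_gradient U u g)"

definition H1 :: "(real^'n) set \<Rightarrow> (real^'n \<Rightarrow> real) set" where
  "H1 U = {u. u square_integrable_on U \<and> (\<exists>g. has_weak_gradient U u g \<and> g square_integrable_on U)}"

definition L2norm :: "(real^'n) set \<Rightarrow> (real^'n \<Rightarrow> 'b::euclidean_space) \<Rightarrow> real" where
  "L2norm \<omega> f = sqrt (LINT x|lebesgue_on \<omega>. (norm (f x))\<^sup>2)"

text \<open>The set \<open>\<omega>\<close> is either open or a finite union of closed simplices. Weak gradients need an
  open set, so the gradient is taken on the interior of \<open>\<omega>\<close>; in both cases the rest of \<open>\<omega>\<close> is a
  null set, on which the arbitrary values of the gradient do not matter.\<close>

definition energy_norm :: "real \<Rightarrow> (real^'n) set \<Rightarrow> (real^'n \<Rightarrow> real) \<Rightarrow> real" where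
  "energy_norm \<epsilon> \<omega> w =
     sqrt ((L2norm \<omega> w)\<^sup>2 + \<epsilon> * (L2norm \<omega> (weak_gradient (interior \<omega>) w))\<^sup>2)"

section \<open>Domains and meshes\<close>

text \<open>No Lipschitz condition is imposed on the boundary, but the domain lies locally on one side
  of its flat boundary pieces, since it is the interior of a closed set (so there are no slits).\<close>

definition polyhedral_domain :: "(real^'n) set \<Rightarrow> bool" where
  "polyhedral_domain \<Omega> \<longleftrightarrow> \<Omega> \<noteq> {} \<and> connected \<Omega> \<and>
     (\<exists>\<P>. finite \<P> \<and> (\<forall>P\<in>\<P>. polytope P) \<and> \<Omega> = interior (\<Union>\<P>))"

text \<open>Conformity, i.e. that two elements meet in a common face of both (possibly empty), is part of
  \<^const>\<open>triangulation\<close>.\<close>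

definition conforming_simplicial_mesh :: "(real^'n) set \<Rightarrow> (real^'n) set set \<Rightarrow> bool" where
  "conforming_simplicial_mesh \<Omega> \<T> \<longleftrightarrow>
     triangulation \<T> \<and> (\<forall>K\<in>\<T>. int CARD('n) simplex K) \<and> \<Union>\<T> = closure \<Omega>"

definition faces :: "(real^'n) set set \<Rightarrow> (real^'n) set set" where
  "faces \<T> = {E. \<exists>K\<in>\<T>. E facet_of K}"

definition interelement_faces :: "(real^'n) set \<Rightarrow> (real^'n) set set \<Rightarrow> (real^'n) set set" where
  "interelement_faces \<Omega> \<T> = {E \<in> faces \<T>. \<not> E \<subseteq> frontier \<Omega>}"

definition face_patch :: "(real^'n) set set \<Rightarrow> (real^'n) set \<Rightarrow> (real^'n) set" where
  "face_patch \<T> E = \<Union>{K \<in> \<T>. E \<subseteq> frontier K}"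

section \<open>Finite element spaces\<close>

definition polynomials_upto :: "nat \<Rightarrow> (real^'n \<Rightarrow> real) set" where
  "polynomials_upto \<l> =
     {p. \<exists>c. p = (\<lambda>x. \<Sum>\<alpha> | (\<Sum>i\<in>UNIV. \<alpha> i) \<le> \<l>. c \<alpha> * (\<Prod>i\<in>UNIV. (x $ i) ^ \<alpha> i))}"

text \<open>The elements are closed, so the functions are continuous up to the boundary of the domain.\<close>

definition fe_space :: "nat \<Rightarrow> (real^'n) set set \<Rightarrow> (real^'n \<Rightarrow> real) set" where
  "fe_space \<l> \<T> =
     {v. continuous_on (\<Union>\<T>) v \<and> (\<forall>K\<in>\<T>. \<exists>p\<in>polynomials_upto \<l>. \<forall>x\<in>K. v x = p x)}"

definition restricted_space ::
    "(real^'n \<Rightarrow> real) set \<Rightarrow> (real^'n) set \<Rightarrow> (real^'n \<Rightarrow> real) set" where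
  "restricted_space S \<omega> = (\<lambda>v. restrict v \<omega>) ` S"

text \<open>The nodes of a simplex are the points with barycentric coordinates in \<open>{0, 1/\<l>, \<dots>, 1}\<close>.\<close>

definition simplex_nodes :: "nat \<Rightarrow> (real^'n) set \<Rightarrow> (real^'n) set" where
  "simplex_nodes \<l> K =
     {(\<Sum>a | a extreme_point_of K. (real (k a) / real \<l>) *\<^sub>R a) | k :: real^'n \<Rightarrow> nat.
        (\<Sum>a | a extreme_point_of K. k a) = \<l>}"

definition mesh_nodes :: "nat \<Rightarrow> (real^'n) set set \<Rightarrow> (real^'n) set" where
  "mesh_nodes \<l> \<T> = (\<Union>K\<in>\<T>. simplex_nodes \<l> K)"

definition face_connected :: "nat \<Rightarrow> (real^'n) set \<Rightarrow> (real^'n) set set \<Rightarrow> bool" where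
  "face_connected \<l> \<Omega> \<T> \<longleftrightarrow>
     (\<forall>z\<in>mesh_nodes \<l> \<T>. \<forall>K\<in>\<T>. \<forall>K'\<in>\<T>. z \<in> K \<and> z \<in> K' \<longrightarrow>
        (\<exists>Ks. Ks \<noteq> [] \<and> hd Ks = K \<and> last Ks = K' \<and> distinct Ks \<and> set Ks \<subseteq> \<T> \<and>
           (\<forall>j. Suc j < length Ks \<longrightarrow>
              Ks ! j \<inter> Ks ! Suc j \<in> interelement_faces \<Omega> \<T> \<and> z \<in> Ks ! j \<inter> Ks ! Suc j)))"

section \<open>Mesh parameters\<close>

definition inball_diameter :: "(real^'n) set \<Rightarrow> real" where
  "inball_diameter K = Sup {diameter (cball x r) | x r. cball x r \<subseteq> K}"

definition max_elements_per_node :: "nat \<Rightarrow> (real^'n) set set \<Rightarrow> nat" where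
  "max_elements_per_node \<l> \<T> = Max ((\<lambda>z. card {K \<in> \<T>. z \<in> K}) ` mesh_nodes \<l> \<T>)"

definition volume_ratio :: "(real^'n) set set \<Rightarrow> real" where
  "volume_ratio \<T> =
     Max {sqrt (measure lebesgue K) / sqrt (measure lebesgue K') | K K'.
            K \<in> \<T> \<and> K' \<in> \<T> \<and> K \<inter> K' \<noteq> {}}"

definition shape_parameter :: "(real^'n) set set \<Rightarrow> real" where
  "shape_parameter \<T> =
     Max {diameter K' / inball_diameter K | K K'. K \<in> \<T> \<and> K' \<in> \<T> \<and> K \<inter> K' \<noteq> {}}"

section \<open>Best errors\<close>

definition global_best_error ::
    "nat \<Rightarrow> (real^'n) set \<Rightarrow> (real^'n) set set \<Rightarrow> real \<Rightarrow> (real^'n \<Rightarrow> real) \<Rightarrow> real" where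
  "global_best_error \<l> \<Omega> \<T> \<epsilon> u =
     (INF v\<in>fe_space \<l> \<T>. energy_norm \<epsilon> \<Omega> (\<lambda>x. u x - v x))"

definition local_best_errors ::
    "nat \<Rightarrow> (real^'n) set \<Rightarrow> (real^'n) set set \<Rightarrow> real \<Rightarrow> (real^'n \<Rightarrow> real) \<Rightarrow> real" where
  "local_best_errors \<l> \<Omega> \<T> \<epsilon> u =
     sqrt (\<Sum>E\<in>interelement_faces \<Omega> \<T>.
       (INF P\<in>restricted_space (fe_space \<l> \<T>) (face_patch \<T> E).
          (energy_norm \<epsilon> (face_patch \<T> E) (\<lambda>x. u x - P x))\<^sup>2))"

end

theory Submission
  imports Defs "HOL-Computational_Algebra.Polynomial"
begin

text \<open>The energy norm of \<open>u - v\<close> for a finite element function \<open>v\<close> splits into integrals over the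
  elements. This needs two facts on weak gradients: they are unique almost everywhere
  (\<open>has_weak_gradient_unique\<close>), and the weak gradient of a continuous piecewise polynomial is its
  elementwise gradient (\<open>fe_weak_gradient\<close>). The second inequality is then a matter of counting, since
  an element has at most \<open>d + 1\<close> facets (\<open>local_best_errors_le\<close>).

  For the first inequality, let \<open>v\<^sub>E\<close> be near-best approximations on the patches of the interelement
  faces \<open>E\<close>. Each element \<open>K\<close> gets a polynomial \<open>p\<^sub>K\<close>, taken from \<open>v\<^sub>E\<close> for one of its interelement
  faces. The global approximation takes at every node \<open>z\<close> the value \<open>p\<^sub>K z\<close> of one element containing
  \<open>z\<close>. On another element \<open>L\<close> at \<open>z\<close> it differs from \<open>p\<^sub>L\<close> by \<open>p\<^sub>K z - p\<^sub>L z\<close>, which is telescoped along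
  a face chain from \<open>K\<close> to \<open>L\<close>. Hence only jumps \<open>p\<^sub>K z - p\<^sub>L z\<close> of elements with a common face \<open>E\<close>
  have to be bounded, by comparison with \<open>v\<^sub>E\<close>, which is continuous across \<open>E\<close>
  (\<open>quasi_interpolation\<close>).

  Let \<open>\<rho>\<close> be the inball diameter and \<open>h\<close> the diameter. The squared energy norm of a Lagrange function on \<open>K\<close>
  is at most a constant times \<open>|K| (1 + \<epsilon> / \<rho>\<^sup>2)\<close>. By an inverse estimate, \<open>|K| (p\<^sub>K z - v\<^sub>E z)\<^sup>2\<close> is bounded
  by the mean square of \<open>p\<^sub>K - v\<^sub>E\<close> (\<open>polynomial_inverse_estimate\<close>, \<open>jump_L2\<close>), which settles the summand
  \<open>1\<close>, and also \<open>\<epsilon> / \<rho>\<^sup>2\<close> if \<open>\<epsilon>\<close> is at most a multiple of \<open>\<rho>\<^sup>2\<close> (\<open>small_parameter_bound\<close>). The constants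
  depend on \<open>l\<close>, \<open>d\<close>, volume ratios and this multiple.

  For large \<open>\<epsilon>\<close> the jumps must be bounded by \<open>h\<^sup>2\<close> times the mean squares of gradients
  (\<open>jump_gradient\<close>). This requires a normalisation of constants: \<open>p\<^sub>K\<close> is shifted so that \<open>u - p\<^sub>K\<close> has
  average zero over an inscribed ball of \<open>K\<close>, with a smooth weight. Up to oscillations of polynomials, a
  jump is then the difference of the averages of \<open>u - v\<^sub>E\<close> over two neighbouring elements. Moving the
  ball from one element to the other through the barycentre of the common facet, and differentiating
  the average along the way, bounds this difference by the gradient of \<open>u - v\<^sub>E\<close>
  (\<open>average_difference_bound\<close>). The ball remains in the patch because the patch is star-shaped with
  respect to a small ball at that barycentre (\<open>patch_star_shaped\<close>). The two bounds together hold for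
  every \<open>\<epsilon>\<close> (\<open>general_bound\<close>).\<close>

section \<open>Smooth functions with compact support\<close>

lemma C_times_Suc_imp: "C_times (Suc k) f \<Longrightarrow> C_times k (f :: real^'n \<Rightarrow> real)"
proof (induction k arbitrary: f)
  case 0
  then obtain G where "\<And>x. GDERIV f x :> G x" by auto
  then have "\<And>x. isCont f x" unfolding gderiv_def using has_derivative_continuous by blast
  then show ?case by (simp add: continuous_at_imp_continuous_on)
next
  case (Suc k)
  then obtain G where G: "\<forall>x. GDERIV f x :> G x" "\<forall>i. C_times (Suc k) (\<lambda>x. G x $ i)" by (auto simp only: C_times.simps)
  then show ?case using Suc.IH by (auto simp del: C_times.simps simp add: C_times.simps(2)[of k])
qed

lemma C_times_const: "C_times k (\<lambda>x :: real^'n. c)"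
proof (induction k arbitrary: c)
  case (Suc k)
  have "\<forall>x :: real^'n. GDERIV (\<lambda>x. c) x :> 0" by (simp add: GDERIV_const)
  then show ?case using Suc[of 0] by (auto intro!: exI[of _ "\<lambda>_. 0"])
qed auto

lemma C_times_add:
  "C_times k f \<Longrightarrow> C_times k g \<Longrightarrow> C_times k (\<lambda>x :: real^'n. f x + g x)"
proof (induction k arbitrary: f g)
  case 0 then show ?case by (auto intro: continuous_on_add)
next
  case (Suc k)
  from Suc.prems obtain F G where "\<forall>x. GDERIV f x :> F x" "\<forall>i. C_times k (\<lambda>x. F x $ i)"
    "\<forall>x. GDERIV g x :> G x" "\<forall>i. C_times k (\<lambda>x. G x $ i)" by auto
  then show ?case using Suc.IH by (auto intro!: exI[of _ "\<lambda>x. F x + G x"] GDERIV_add)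
qed

lemma C_times_mult:
  "C_times k f \<Longrightarrow> C_times k g \<Longrightarrow> C_times k (\<lambda>x :: real^'n. f x * g x)"
proof (induction k arbitrary: f g)
  case 0 then show ?case by (auto intro: continuous_on_mult)
next
  case (Suc k)
  from Suc.prems obtain F G where *: "\<forall>x. GDERIV f x :> F x" "\<forall>i. C_times k (\<lambda>x. F x $ i)"
    "\<forall>x. GDERIV g x :> G x" "\<forall>i. C_times k (\<lambda>x. G x $ i)" by auto
  have "C_times k f" "C_times k g" using Suc.prems C_times_Suc_imp by blast+
  then have "\<forall>i. C_times k (\<lambda>x. f x * G x $ i + g x * F x $ i)" 
    using * by (intro allI C_times_add Suc.IH) auto
  then show ?case unfolding C_times.simps using *
    by (intro exI[of _ "\<lambda>x. f x *\<^sub>R G x + g x *\<^sub>R F x"]) (simp add: GDERIV_mult)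
qed

lemma C_times_prod:
  "(\<And>i. i \<in> A \<Longrightarrow> C_times k (f i)) \<Longrightarrow> C_times k (\<lambda>x :: real^'n. \<Prod>i\<in>A. f i x)"
  by (induction A rule: infinite_finite_induct) (auto intro: C_times_const C_times_mult)

lemma C_times_power: "C_times k f \<Longrightarrow> C_times k (\<lambda>x :: real^'n. f x ^ m)"
  by (induction m) (auto intro: C_times_const C_times_mult)

lemma C_times_dilate:
  "C_times k f \<Longrightarrow> C_times k (\<lambda>x :: real^'n. f (r *\<^sub>R x + b))"
proof (induction k arbitrary: f)
  case 0
  have "continuous_on UNIV (\<lambda>x :: real^'n. r *\<^sub>R x + b)" by (intro continuous_intros)
  with 0 show ?case using continuous_on_compose2[of UNIV f UNIV "\<lambda>x. r *\<^sub>R x + b"] by auto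
next
  case (Suc k)
  then obtain F where F: "\<forall>x. GDERIV f x :> F x" "\<forall>i. C_times k (\<lambda>x. F x $ i)" by auto
  have "GDERIV (\<lambda>x. f (r *\<^sub>R x + b)) x :> r *\<^sub>R F (r *\<^sub>R x + b)" for x
  proof -
    have "((\<lambda>x. r *\<^sub>R x + b) has_derivative (\<lambda>h. r *\<^sub>R h)) (at x)" by (auto intro!: derivative_eq_intros)
    from has_derivative_compose[OF this F(1)[rule_format, of "r *\<^sub>R x + b", unfolded gderiv_def]]
    show ?thesis by (simp add: gderiv_def)
  qed
  moreover have "C_times k (\<lambda>x. r * F (r *\<^sub>R x + b) $ i)" for i
    by (intro C_times_mult C_times_const Suc.IH F(2)[rule_format])
  ultimately show ?case by (auto intro!: exI[of _ "\<lambda>x. r *\<^sub>R F (r *\<^sub>R x + b)"])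
qed

text \<open>The family is closed under differentiation: the derivative of \<open>p (1/t) exp (- 1/t)\<close> has the same
  shape with another polynomial, and all members vanish to infinite order at \<open>0\<close>. Smoothness of one
  member therefore follows by induction over the whole family.\<close>

definition flat_exp :: "real poly \<Rightarrow> real \<Rightarrow> real" where
  "flat_exp p t = (if 0 < t then poly p (1/t) * exp (- 1/t) else 0)"

lemma poly_times_exp_minus_tendsto_0: "((\<lambda>s. poly p s * exp (- s)) \<longlongrightarrow> (0::real)) at_top"
proof -
  have "((\<lambda>s. \<Sum>i\<le>degree p. coeff p i * (s ^ i / exp s)) \<longlongrightarrow> (\<Sum>i\<le>degree p. coeff p i * 0)) at_top"
    by (intro tendsto_sum tendsto_mult tendsto_const tendsto_power_div_exp_0)
  moreover have "(\<Sum>i\<le>degree p. coeff p i * (s ^ i / exp s)) = poly p s * exp (- s)" for s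
    by (simp add: poly_altdef sum_distrib_right exp_minus divide_inverse mult.assoc)
  ultimately show ?thesis by simp
qed

lemma flat_exp_isCont_0: "isCont (flat_exp p) 0"
proof -
  have "((\<lambda>t. poly p (inverse t) * exp (- inverse t)) \<longlongrightarrow> 0) (at_right 0)"
    using filterlim_compose[OF poly_times_exp_minus_tendsto_0 filterlim_inverse_at_top_right] .
  then have "(flat_exp p \<longlongrightarrow> 0) (at_right 0)"
    by (rule Lim_transform_eventually)
      (auto simp: flat_exp_def eventually_at_filter inverse_eq_divide)
  moreover have "(flat_exp p \<longlongrightarrow> 0) (at_left 0)"
    by (rule Lim_transform_eventually[OF tendsto_const]) (auto simp: flat_exp_def eventually_at_filter)
  ultimately show ?thesis by (simp add: isCont_def filterlim_split_at flat_exp_def)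
qed

lemma flat_exp_DERIV:
  "DERIV (flat_exp p) t :> flat_exp ([:0, 0, 1:] * (p - pderiv p)) t"
proof (cases "t = 0")
  case True
  have "(\<lambda>h. (flat_exp p (0 + h) - flat_exp p 0) / h) = flat_exp (pCons 0 p)"
    by (auto simp: flat_exp_def fun_eq_iff)
  then show ?thesis using flat_exp_isCont_0[of "pCons 0 p"] True
    by (simp add: DERIV_def isCont_def flat_exp_def)
next
  case False
  show ?thesis
  proof (cases "t > 0")
    case True
    have "DERIV (\<lambda>t. poly p (1/t) * exp (- 1/t)) t :> poly ([:0, 0, 1:] * (p - pderiv p)) (1/t) * exp (- 1/t)"
      using True by (auto intro!: derivative_eq_intros DERIV_chain2[of "poly p" _ "\<lambda>t. 1/t"] poly_DERIV simp: field_simps)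
    moreover have "eventually (\<lambda>s. flat_exp p s = poly p (1/s) * exp (- 1/s)) (nhds t)"
      using eventually_nhds_in_open[of "{0<..}" t] True by (auto elim!: eventually_mono simp: flat_exp_def)
    ultimately show ?thesis using True by (subst DERIV_cong_ev[OF refl _ refl]) (auto simp: flat_exp_def)
  next
    assume "\<not> t > 0"
    then have "t < 0" using False by simp
    then have "eventually (\<lambda>s. flat_exp p s = 0) (nhds t)"
      using eventually_nhds_in_open[of "{..<0}" t] by (auto elim!: eventually_mono simp: flat_exp_def)
    then show ?thesis using \<open>t < 0\<close> by (subst DERIV_cong_ev[OF refl _ refl]) (auto simp: flat_exp_def)
  qed
qed

lemma C_times_flat_exp: "C_times k (\<lambda>x :: real^'n. flat_exp p (s * x $ i + c))"
proof (induction k arbitrary: p)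
  case 0
  have "continuous_on UNIV (flat_exp p)" using flat_exp_DERIV DERIV_isCont continuous_at_imp_continuous_on by blast
  moreover have "continuous_on UNIV (\<lambda>x :: real^'n. s * x $ i + c)" by (intro continuous_intros)
  ultimately show ?case using continuous_on_compose2[of UNIV "flat_exp p" UNIV "\<lambda>x :: real^'n. s * x $ i + c"] by auto
next
  case (Suc k)
  let ?q = "[:0, 0, 1:] * (p - pderiv p)"
  let ?G = "\<lambda>x. (s * flat_exp ?q (s * x $ i + c)) *\<^sub>R axis i 1 :: real^'n"
  have "GDERIV (\<lambda>x. flat_exp p (s * x $ i + c)) x :> ?G x" for x
  proof -
    have "((\<lambda>x. s * x $ i + c) has_derivative (\<lambda>h. s * h $ i)) (at x)"
      by (auto intro!: derivative_eq_intros bounded_linear_imp_has_derivative bounded_linear_vec_nth)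
    from has_derivative_compose[OF this flat_exp_DERIV[of p "s * x $ i + c", unfolded has_field_derivative_def]]
    show ?thesis by (auto simp: gderiv_def inner_axis mult_ac)
  qed
  moreover have "C_times k (\<lambda>x. ?G x $ j)" for j
    using C_times_mult[OF C_times_const Suc.IH[of ?q], of "if i = j then s else 0"]
    by (auto simp: axis_def C_times_const)
  ultimately show ?case unfolding C_times.simps by (intro exI[of _ ?G]) auto
qed

definition box_bump :: "real^'n \<Rightarrow> real^'n \<Rightarrow> real^'n \<Rightarrow> real" where
  "box_bump a b x = (\<Prod>i\<in>UNIV. flat_exp 1 (x $ i - a $ i) * flat_exp 1 (b $ i - x $ i))"

lemma C_times_box_bump: "C_times k (box_bump a b)"
proof -
  have "C_times k (\<lambda>x. \<Prod>i\<in>UNIV. flat_exp 1 (1 * x $ i + - a $ i) * flat_exp 1 (-1 * x $ i + b $ i))"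
    by (intro C_times_prod C_times_mult C_times_flat_exp)
  then show ?thesis unfolding box_bump_def[abs_def] by simp
qed

lemma box_bump_pos: "x \<in> box a b \<Longrightarrow> 0 < box_bump a b x"
  by (auto simp: box_bump_def mem_box_cart flat_exp_def intro!: prod_pos mult_pos_pos)

lemma box_bump_outside: "x \<notin> box a b \<Longrightarrow> box_bump a b x = 0"
  by (auto simp: box_bump_def mem_box_cart flat_exp_def)

lemma box_bump_nonneg: "0 \<le> box_bump a b x"
  using box_bump_pos box_bump_outside by (metis less_eq_real_def)

lemma box_bump_le_1: "box_bump a b x \<le> 1"
  unfolding box_bump_def by (intro prod_le_1) (auto simp: flat_exp_def intro!: mult_le_one)

lemma continuous_on_C_times: "C_times k f \<Longrightarrow> continuous_on A (f :: real^'n \<Rightarrow> real)"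
proof (induction k)
  case 0 then show ?case using continuous_on_subset by auto
next
  case (Suc k) then show ?case using C_times_Suc_imp by blast
qed

lemma integrable_continuous_compact_support:
  fixes f :: "'a::euclidean_space \<Rightarrow> 'b::euclidean_space"
  assumes "continuous_on UNIV f" "compact K" "\<And>x. x \<notin> K \<Longrightarrow> f x = 0"
  shows "integrable lebesgue f" and "integrable lborel f"
proof -
  have "continuous_on K f" using assms(1) continuous_on_subset by blast
  then have "integrable lborel (\<lambda>x. indicator K x *\<^sub>R f x)"
    using borel_integrable_compact[OF assms(2)] by blast
  also have "(\<lambda>x. indicator K x *\<^sub>R f x) = f" using assms(3) by (auto simp: indicator_def)
  finally show "integrable lborel f" .
  then show "integrable lebesgue f"
    using integrable_completion borel_measurable_integrable by blast
qed

text \<open>The half-width \<open>1 / d\<close> puts the box into the unit ball, by the bound of the Euclidean norm by the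
  \<open>\<ell>\<^sup>1\<close>-norm.\<close>

definition unit_box_bump :: "real^'n \<Rightarrow> real" where
  "unit_box_bump = box_bump (\<chi> i. - 1 / CARD('n)) (\<chi> i. 1 / CARD('n))"

lemma unit_box_bump_outside: "norm (x :: real^'n) > 1 \<Longrightarrow> unit_box_bump x = 0"
proof (rule ccontr)
  assume "norm x > 1" "unit_box_bump x \<noteq> 0"
  then have "x \<in> box (\<chi> i. - 1 / CARD('n)) (\<chi> i. 1 / CARD('n))"
    using box_bump_outside by (auto simp: unit_box_bump_def)
  then have "\<bar>x $ i\<bar> \<le> 1 / CARD('n)" for i by (auto simp: mem_box_cart abs_le_iff) (smt (verit, best))+
  then have "(\<Sum>i\<in>UNIV. \<bar>x $ i\<bar>) \<le> (\<Sum>i\<in>(UNIV::'n set). 1 / CARD('n))" by (intro sum_mono) auto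
  then show False using norm_le_l1_cart[of x] \<open>norm x > 1\<close> by simp
qed

definition bump_mass :: "'n::finite itself \<Rightarrow> real" where
  "bump_mass _ = (LINT x|lebesgue. unit_box_bump (x :: real^'n))"

lemma unit_box_bump_integrable: "integrable lebesgue (unit_box_bump :: real^'n \<Rightarrow> real)"
  by (rule integrable_continuous_compact_support(1)[of _ "cball 0 1"])
    (use continuous_on_C_times[OF C_times_box_bump] unit_box_bump_outside in \<open>auto simp: unit_box_bump_def not_le\<close>)

lemma bump_mass_pos: "0 < bump_mass TYPE('n::finite)"
proof -
  let ?B = "box (\<chi> i. - 1 / CARD('n)) (\<chi> i. 1 / CARD('n)) :: (real^'n) set"
  have ge: "0 \<le> bump_mass TYPE('n)" unfolding bump_mass_def
    by (intro Bochner_Integration.integral_nonneg) (auto simp: unit_box_bump_def box_bump_nonneg)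
  moreover have "bump_mass TYPE('n) \<noteq> 0"
  proof
    assume "bump_mass TYPE('n) = 0"
    then have "AE x in lebesgue. unit_box_bump (x :: real^'n) = 0"
      unfolding bump_mass_def
      by (subst (asm) integral_nonneg_eq_0_iff_AE[OF unit_box_bump_integrable])
         (auto simp: unit_box_bump_def box_bump_nonneg)
    then have "AE x in lebesgue. x \<notin> ?B"
      by eventually_elim (use box_bump_pos in \<open>force simp: unit_box_bump_def\<close>)
    then have "?B \<in> null_sets lebesgue"
      by (subst AE_iff_null_sets) auto
    then have "negligible ?B" by (simp add: negligible_iff_null_sets)
    then have "?B = {}" using open_not_negligible[OF open_box] by blast
    moreover have "0 \<in> ?B" by (auto simp: mem_box_cart)
    ultimately show False by blast
  qed
  ultimately show ?thesis by simp
qed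

text \<open>The standard mollifier of mass one for the ball of radius \<open>r\<close> about \<open>c\<close>. The argument
  \<open>(x - c) / r\<close> is written as a dilation plus a translation, the form that \<open>C_times_dilate\<close> covers.\<close>

definition bump :: "real^'n \<Rightarrow> real \<Rightarrow> real^'n \<Rightarrow> real" where
  "bump c r x = unit_box_bump ((1/r) *\<^sub>R x + - (1/r) *\<^sub>R c) / (bump_mass TYPE('n) * r ^ CARD('n))"

lemma C_times_bump: "C_times k (bump c r :: real^'n \<Rightarrow> real)"
proof -
  have "C_times k (\<lambda>x. (1 / (bump_mass TYPE('n) * r ^ CARD('n))) * unit_box_bump ((1/r) *\<^sub>R x + - (1/r) *\<^sub>R c :: real^'n))"
    by (intro C_times_mult C_times_const C_times_dilate) (simp add: unit_box_bump_def C_times_box_bump)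
  then show ?thesis by (simp add: bump_def[abs_def])
qed

lemma bump_outside: "0 < r \<Longrightarrow> x \<notin> cball c r \<Longrightarrow> bump c r x = 0"
proof -
  assume *: "0 < r" "x \<notin> cball c r"
  have "(1/r) *\<^sub>R x + - (1/r) *\<^sub>R c = (1/r) *\<^sub>R (x - c)" by (simp add: algebra_simps)
  then have "norm ((1/r) *\<^sub>R x + - (1/r) *\<^sub>R c) = dist c x / r" using * by (simp add: dist_norm norm_minus_commute)
  then show ?thesis using * by (auto simp: bump_def intro!: unit_box_bump_outside)
qed

lemma bump_nonneg: "0 < r \<Longrightarrow> 0 \<le> bump c r x"
  by (auto simp: bump_def unit_box_bump_def box_bump_nonneg bump_mass_pos less_imp_le)

lemma bump_le: "0 < r \<Longrightarrow> bump c r (x :: real^'n) \<le> 1 / (bump_mass TYPE('n) * r ^ CARD('n))"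
  unfolding bump_def by (intro divide_right_mono)
    (auto simp: unit_box_bump_def box_bump_le_1 bump_mass_pos less_imp_le)

lemma bump_integrable: "0 < r \<Longrightarrow> integrable lebesgue (bump c r)"
  by (rule integrable_continuous_compact_support(1)[of _ "cball c r"])
    (use continuous_on_C_times[OF C_times_bump] bump_outside in auto)

lemma bump_integral:
  fixes c :: "real^'n"
  shows "0 < r \<Longrightarrow> (LINT x|lebesgue. bump c r x) = 1"
proof -
  assume r: "0 < r"
  let ?f = "\<lambda>x :: real^'n. unit_box_bump ((1/r) *\<^sub>R x + - (1/r) *\<^sub>R c)"
  have cu: "continuous_on UNIV (unit_box_bump :: real^'n \<Rightarrow> real)"
    by (simp add: unit_box_bump_def continuous_on_C_times[OF C_times_box_bump])
  then have m: "unit_box_bump \<in> borel_measurable (borel :: (real^'n) measure)"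
    by (rule borel_measurable_continuous_onI)
  then have mf: "?f \<in> borel_measurable borel" by measurable
  have "(LINT x|lebesgue. ?f x) = (LINT x|lborel. ?f x)"
    using mf by (intro integral_completion) auto
  also have "\<dots> = (LINT x|density (distr lborel borel (\<lambda>x. c + r *\<^sub>R x)) (\<lambda>_. ennreal (\<bar>r\<bar>^DIM(real^'n))). ?f x)"
    using lborel_affine[of r c] r by simp
  also have "\<dots> = (LINT x|distr lborel borel (\<lambda>x. c + r *\<^sub>R x). \<bar>r\<bar>^DIM(real^'n) *\<^sub>R ?f x)"
    using mf by (subst integral_density) auto
  also have "\<dots> = (LINT x|lborel. \<bar>r\<bar>^DIM(real^'n) *\<^sub>R ?f (c + r *\<^sub>R x))"
    using mf by (subst integral_distr) auto
  also have "\<dots> = (LINT x|lborel. r ^ CARD('n) * unit_box_bump (x :: real^'n))"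
    using r by (simp add: algebra_simps)
  also have "\<dots> = r ^ CARD('n) * bump_mass TYPE('n)"
    using m by (simp add: bump_mass_def integral_completion)
  finally show ?thesis using r bump_mass_pos[where 'n='n] by (simp add: bump_def[abs_def])
qed

section \<open>Null sets and square integrability\<close>

lemma GDERIV_unique: "GDERIV f x :> D \<Longrightarrow> GDERIV f x :> D' \<Longrightarrow> D = (D' :: 'a::euclidean_space)"
  unfolding gderiv_def by (metis has_derivative_unique vector_eq_ldot)

text \<open>Lebesgue measure is complete, so measurability survives a change on a null set. This and the next
  lemma serve to pass between a closed element, its interior and the elementwise gradient, which is
  undetermined on the boundary of the elements.\<close>

lemma lebesgue_measurable_AE_cong:
  fixes f g :: "'a::euclidean_space \<Rightarrow> 'b::topological_space"
  assumes f: "f \<in> borel_measurable lebesgue" and N: "negligible N" and eq: "\<And>x. x \<notin> N \<Longrightarrow> f x = g x"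
  shows "g \<in> borel_measurable lebesgue"
proof (rule measurableI)
  fix B :: "'b set" assume B: "B \<in> sets borel"
  have 1: "f -` B - N \<in> sets lebesgue"
    using measurable_sets[OF f B] negligible_imp_sets[OF N] by auto
  have 2: "g -` B \<inter> N \<in> sets lebesgue"
    by (intro negligible_imp_sets negligible_subset[OF N]) auto
  have "g -` B = (f -` B - N) \<union> (g -` B \<inter> N)" using eq by auto
  then show "g -` B \<inter> space lebesgue \<in> sets lebesgue" using sets.Un[OF 1 2] by (metis Int_UNIV_right space_completion space_lborel space_borel)
qed auto

lemma
  fixes f g :: "'a::euclidean_space \<Rightarrow> 'b::euclidean_space"
  assumes S: "S \<in> sets lebesgue" and T: "T \<in> sets lebesgue" and N: "negligible N"
    and ST: "\<And>x. x \<notin> N \<Longrightarrow> x \<in> S \<longleftrightarrow> x \<in> T" and eq: "\<And>x. x \<in> S \<Longrightarrow> x \<notin> N \<Longrightarrow> f x = g x"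
  shows borel_measurable_transfer:
      "f \<in> borel_measurable (lebesgue_on S) \<Longrightarrow> g \<in> borel_measurable (lebesgue_on T)"
    and integrable_transfer: "integrable (lebesgue_on S) f \<Longrightarrow> integrable (lebesgue_on T) g"
    and integral_transfer: "f \<in> borel_measurable (lebesgue_on S) \<Longrightarrow>
      integral\<^sup>L (lebesgue_on S) f = integral\<^sup>L (lebesgue_on T) g"
proof -
  let ?f = "\<lambda>x. indicator S x *\<^sub>R f x" let ?g = "\<lambda>x. indicator T x *\<^sub>R g x"
  have eq': "?f x = ?g x" if "x \<notin> N" for x using ST[OF that] eq[OF _ that] by (auto simp: indicator_def)
  have AE: "AE x in lebesgue. ?f x = ?g x"
    using N eq' by (intro AE_I'[of N]) (auto simp: negligible_iff_null_sets)
  have m: "?g \<in> borel_measurable lebesgue" if "?f \<in> borel_measurable lebesgue"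
    using lebesgue_measurable_AE_cong[OF that N eq'] .
  show *: "g \<in> borel_measurable (lebesgue_on T)" if "f \<in> borel_measurable (lebesgue_on S)"
    using m that S T by (simp add: borel_measurable_restrict_space_iff)
  show "integrable (lebesgue_on T) g" if "integrable (lebesgue_on S) f"
  proof -
    have "integrable lebesgue ?f" using that S by (simp add: integrable_restrict_space)
    then have "integrable lebesgue ?g" using m AE borel_measurable_integrable[OF \<open>integrable lebesgue ?f\<close>]
      by (subst integrable_cong_AE[where g = ?f]) auto
    then show ?thesis using T by (simp add: integrable_restrict_space)
  qed
  show "integral\<^sup>L (lebesgue_on S) f = integral\<^sup>L (lebesgue_on T) g"
    if fm: "f \<in> borel_measurable (lebesgue_on S)"
  proof -
    have "?f \<in> borel_measurable lebesgue" using fm S by (simp add: borel_measurable_restrict_space_iff)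
    then have "integral\<^sup>L lebesgue ?f = integral\<^sup>L lebesgue ?g" using m AE by (intro integral_cong_AE) auto
    then show ?thesis using S T by (simp add: integral_restrict_space)
  qed
qed

lemma integral_on_superset_of_support:
  fixes f :: "'a::euclidean_space \<Rightarrow> 'b::euclidean_space"
  assumes "U \<in> sets lebesgue" "\<And>x. x \<notin> U \<Longrightarrow> f x = 0"
  shows "integral\<^sup>L (lebesgue_on U) f = integral\<^sup>L lebesgue f"
    and "integrable (lebesgue_on U) f \<longleftrightarrow> integrable lebesgue f"
proof -
  have "(\<lambda>x. indicator U x *\<^sub>R f x) = f" using assms(2) by (auto simp: indicator_def)
  then show "integral\<^sup>L (lebesgue_on U) f = integral\<^sup>L lebesgue f"
    and "integrable (lebesgue_on U) f \<longleftrightarrow> integrable lebesgue f"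
    using assms(1) by (simp_all add: integral_restrict_space integrable_restrict_space)
qed

lemma compact_in_lebesgue: "compact K \<Longrightarrow> K \<in> sets lebesgue"
  using lmeasurable_compact fmeasurableD by blast

lemma integrable_lebesgue_on_subset:
  fixes f :: "'a::euclidean_space \<Rightarrow> 'b::euclidean_space"
  assumes "integrable (lebesgue_on S) f" "S \<in> sets lebesgue" "T \<in> sets lebesgue" "T \<subseteq> S"
  shows "integrable (lebesgue_on T) f"
proof -
  have "set_integrable lebesgue S f" using assms by (simp add: set_integrable_def integrable_restrict_space)
  then have "set_integrable lebesgue T f" using assms set_integrable_subset by blast
  then show ?thesis using assms by (simp add: set_integrable_def integrable_restrict_space)
qed

lemma measurable_on_subset:
  assumes "f \<in> borel_measurable (lebesgue_on S)" "T \<subseteq> S"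
  shows "f \<in> borel_measurable (lebesgue_on T)"
  using assms measurable_restrict_mono by blast

lemma square_integrable_subset:
  "f square_integrable_on S \<Longrightarrow> S \<in> sets lebesgue \<Longrightarrow> T \<in> sets lebesgue \<Longrightarrow> T \<subseteq> S \<Longrightarrow> f square_integrable_on T"
  unfolding square_integrable_on_def using measurable_on_subset integrable_lebesgue_on_subset by blast

lemma norm_add_sq: "(norm (a + b))\<^sup>2 \<le> 2 * (norm a)\<^sup>2 + 2 * (norm (b :: 'b::real_normed_vector))\<^sup>2"
proof -
  have "(norm (a + b))\<^sup>2 \<le> (norm a + norm b)\<^sup>2" by (intro power_mono norm_triangle_ineq) auto
  also have "\<dots> \<le> 2 * (norm a)\<^sup>2 + 2 * (norm b)\<^sup>2" using sum_squares_bound[of "norm a" "norm b"] by (simp add: power2_sum)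
  finally show ?thesis .
qed

lemma square_integrable_add:
  fixes f g :: "real^'n \<Rightarrow> 'b::euclidean_space"
  assumes "f square_integrable_on S" "g square_integrable_on S"
  shows "(\<lambda>x. f x + g x) square_integrable_on S"
    and "(LINT x|lebesgue_on S. (norm (f x + g x))\<^sup>2) \<le>
      2 * (LINT x|lebesgue_on S. (norm (f x))\<^sup>2) + 2 * (LINT x|lebesgue_on S. (norm (g x))\<^sup>2)"
proof -
  have [measurable]: "f \<in> borel_measurable (lebesgue_on S)" "g \<in> borel_measurable (lebesgue_on S)"
    and i: "integrable (lebesgue_on S) (\<lambda>x. (norm (f x))\<^sup>2)" "integrable (lebesgue_on S) (\<lambda>x. (norm (g x))\<^sup>2)"
    using assms by (auto simp: square_integrable_on_def)
  have i2: "integrable (lebesgue_on S) (\<lambda>x. 2 * (norm (f x))\<^sup>2 + 2 * (norm (g x))\<^sup>2)" using i by auto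
  have i3: "integrable (lebesgue_on S) (\<lambda>x. (norm (f x + g x))\<^sup>2)"
    by (rule Bochner_Integration.integrable_bound[OF i2]) (auto intro: norm_add_sq)
  then show "(\<lambda>x. f x + g x) square_integrable_on S" by (auto simp: square_integrable_on_def)
  show "(LINT x|lebesgue_on S. (norm (f x + g x))\<^sup>2) \<le>
      2 * (LINT x|lebesgue_on S. (norm (f x))\<^sup>2) + 2 * (LINT x|lebesgue_on S. (norm (g x))\<^sup>2)"
    using integral_mono[OF i3 i2] norm_add_sq i by auto
qed

lemma square_integrable_uminus:
  fixes f :: "real^'n \<Rightarrow> 'b::euclidean_space"
  shows "f square_integrable_on S \<Longrightarrow> (\<lambda>x. - f x) square_integrable_on S"
  by (auto simp: square_integrable_on_def)

lemma square_integrable_diff: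
  fixes f g :: "real^'n \<Rightarrow> 'b::euclidean_space"
  assumes "f square_integrable_on S" "g square_integrable_on S"
  shows "(\<lambda>x. f x - g x) square_integrable_on S"
  using square_integrable_add(1)[OF assms(1) square_integrable_uminus[OF assms(2)]] by simp

lemma integrable_continuous_on_compact:
  fixes f :: "real^'n \<Rightarrow> 'b::euclidean_space"
  assumes "continuous_on K f" "compact K"
  shows "integrable (lebesgue_on K) f"
proof -
  have "integrable lborel (\<lambda>x. indicator K x *\<^sub>R f x)"
    using borel_integrable_compact[OF assms(2,1)] by blast
  then have "integrable lebesgue (\<lambda>x. indicator K x *\<^sub>R f x)"
    using integrable_completion borel_measurable_integrable by blast
  then show ?thesis using assms by (simp add: integrable_restrict_space compact_in_lebesgue)
qed

lemma square_integrable_continuous: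
  fixes f :: "real^'n \<Rightarrow> 'b::euclidean_space"
  assumes "continuous_on K f" "compact K"
  shows "f square_integrable_on K"
proof -
  have "continuous_on K (\<lambda>x. (norm (f x))\<^sup>2)" using assms by (intro continuous_intros)
  then show ?thesis unfolding square_integrable_on_def
    using integrable_continuous_on_compact[OF _ assms(2)]
      borel_measurable_integrable[OF integrable_continuous_on_compact[OF assms]] by blast
qed

text \<open>The Cauchy-Schwarz inequality against the constant one, from the nonnegative integral of
  \<open>(t |f| - s)\<^sup>2\<close> with \<open>t = |S|\<close> and \<open>s = \<integral> |f|\<close>.\<close>

lemma square_of_integral_le:
  fixes f :: "real^'n \<Rightarrow> 'b::euclidean_space"
  assumes f: "f square_integrable_on S" and S: "S \<in> lmeasurable"
  shows "integrable (lebesgue_on S) f"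
    and "(LINT x|lebesgue_on S. norm (f x))\<^sup>2 \<le> measure lebesgue S * (LINT x|lebesgue_on S. (norm (f x))\<^sup>2)"
proof -
  have [measurable]: "f \<in> borel_measurable (lebesgue_on S)"
    and i: "integrable (lebesgue_on S) (\<lambda>x. (norm (f x))\<^sup>2)" using f by (auto simp: square_integrable_on_def)
  have const: "integrable (lebesgue_on S) (\<lambda>x. c :: real)" for c
    by (intro finite_measure.integrable_const finite_measure_lebesgue_on S)
  have "integrable (lebesgue_on S) (\<lambda>x. 1 + (norm (f x))\<^sup>2)" using const i by auto
  then show int: "integrable (lebesgue_on S) f"
  proof (rule Bochner_Integration.integrable_bound)
    have "norm (f x) \<le> 1 + (norm (f x))\<^sup>2" for x
      using sum_squares_bound[of "norm (f x)" 1] norm_ge_zero[of "f x"] by (simp del: norm_ge_zero)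
    then show "AE x in lebesgue_on S. norm (f x) \<le> norm (1 + (norm (f x))\<^sup>2)" by auto
  qed auto
  let ?I = "LINT x|lebesgue_on S. norm (f x)" let ?m = "measure lebesgue S" let ?Q = "LINT x|lebesgue_on S. (norm (f x))\<^sup>2"
  have m: "measure (lebesgue_on S) S = ?m"
    using S measure_restrict_space[of S lebesgue S] by (simp add: fmeasurableD)
  have eq: "(LINT x|lebesgue_on S. (t * norm (f x) - s)\<^sup>2) = t\<^sup>2 * ?Q - 2 * t * s * ?I + s\<^sup>2 * ?m" for t s :: real
  proof -
    have "(LINT x|lebesgue_on S. (t * norm (f x) - s)\<^sup>2) =
       (LINT x|lebesgue_on S. t\<^sup>2 * (norm (f x))\<^sup>2 - 2 * t * s * norm (f x) + s\<^sup>2)"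
      by (rule Bochner_Integration.integral_cong) (auto simp: power2_eq_square algebra_simps)
    also have "\<dots> = t\<^sup>2 * ?Q - 2 * t * s * ?I + s\<^sup>2 * ?m"
      using i int const by (subst Bochner_Integration.integral_add Bochner_Integration.integral_diff; auto simp: m)+
    finally show ?thesis .
  qed
  have nn: "0 \<le> t\<^sup>2 * ?Q - 2 * t * s * ?I + s\<^sup>2 * ?m" for t s :: real
    unfolding eq[symmetric] by (rule Bochner_Integration.integral_nonneg) auto
  show "?I\<^sup>2 \<le> ?m * ?Q"
  proof (cases "?m = 0")
    case True
    have "0 \<le> ?Q - 2 * ((?Q + 1) / (2 * ?I)) * ?I" using nn[of 1 "(?Q + 1) / (2 * ?I)"] True by simp
    then have "?I = 0" by (cases "?I = 0") (auto simp: field_simps)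
    then show ?thesis using True by simp
  next
    case False
    then have "0 < ?m" by (simp add: less_le)
    have "0 \<le> ?m\<^sup>2 * ?Q - 2 * ?m * ?I * ?I + ?I\<^sup>2 * ?m" using nn[of ?m ?I] .
    also have "\<dots> = ?m * (?m * ?Q - ?I\<^sup>2)" by (simp add: power2_eq_square algebra_simps)
    finally show ?thesis using \<open>0 < ?m\<close> by (simp add: zero_le_mult_iff)
  qed
qed

lemma square_integrable_imp_locally_integrable:
  assumes "f square_integrable_on S" "S \<in> sets lebesgue"
  shows "f locally_integrable_on S"
  unfolding locally_integrable_on_def
  using assms square_integrable_subset compact_in_lebesgue square_of_integral_le(1) lmeasurable_compact by meson

section \<open>Weak gradients\<close>

lemma test_function_gradient:
  assumes "\<phi> \<in> test_functions U" "\<And>x. GDERIV \<phi> x :> D x"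
  obtains K where "compact K" "K \<subseteq> U" "\<And>x. x \<notin> K \<Longrightarrow> \<phi> x = 0" "\<And>x. x \<notin> K \<Longrightarrow> D x = 0"
    "continuous_on UNIV \<phi>" "continuous_on UNIV D"
proof -
  obtain K where K: "compact K" "K \<subseteq> U" "\<And>x. x \<notin> K \<Longrightarrow> \<phi> x = 0" and C: "\<And>k. C_times k \<phi>"
    using assms(1) by (auto simp: test_functions_def)
  obtain G where G: "\<And>x. GDERIV \<phi> x :> G x" "\<And>i. C_times 0 (\<lambda>x. G x $ i)"
    using C[of "Suc 0"] by auto
  have "G = D" using G assms(2) GDERIV_unique by blast
  then have "continuous_on UNIV (\<lambda>x. \<chi> i. D x $ i)" using G(2) by (intro continuous_on_vec_lambda) auto
  then have cD: "continuous_on UNIV D" by simp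
  have "D x = 0" if "x \<notin> K" for x
  proof -
    have "((\<lambda>x. 0) has_derivative (\<lambda>h. h \<bullet> D x)) (at x)"
      using assms(2)[of x, unfolded gderiv_def]
      by (rule has_derivative_transform_within_open[of _ _ _ _ "- K"])
        (use K that compact_imp_closed in \<open>auto simp: open_Compl\<close>)
    then have "GDERIV (\<lambda>x. 0) x :> D x" by (simp add: gderiv_def)
    then show ?thesis using GDERIV_unique GDERIV_const by blast
  qed
  then show ?thesis using that K cD C[of 0] by auto
qed

lemma integrable_locally_times_continuous:
  fixes w :: "real^'n \<Rightarrow> 'b::euclidean_space" and \<psi> :: "real^'n \<Rightarrow> real"
  assumes w: "w locally_integrable_on U" and K: "compact K" "K \<subseteq> U"
    and \<psi>: "continuous_on UNIV \<psi>" "\<And>x. x \<notin> K \<Longrightarrow> \<psi> x = 0"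
  shows "integrable lebesgue (\<lambda>x. \<psi> x *\<^sub>R w x)"
proof -
  have i: "integrable (lebesgue_on K) w" using w K by (auto simp: locally_integrable_on_def)
  have "bounded (\<psi> ` K)" using K \<psi> compact_continuous_image compact_imp_bounded continuous_on_subset by (metis subset_UNIV)
  then obtain M where M: "\<And>x. x \<in> K \<Longrightarrow> \<bar>\<psi> x\<bar> \<le> M" by (auto simp: bounded_iff)
  have "\<psi> \<in> borel_measurable borel" using \<psi> by (intro borel_measurable_continuous_onI)
  then have [measurable]: "\<psi> \<in> borel_measurable (lebesgue_on K)"
    by (intro measurable_restrict_space1 measurable_completion) simp
  have [measurable]: "w \<in> borel_measurable (lebesgue_on K)" using i by auto
  have iM: "integrable (lebesgue_on K) (\<lambda>x. M *\<^sub>R w x)" using i by auto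
  have bd: "norm (\<psi> x *\<^sub>R w x) \<le> norm (M *\<^sub>R w x)" if "x \<in> K" for x
    using M[OF that] by (auto intro!: mult_right_mono)
  have "integrable (lebesgue_on K) (\<lambda>x. \<psi> x *\<^sub>R w x)"
    by (rule Bochner_Integration.integrable_bound[OF iM]) (use bd in \<open>auto simp: space_restrict_space\<close>)
  then show ?thesis using integral_on_superset_of_support(2)[of K "\<lambda>x. \<psi> x *\<^sub>R w x"] \<psi>(2) K compact_in_lebesgue
    by auto
qed

lemma integrable_locally_times_continuous_vector:
  fixes w :: "real^'n \<Rightarrow> real" and D :: "real^'n \<Rightarrow> real^'n"
  assumes w: "w locally_integrable_on U" and K: "compact K" "K \<subseteq> U"
    and D: "continuous_on UNIV D" "\<And>x. x \<notin> K \<Longrightarrow> D x = 0"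
  shows "integrable lebesgue (\<lambda>x. w x *\<^sub>R D x)"
proof -
  have "integrable lebesgue (\<lambda>x. \<Sum>i\<in>UNIV. (D x $ i *\<^sub>R w x) *\<^sub>R (axis i 1 :: real^'n))"
    by (intro Bochner_Integration.integrable_sum integrable_scaleR_left integrable_locally_times_continuous[OF w K])
      (use D in \<open>auto intro!: continuous_intros\<close>)
  moreover have "(\<lambda>x. \<Sum>i\<in>UNIV. (D x $ i *\<^sub>R w x) *\<^sub>R (axis i 1 :: real^'n)) = (\<lambda>x. w x *\<^sub>R D x)"
    by (auto simp: vec_eq_iff axis_def if_distrib cong: if_cong)
  ultimately show ?thesis by (simp only:)
qed

text \<open>Test functions and their gradients vanish off a compact subset of \<open>U\<close>, so the defining identity may
  be read as one between integrals over the whole space. In this form it restricts to open subsets.\<close>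

lemma has_weak_gradient_iff:
  fixes U :: "(real^'n) set"
  assumes U: "open U"
  shows "has_weak_gradient U u g \<longleftrightarrow> u locally_integrable_on U \<and> g locally_integrable_on U \<and>
     (\<forall>\<phi>\<in>test_functions U. \<forall>D. (\<forall>x. GDERIV \<phi> x :> D x) \<longrightarrow>
        (LINT x|lebesgue. u x *\<^sub>R D x) = - (LINT x|lebesgue. \<phi> x *\<^sub>R g x))"
proof -
  have "(LINT x|lebesgue_on U. u x *\<^sub>R D x) = (LINT x|lebesgue. u x *\<^sub>R D x) \<and>
      (LINT x|lebesgue_on U. \<phi> x *\<^sub>R g x) = (LINT x|lebesgue. \<phi> x *\<^sub>R g x)"
    if \<phi>: "\<phi> \<in> test_functions U" and D: "\<forall>x. GDERIV \<phi> x :> D x" for \<phi> D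
  proof -
    obtain K where "compact K" "K \<subseteq> U" "\<And>x. x \<notin> K \<Longrightarrow> \<phi> x = 0" "\<And>x. x \<notin> K \<Longrightarrow> D x = 0"
      using test_function_gradient[OF \<phi> D[rule_format]] by metis
    then show ?thesis using U by (intro conjI integral_on_superset_of_support(1)) auto
  qed
  then show ?thesis unfolding has_weak_gradient_def by auto
qed

lemma test_functions_mono: "U \<subseteq> V \<Longrightarrow> test_functions U \<subseteq> test_functions V"
  by (auto simp: test_functions_def)

lemma has_weak_gradient_subset:
  fixes U :: "(real^'n) set"
  assumes "has_weak_gradient U u g" "open U" "open V" "V \<subseteq> U"
  shows "has_weak_gradient V u g"
  using assms test_functions_mono[of V U]
  by (auto simp: has_weak_gradient_iff locally_integrable_on_def)

lemma has_weak_gradient_cong: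
  fixes U :: "(real^'n) set"
  assumes "has_weak_gradient U u g" and eq: "\<And>x. x \<in> U \<Longrightarrow> u x = u' x" and U: "open U"
  shows "has_weak_gradient U u' g"
proof -
  have "integrable (lebesgue_on K) u = integrable (lebesgue_on K) u'" if "K \<subseteq> U" for K
    using that eq by (intro Bochner_Integration.integrable_cong) (auto simp: space_restrict_space)
  then have "u' locally_integrable_on U" using assms(1) by (auto simp: has_weak_gradient_def locally_integrable_on_def)
  moreover have e: "(LINT x|lebesgue_on U. u x *\<^sub>R D x) = (LINT x|lebesgue_on U. u' x *\<^sub>R D x)" for D :: "real^'n \<Rightarrow> real^'n"
    using eq by (intro Bochner_Integration.integral_cong) (auto simp: space_restrict_space)
  ultimately show ?thesis using assms(1) unfolding has_weak_gradient_def e[symmetric] by blast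
qed

lemma has_weak_gradient_diff:
  fixes U :: "(real^'n) set"
  assumes ug: "has_weak_gradient U u g" and vh: "has_weak_gradient U v h" and U: "open U"
  shows "has_weak_gradient U (\<lambda>x. u x - v x) (\<lambda>x. g x - h x)"
proof -
  have l: "u locally_integrable_on U" "g locally_integrable_on U" "v locally_integrable_on U" "h locally_integrable_on U"
    using ug vh by (auto simp: has_weak_gradient_def)
  have "(LINT x|lebesgue. (u x - v x) *\<^sub>R D x) = - (LINT x|lebesgue. \<phi> x *\<^sub>R (g x - h x))"
    if \<phi>: "\<phi> \<in> test_functions U" and D: "\<forall>x. GDERIV \<phi> x :> D x" for \<phi> D
  proof -
    obtain K where K: "compact K" "K \<subseteq> U" "\<And>x. x \<notin> K \<Longrightarrow> \<phi> x = 0" "\<And>x. x \<notin> K \<Longrightarrow> D x = 0"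
      "continuous_on UNIV \<phi>" "continuous_on UNIV D"
      using test_function_gradient[OF \<phi> D[rule_format]] by metis
    have "integrable lebesgue (\<lambda>x. u x *\<^sub>R D x)" "integrable lebesgue (\<lambda>x. v x *\<^sub>R D x)"
      "integrable lebesgue (\<lambda>x. \<phi> x *\<^sub>R g x)" "integrable lebesgue (\<lambda>x. \<phi> x *\<^sub>R h x)"
      using integrable_locally_times_continuous_vector integrable_locally_times_continuous l K by blast+
    moreover have "(LINT x|lebesgue. u x *\<^sub>R D x) = - (LINT x|lebesgue. \<phi> x *\<^sub>R g x)"
      "(LINT x|lebesgue. v x *\<^sub>R D x) = - (LINT x|lebesgue. \<phi> x *\<^sub>R h x)"
      using ug vh \<phi> D by (auto simp: has_weak_gradient_iff U)
    ultimately show ?thesis by (simp add: scaleR_diff_left scaleR_diff_right)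
  qed
  then show ?thesis using l by (auto simp: has_weak_gradient_iff U locally_integrable_on_def)
qed

text \<open>On the open box the bump lies in \<open>(0, 1]\<close>, so for \<open>m \<rightarrow> \<infinity>\<close> these test functions converge to the
  indicator function of the box and remain bounded by one.\<close>

lemma box_test_function:
  assumes "cbox a b \<subseteq> U"
  shows "(\<lambda>x. 1 - (1 - box_bump a b x) ^ m) \<in> test_functions U"
proof -
  have "C_times k (\<lambda>x. 1 + (-1) * (1 + (-1) * box_bump a b x) ^ m)" for k
    by (intro C_times_add C_times_mult C_times_const C_times_power C_times_box_bump)
  then have "C_times k (\<lambda>x. 1 - (1 - box_bump a b x) ^ m)" for k by simp
  moreover have "1 - (1 - box_bump a b x) ^ m = 0" if "x \<notin> cbox a b" for x
    using box_bump_outside[of x a b] box_subset_cbox that by (metis diff_zero in_mono power_one right_minus_eq)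
  ultimately show ?thesis using assms by (auto simp: test_functions_def intro!: exI[of _ "cbox a b"])
qed

lemma weakly_zero_imp_box_integral_zero:
  fixes h :: "real^'n \<Rightarrow> 'b::euclidean_space"
  assumes h: "h locally_integrable_on U" and ab: "cbox a b \<subseteq> U"
    and z: "\<And>\<phi>. \<phi> \<in> test_functions U \<Longrightarrow> (LINT x|lebesgue. \<phi> x *\<^sub>R h x) = 0"
  shows "integral (cbox a b) h = 0"
proof -
  let ?\<phi> = "\<lambda>m x. 1 - (1 - box_bump a b x) ^ m"
  let ?F = "\<lambda>x. indicator (cbox a b) x *\<^sub>R h x"
  have "integrable (lebesgue_on (cbox a b)) h" using h ab by (auto simp: locally_integrable_on_def)
  then have iF: "integrable lebesgue ?F" by (simp add: integrable_restrict_space)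
  have cont: "continuous_on UNIV (?\<phi> m)" for m
    by (intro continuous_intros continuous_on_C_times[OF C_times_box_bump])
  have out: "?\<phi> m x = 0" if "x \<notin> cbox a b" for m x
    using box_bump_outside[of x a b] box_subset_cbox that by (metis diff_zero in_mono power_one right_minus_eq)
  have int: "integrable lebesgue (\<lambda>x. ?\<phi> m x *\<^sub>R h x)" for m
    using integrable_locally_times_continuous[OF h compact_cbox ab cont out] .
  have "(\<lambda>m. LINT x|lebesgue. ?\<phi> m x *\<^sub>R h x) \<longlonglongrightarrow> (LINT x|lebesgue. indicator (box a b) x *\<^sub>R ?F x)"
  proof (rule integral_dominated_convergence[where w = "\<lambda>x. norm (?F x)"])
    show "(\<lambda>x. indicator (box a b) x *\<^sub>R ?F x) \<in> borel_measurable lebesgue"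
      by (rule borel_measurable_scaleR[OF borel_measurable_indicator borel_measurable_integrable[OF iF]]) simp
    show "(\<lambda>x. ?\<phi> m x *\<^sub>R h x) \<in> borel_measurable lebesgue" for m using int by auto
    show "integrable lebesgue (\<lambda>x. norm (?F x))" using iF by (rule integrable_norm)
    show "AE x in lebesgue. (\<lambda>m. ?\<phi> m x *\<^sub>R h x) \<longlonglongrightarrow> indicator (box a b) x *\<^sub>R ?F x"
    proof (rule AE_I2)
      fix x
      show "(\<lambda>m. ?\<phi> m x *\<^sub>R h x) \<longlonglongrightarrow> indicator (box a b) x *\<^sub>R ?F x"
      proof (cases "x \<in> box a b")
        case True
        have "norm (1 - box_bump a b x) < 1"
          using box_bump_pos[OF True] box_bump_le_1[of a b x] by (simp add: abs_if)
        then have "(\<lambda>m. (1 - box_bump a b x) ^ m) \<longlonglongrightarrow> 0" by (rule LIMSEQ_power_zero)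
        then have "(\<lambda>m. ?\<phi> m x *\<^sub>R h x) \<longlonglongrightarrow> (1 - 0) *\<^sub>R h x"
          by (intro tendsto_scaleR tendsto_diff tendsto_const)
        then show ?thesis using True box_subset_cbox[of a b] by (auto simp: indicator_def)
      next
        case False then show ?thesis by (simp add: box_bump_outside)
      qed
    qed
    show "AE x in lebesgue. norm (?\<phi> m x *\<^sub>R h x) \<le> norm (?F x)" for m
    proof (rule AE_I2)
      fix x
      have "0 \<le> (1 - box_bump a b x) ^ m" "(1 - box_bump a b x) ^ m \<le> 1"
        using box_bump_le_1[of a b x] box_bump_nonneg[of a b x] by (auto intro: power_le_one)
      then have "\<bar>?\<phi> m x\<bar> * norm (h x) \<le> 1 * norm (h x)" by (intro mult_right_mono) auto
      then show "norm (?\<phi> m x *\<^sub>R h x) \<le> norm (?F x)"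
        using out[of x m] by (cases "x \<in> cbox a b") auto
    qed
  qed
  then have "(LINT x|lebesgue. indicator (box a b) x *\<^sub>R ?F x) = 0"
    using z[OF box_test_function[OF ab]] by (simp add: LIMSEQ_const_iff)
  also have "(LINT x|lebesgue. indicator (box a b) x *\<^sub>R ?F x) = integral\<^sup>L lebesgue ?F"
  proof (rule integral_cong_AE)
    have "negligible (cbox a b - box a b)" by (rule negligible_frontier_interval)
    then show "AE x in lebesgue. indicator (box a b) x *\<^sub>R ?F x = ?F x"
      by (intro AE_I'[of "cbox a b - box a b"]) (auto simp: negligible_iff_null_sets indicator_def)
    show "(\<lambda>x. indicator (box a b) x *\<^sub>R ?F x) \<in> borel_measurable lebesgue"
      by (rule borel_measurable_scaleR[OF borel_measurable_indicator borel_measurable_integrable[OF iF]]) simp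
  qed (use iF in auto)
  also have "\<dots> = integral (cbox a b) h"
    using lebesgue_integral_eq_integral[of "cbox a b" h] iF by (simp add: integrable_restrict_space integral_restrict_space)
  finally show ?thesis by simp
qed

text \<open>The fundamental lemma of the calculus of variations. All integrals of \<open>h\<close> over boxes vanish, and at
  almost every point \<open>h\<close> is the limit of its averages over shrinking boxes.\<close>

lemma weakly_zero_imp_AE_zero:
  fixes h :: "real^'n \<Rightarrow> 'b::euclidean_space"
  assumes U: "open U" and h: "h locally_integrable_on U"
    and z: "\<And>\<phi>. \<phi> \<in> test_functions U \<Longrightarrow> (LINT x|lebesgue. \<phi> x *\<^sub>R h x) = 0"
  obtains N where "negligible N" "\<And>x. x \<in> U - N \<Longrightarrow> h x = 0"
proof -
  have box: "\<exists>N. negligible N \<and> (\<forall>x\<in>cbox a b - N. h x = 0)" if ab: "cbox a b \<subseteq> U" for a b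
  proof -
    define f where "f x = (if x \<in> cbox a b then h x else 0)" for x
    have "integrable (lebesgue_on (cbox a b)) h" using h ab by (auto simp: locally_integrable_on_def)
    then have "h integrable_on cbox a b" by (intro integrable_on_lebesgue_on) auto
    then have "f integrable_on UNIV" unfolding f_def by (simp add: integrable_restrict_UNIV)
    then have "f integrable_on cbox c d" for c d by (rule integrable_on_subcbox) auto
    then obtain N where N: "negligible N" and conv: "\<And>x e. \<lbrakk>x \<notin> N; 0 < e\<rbrakk> \<Longrightarrow>
        \<exists>d>0. \<forall>t. 0 < t \<and> t < d \<longrightarrow> norm (integral (cbox x (x + t *\<^sub>R One)) f /\<^sub>R t ^ DIM(real^'n) - f x) < e"
      using integrable_ccontinuous_explicit[of f] by blast
    have "h x = 0" if x: "x \<in> box a b" "x \<notin> N" for x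
    proof (rule ccontr)
      assume "h x \<noteq> 0"
      then obtain d where d: "d > 0" "\<And>t. 0 < t \<Longrightarrow> t < d \<Longrightarrow>
          norm (integral (cbox x (x + t *\<^sub>R One)) f /\<^sub>R t ^ DIM(real^'n) - f x) < norm (h x)"
        using conv[OF x(2), of "norm (h x)"] by auto
      have "((\<lambda>t. x + t *\<^sub>R One) \<longlongrightarrow> x) (at_right (0::real))" by (auto intro!: tendsto_eq_intros)
      from topological_tendstoD[OF this open_box x(1)]
      have "eventually (\<lambda>t. x + t *\<^sub>R One \<in> box a b) (at_right (0::real))" .
      moreover have "eventually (\<lambda>t. 0 < t \<and> t < d) (at_right (0::real))"
        using d(1) eventually_at_right[of "0::real" 1] by auto
      ultimately obtain t where t: "0 < t" "t < d" "x + t *\<^sub>R One \<in> box a b"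
        using eventually_happens[OF eventually_conj] trivial_limit_at_right_real by blast
      have sub: "cbox x (x + t *\<^sub>R One) \<subseteq> cbox a b"
      proof
        fix z assume z: "z \<in> cbox x (x + t *\<^sub>R One)"
        have "a \<bullet> i \<le> z \<bullet> i \<and> z \<bullet> i \<le> b \<bullet> i" if i: "i \<in> Basis" for i
        proof -
          have "x \<bullet> i \<le> z \<bullet> i" "z \<bullet> i \<le> (x + t *\<^sub>R One) \<bullet> i" using z i by (auto simp only: mem_box)
          moreover have "a \<bullet> i < x \<bullet> i" "(x + t *\<^sub>R One) \<bullet> i < b \<bullet> i" using x(1) t(3) i by (auto simp only: mem_box)
          ultimately show ?thesis by linarith
        qed
        then show "z \<in> cbox a b" by (simp add: mem_box)
      qed
      then have "integral (cbox x (x + t *\<^sub>R One)) f = integral (cbox x (x + t *\<^sub>R One)) h"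
        by (intro integral_cong) (auto simp: f_def)
      also have "\<dots> = 0" using weakly_zero_imp_box_integral_zero[OF h _ z] sub ab by blast
      finally show False using d(2)[OF t(1,2)] x(1) box_subset_cbox[of a b] by (auto simp: f_def)
    qed
    then show ?thesis using N negligible_frontier_interval[of a b]
      by (intro exI[of _ "N \<union> (cbox a b - box a b)"]) (auto intro: negligible_Un)
  qed
  obtain \<D> where \<D>: "countable \<D>" "\<D> \<subseteq> Pow U" "\<And>X. X \<in> \<D> \<Longrightarrow> \<exists>a b. X = cbox a b" "\<Union>\<D> = U"
    by (rule open_countable_Union_open_cbox[OF U]) (rule that)
  have "\<exists>N. negligible N \<and> (\<forall>x\<in>X - N. h x = 0)" if X: "X \<in> \<D>" for X
  proof -
    obtain a b where "X = cbox a b" using \<D>(3)[OF X] by blast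
    then show ?thesis using box[of a b] \<D>(2) X by auto
  qed
  then obtain N where N: "\<And>X. X \<in> \<D> \<Longrightarrow> negligible (N X)" "\<And>X x. X \<in> \<D> \<Longrightarrow> x \<in> X - N X \<Longrightarrow> h x = 0" by metis
  show ?thesis
  proof (rule that)
    show "negligible (\<Union>X\<in>\<D>. N X)" using N(1) \<D>(1) by (intro negligible_countable_Union) auto
    show "h x = 0" if "x \<in> U - (\<Union>X\<in>\<D>. N X)" for x using that \<D>(4) N(2) by blast
  qed
qed

lemma has_weak_gradient_unique:
  fixes U :: "(real^'n) set"
  assumes g: "has_weak_gradient U u g" and h: "has_weak_gradient U u h" and U: "open U"
  obtains N where "negligible N" "\<And>x. x \<in> U - N \<Longrightarrow> g x = h x"
proof -
  have *: "has_weak_gradient U (\<lambda>x. 0) (\<lambda>x. g x - h x)" using has_weak_gradient_diff[OF g h U] by simp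
  have loc: "(\<lambda>x. g x - h x) locally_integrable_on U" using * by (simp add: has_weak_gradient_def)
  have z: "(LINT x|lebesgue. \<phi> x *\<^sub>R (g x - h x)) = 0" if \<phi>: "\<phi> \<in> test_functions U" for \<phi>
  proof -
    obtain D where "\<forall>x. GDERIV \<phi> x :> D x" using \<phi> by (auto simp: test_functions_def dest!: spec[of _ "Suc 0"])
    then show ?thesis using * \<phi> by (auto simp: has_weak_gradient_iff[OF U])
  qed
  then obtain N where "negligible N" "\<And>x. x \<in> U - N \<Longrightarrow> g x - h x = 0"
    using weakly_zero_imp_AE_zero[OF U loc z] by blast
  then show ?thesis using that by auto
qed

text \<open>By uniqueness almost everywhere, any weak gradient may stand for the one chosen in the definition of
  the energy norm.\<close>

lemma energy_norm_eq:
  fixes \<omega> :: "(real^'n) set"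
  assumes wg: "has_weak_gradient (interior \<omega>) w g" and g: "g square_integrable_on \<omega>"
    and \<omega>: "\<omega> \<in> sets lebesgue" "negligible (\<omega> - interior \<omega>)"
  shows "energy_norm \<epsilon> \<omega> w =
    sqrt ((LINT x|lebesgue_on \<omega>. (norm (w x))\<^sup>2) + \<epsilon> * (LINT x|lebesgue_on \<omega>. (norm (g x))\<^sup>2))"
proof -
  have "has_weak_gradient (interior \<omega>) w (weak_gradient (interior \<omega>) w)"
    unfolding weak_gradient_def using someI_ex[of "has_weak_gradient (interior \<omega>) w"] wg by blast
  then obtain N where N: "negligible N" "\<And>x. x \<in> interior \<omega> - N \<Longrightarrow> g x = weak_gradient (interior \<omega>) w x"
    using has_weak_gradient_unique[OF wg _ open_interior] by metis
  have "(\<lambda>x. (norm (g x))\<^sup>2) \<in> borel_measurable (lebesgue_on \<omega>)"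
    using g by (auto simp: square_integrable_on_def)
  then have "(LINT x|lebesgue_on \<omega>. (norm (g x))\<^sup>2) = (LINT x|lebesgue_on \<omega>. (norm (weak_gradient (interior \<omega>) w x))\<^sup>2)"
    by (rule integral_transfer[OF \<omega>(1,1) negligible_Un[OF N(1) \<omega>(2)], rotated -1]) (use N(2) in auto)
  then show ?thesis by (simp add: energy_norm_def L2norm_def Bochner_Integration.integral_nonneg)
qed

section \<open>Polynomials\<close>

text \<open>For a continuous piecewise polynomial this is the elementwise gradient off the element boundaries;
  the arbitrary values there form a null set.\<close>

definition grad :: "(real^'n \<Rightarrow> real) \<Rightarrow> real^'n \<Rightarrow> real^'n" where
  "grad f x = (SOME D. GDERIV f x :> D)"

lemma grad_eq: "GDERIV f x :> D \<Longrightarrow> grad f x = D"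
  unfolding grad_def using GDERIV_unique by (metis someI_ex)

lemma finite_multi_indices: "finite {\<alpha> :: 'n::finite \<Rightarrow> nat. (\<Sum>i\<in>UNIV. \<alpha> i) \<le> l}"
proof (rule finite_subset)
  show "{\<alpha> :: 'n \<Rightarrow> nat. (\<Sum>i\<in>UNIV. \<alpha> i) \<le> l} \<subseteq> PiE UNIV (\<lambda>_. {..l})"
    by (auto intro: order.trans[OF member_le_sum[of _ UNIV]])
qed (auto intro: finite_PiE)

text \<open>Degree bounds, derivatives, restrictions to lines and the expansion in nodal basis functions are all
  compatible with sums and with multiplication by a coordinate; this rule reduces each of them to those
  two operations and avoids multi-indices.\<close>

lemma polynomials_upto_induct [consumes 1, case_names const add scale coord mono]:
  assumes p: "p \<in> polynomials_upto l"
    and const: "\<And>c m. Q m (\<lambda>x :: real^'n. c)"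
    and add: "\<And>m p q. Q m p \<Longrightarrow> Q m q \<Longrightarrow> Q m (\<lambda>x. p x + q x)"
    and scale: "\<And>m p c. Q m p \<Longrightarrow> Q m (\<lambda>x. c * p x)"
    and coord: "\<And>m p i. Q m p \<Longrightarrow> Q (Suc m) (\<lambda>x. x $ i * p x)"
    and mono: "\<And>m n p. Q m p \<Longrightarrow> m \<le> n \<Longrightarrow> Q n p"
  shows "Q l p"
proof -
  have monom: "Q n (\<lambda>x. \<Prod>i\<in>UNIV. (x $ i) ^ \<alpha> i)" if "(\<Sum>i\<in>UNIV. \<alpha> i) = n" for n and \<alpha> :: "'n \<Rightarrow> nat"
    using that
  proof (induction n arbitrary: \<alpha>)
    case 0
    then have "\<And>i. \<alpha> i = 0" by simp
    then show ?case using const by simp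
  next
    case (Suc n)
    then have "\<exists>i. \<alpha> i \<noteq> 0" by (metis nat.distinct(1) sum.neutral)
    then obtain i where i: "\<alpha> i > 0" by blast
    let ?\<beta> = "\<alpha>(i := \<alpha> i - 1)"
    have "(\<Sum>j\<in>UNIV. \<alpha> j) = \<alpha> i + (\<Sum>j\<in>UNIV - {i}. \<alpha> j)" "(\<Sum>j\<in>UNIV. ?\<beta> j) = ?\<beta> i + (\<Sum>j\<in>UNIV - {i}. ?\<beta> j)"
      by (simp_all only: sum.remove[OF finite_class.finite_UNIV UNIV_I[of i]])
    moreover have "(\<Sum>j\<in>UNIV - {i}. ?\<beta> j) = (\<Sum>j\<in>UNIV - {i}. \<alpha> j)" by (rule sum.cong) auto
    ultimately have "(\<Sum>j\<in>UNIV. ?\<beta> j) = n" using Suc.prems i by simp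
    then have "Q (Suc n) (\<lambda>x. x $ i * (\<Prod>j\<in>UNIV. (x $ j) ^ ?\<beta> j))" using Suc.IH coord by blast
    moreover have "x $ i * (\<Prod>j\<in>UNIV. (x $ j) ^ ?\<beta> j) = (\<Prod>j\<in>UNIV. (x $ j) ^ \<alpha> j)" for x :: "real^'n"
    proof -
      have "(\<Prod>j\<in>UNIV. (x $ j) ^ ?\<beta> j) = (x $ i) ^ (\<alpha> i - 1) * (\<Prod>j\<in>UNIV - {i}. (x $ j) ^ ?\<beta> j)"
        by (simp only: prod.remove[OF finite_class.finite_UNIV UNIV_I[of i]]) simp
      also have "(\<Prod>j\<in>UNIV - {i}. (x $ j) ^ ?\<beta> j) = (\<Prod>j\<in>UNIV - {i}. (x $ j) ^ \<alpha> j)" by (rule prod.cong) auto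
      also have "x $ i * ((x $ i) ^ (\<alpha> i - 1) * (\<Prod>j\<in>UNIV - {i}. (x $ j) ^ \<alpha> j)) =
          (x $ i) ^ \<alpha> i * (\<Prod>j\<in>UNIV - {i}. (x $ j) ^ \<alpha> j)"
        using i power_minus_mult[of "\<alpha> i" "x $ i"] by (simp add: mult_ac)
      also have "\<dots> = (\<Prod>j\<in>UNIV. (x $ j) ^ \<alpha> j)"
        by (simp only: prod.remove[OF finite_class.finite_UNIV UNIV_I[of i]])
      finally show ?thesis .
    qed
    ultimately show ?case by simp
  qed
  have sum: "Q l (\<lambda>x. \<Sum>\<alpha>\<in>A. c \<alpha> * (\<Prod>i\<in>UNIV. (x $ i) ^ \<alpha> i))"
    if "A \<subseteq> {\<alpha>. (\<Sum>i\<in>UNIV. \<alpha> i) \<le> l}" for A c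
    using that
  proof (induction A rule: infinite_finite_induct)
    case (insert \<alpha> A)
    then have "Q l (\<lambda>x. c \<alpha> * (\<Prod>i\<in>UNIV. (x $ i) ^ \<alpha> i))"
      using mono[OF scale[OF monom[OF refl]]] by auto
    from add[OF this] insert show ?case by simp
  qed (auto intro: const)
  then show ?thesis using p by (auto simp: polynomials_upto_def)
qed

lemma polynomials_upto_add:
  "p \<in> polynomials_upto l \<Longrightarrow> q \<in> polynomials_upto l \<Longrightarrow> (\<lambda>x :: real^'n. p x + q x) \<in> polynomials_upto l"
  unfolding polynomials_upto_def by clarsimp (rule exI, simp add: sum.distrib[symmetric] distrib_right[symmetric])

lemma polynomials_upto_scale:
  "p \<in> polynomials_upto l \<Longrightarrow> (\<lambda>x :: real^'n. c * p x) \<in> polynomials_upto l"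
  unfolding polynomials_upto_def by clarsimp (rule exI, simp add: sum_distrib_left mult.assoc[symmetric])

lemma polynomials_upto_mono:
  assumes "p \<in> polynomials_upto l" "l \<le> m"
  shows "p \<in> polynomials_upto m"
proof -
  let ?A = "\<lambda>l. {\<alpha> :: 'a \<Rightarrow> nat. (\<Sum>i\<in>UNIV. \<alpha> i) \<le> l}"
  obtain c where c: "p = (\<lambda>x. \<Sum>\<alpha>\<in>?A l. c \<alpha> * (\<Prod>i\<in>UNIV. (x $ i) ^ \<alpha> i))"
    using assms by (auto simp: polynomials_upto_def)
  have "p = (\<lambda>x. \<Sum>\<alpha>\<in>?A m. (if \<alpha> \<in> ?A l then c \<alpha> else 0) * (\<Prod>i\<in>UNIV. (x $ i) ^ \<alpha> i))"
    unfolding c using assms(2) by (intro ext sum.mono_neutral_cong_left finite_multi_indices) auto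
  then show ?thesis unfolding polynomials_upto_def
    by (intro CollectI exI[of _ "\<lambda>\<alpha>. if \<alpha> \<in> ?A l then c \<alpha> else 0"])
qed

lemma polynomials_upto_const: "(\<lambda>x :: real^'n. c) \<in> polynomials_upto l"
proof -
  have "{\<alpha> :: 'n \<Rightarrow> nat. (\<Sum>i\<in>UNIV. \<alpha> i) \<le> 0} = {\<lambda>_. 0}" by auto
  then have "(\<lambda>x :: real^'n. c) \<in> polynomials_upto 0"
    unfolding polynomials_upto_def by (auto intro!: exI[of _ "\<lambda>_. c"])
  then show ?thesis using polynomials_upto_mono by blast
qed

lemma polynomials_upto_coord:
  assumes "p \<in> polynomials_upto l"
  shows "(\<lambda>x :: real^'n. x $ i * p x) \<in> polynomials_upto (Suc l)"
proof -
  let ?A = "\<lambda>l. {\<alpha> :: 'n \<Rightarrow> nat. (\<Sum>i\<in>UNIV. \<alpha> i) \<le> l}"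
  let ?m = "\<lambda>\<alpha> x. \<Prod>j\<in>UNIV. (x $ j) ^ \<alpha> j :: real"
  let ?up = "\<lambda>\<alpha>. \<alpha>(i := Suc (\<alpha> i))"
  obtain c where c: "p = (\<lambda>x. \<Sum>\<alpha>\<in>?A l. c \<alpha> * ?m \<alpha> x)"
    using assms by (auto simp: polynomials_upto_def)
  have inj: "inj_on ?up (?A l)"
  proof (rule inj_onI)
    fix \<alpha> \<beta> assume eq: "?up \<alpha> = ?up \<beta>"
    have "\<alpha> j = \<beta> j" for j using fun_cong[OF eq, of j] by (cases "j = i") auto
    then show "\<alpha> = \<beta>" by auto
  qed
  have upm: "?m (?up \<alpha>) x = x $ i * ?m \<alpha> x" for \<alpha> x
  proof -
    have "(\<Prod>j\<in>UNIV - {i}. (x $ j) ^ ?up \<alpha> j) = (\<Prod>j\<in>UNIV - {i}. (x $ j) ^ \<alpha> j)" by (rule prod.cong) auto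
    then show ?thesis by (simp only: prod.remove[OF finite_class.finite_UNIV UNIV_I[of i]]) simp
  qed
  have upA: "?up ` ?A l \<subseteq> ?A (Suc l)"
  proof clarify
    fix \<alpha> :: "'n \<Rightarrow> nat" assume "(\<Sum>j\<in>UNIV. \<alpha> j) \<le> l"
    moreover have "(\<Sum>j\<in>UNIV - {i}. ?up \<alpha> j) = (\<Sum>j\<in>UNIV - {i}. \<alpha> j)" by (rule sum.cong) auto
    ultimately show "(\<Sum>j\<in>UNIV. ?up \<alpha> j) \<le> Suc l"
      by (simp only: sum.remove[OF finite_class.finite_UNIV UNIV_I[of i]]) simp
  qed
  \<comment> \<open>multi-indices without a factor \<open>x\<^sub>i\<close> are not hit and get the coefficient zero\<close>
  let ?c = "\<lambda>\<beta>. if \<beta> \<in> ?up ` ?A l then c (the_inv_into (?A l) ?up \<beta>) else 0"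
  have "x $ i * p x = (\<Sum>\<beta>\<in>?A (Suc l). ?c \<beta> * ?m \<beta> x)" for x
  proof -
    have "(\<Sum>\<beta>\<in>?A (Suc l). ?c \<beta> * ?m \<beta> x) = (\<Sum>\<beta>\<in>?up ` ?A l. ?c \<beta> * ?m \<beta> x)"
      using upA by (intro sum.mono_neutral_right finite_multi_indices) auto
    also have "\<dots> = (\<Sum>\<alpha>\<in>?A l. ?c (?up \<alpha>) * ?m (?up \<alpha>) x)" by (rule sum.reindex_cong[OF inj]) auto
    also have "\<dots> = (\<Sum>\<alpha>\<in>?A l. x $ i * (c \<alpha> * ?m \<alpha> x))"
    proof (rule sum.cong[OF refl])
      fix \<alpha> assume \<alpha>: "\<alpha> \<in> ?A l"
      have "the_inv_into (?A l) ?up (?up \<alpha>) = \<alpha>" using the_inv_into_f_f[OF inj \<alpha>] .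
      moreover have "?up \<alpha> \<in> ?up ` ?A l" using \<alpha> by (rule imageI)
      ultimately show "?c (?up \<alpha>) * ?m (?up \<alpha>) x = x $ i * (c \<alpha> * ?m \<alpha> x)" by (simp only: upm if_True mult_ac)
    qed
    finally show ?thesis unfolding c by (simp only: sum_distrib_left)
  qed
  then show ?thesis unfolding polynomials_upto_def by (intro CollectI exI[of _ ?c] ext)
qed

lemma polynomials_upto_sum:
  "(\<And>i. i \<in> A \<Longrightarrow> f i \<in> polynomials_upto l) \<Longrightarrow> (\<lambda>x :: real^'n. \<Sum>i\<in>A. f i x) \<in> polynomials_upto l"
  by (induction A rule: infinite_finite_induct) (auto intro: polynomials_upto_const polynomials_upto_add)

lemma polynomials_upto_diff:
  "p \<in> polynomials_upto l \<Longrightarrow> q \<in> polynomials_upto l \<Longrightarrow> (\<lambda>x :: real^'n. p x - q x) \<in> polynomials_upto l"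
  using polynomials_upto_add[OF _ polynomials_upto_scale[of q l "-1"]] by simp

lemma polynomials_upto_affine_mult:
  assumes "p \<in> polynomials_upto l"
  shows "(\<lambda>x :: real^'n. (g \<bullet> x + b) * p x) \<in> polynomials_upto (Suc l)"
proof -
  have "(\<lambda>x. (\<Sum>i\<in>UNIV. g $ i * (x $ i * p x)) + b * p x) \<in> polynomials_upto (Suc l)"
    by (intro polynomials_upto_add polynomials_upto_sum polynomials_upto_scale polynomials_upto_coord assms
        polynomials_upto_mono[OF assms]) auto
  then show ?thesis by (simp add: inner_vec_def distrib_right sum_distrib_right mult.assoc)
qed

lemma polynomials_upto_affine_prod:
  assumes "finite A"
  shows "(\<lambda>x :: real^'n. \<Prod>i\<in>A. (g i \<bullet> x + b i)) \<in> polynomials_upto (card A)"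
  using assms
  by (induction A rule: finite_induct) (simp_all add: polynomials_upto_const polynomials_upto_affine_mult)

lemma polynomials_upto_GDERIV:
  assumes "p \<in> polynomials_upto l"
  shows "GDERIV p x :> grad p x" and "(\<lambda>x :: real^'n. grad p x $ i) \<in> polynomials_upto l"
proof -
  have "\<exists>G. (\<forall>x. GDERIV p x :> G x) \<and> (\<forall>i. (\<lambda>x. G x $ i) \<in> polynomials_upto l) \<and> p \<in> polynomials_upto l"
    using assms
  proof (induction rule: polynomials_upto_induct)
    case (const c m)
    then show ?case by (intro exI[of _ "\<lambda>_. 0"]) (simp add: GDERIV_const polynomials_upto_const)
  next
    case (add m p q)
    then obtain G H where "\<forall>x. GDERIV p x :> G x" "\<forall>i. (\<lambda>x. G x $ i) \<in> polynomials_upto m"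
      "\<forall>x. GDERIV q x :> H x" "\<forall>i. (\<lambda>x. H x $ i) \<in> polynomials_upto m" by blast
    with add show ?case by (intro exI[of _ "\<lambda>x. G x + H x"]) (auto intro: GDERIV_add polynomials_upto_add)
  next
    case (scale m p c)
    then obtain G where G: "\<And>x. GDERIV p x :> G x" "\<forall>i. (\<lambda>x. G x $ i) \<in> polynomials_upto m" by blast
    have "GDERIV (\<lambda>x. c * p x) x :> c *\<^sub>R G x" for x
      using GDERIV_mult[OF GDERIV_const[of c] G(1)[of x]] by simp
    with scale G show ?case
      by (intro exI[of _ "\<lambda>x. c *\<^sub>R G x"]) (auto intro: polynomials_upto_scale)
  next
    case (coord m p j)
    then obtain G where G: "\<forall>x. GDERIV p x :> G x" "\<forall>i. (\<lambda>x. G x $ i) \<in> polynomials_upto m"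
      and p: "p \<in> polynomials_upto m" by blast
    have *: "GDERIV (\<lambda>x. x $ j) x :> axis j 1" for x :: "real^'n"
      unfolding gderiv_def by (simp add: inner_axis bounded_linear_imp_has_derivative bounded_linear_vec_nth)
    have **: "(\<lambda>x. axis j 1 $ i * p x) \<in> polynomials_upto (Suc m)" for i
      using polynomials_upto_scale[OF polynomials_upto_mono[OF p, of "Suc m"]] by auto
    show ?case using GDERIV_mult[OF * G(1)[rule_format]] polynomials_upto_coord[OF p]
        polynomials_upto_add[OF polynomials_upto_coord[OF G(2)[rule_format]] **]
      by (intro exI[of _ "\<lambda>x. x $ j *\<^sub>R G x + p x *\<^sub>R axis j 1"]) (auto simp: mult.commute)
  next
    case (mono m n p) then show ?case using polynomials_upto_mono by meson
  qed
  then obtain G where G: "\<And>x. GDERIV p x :> G x" "\<And>i. (\<lambda>x. G x $ i) \<in> polynomials_upto l" by blast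
  then have "grad p = G" using grad_eq by blast
  then show "GDERIV p x :> grad p x" "(\<lambda>x. grad p x $ i) \<in> polynomials_upto l" using G by auto
qed

lemma continuous_on_polynomials_upto: "p \<in> polynomials_upto l \<Longrightarrow> continuous_on A p"
  using polynomials_upto_GDERIV(1) unfolding gderiv_def
  by (meson continuous_at_imp_continuous_on has_derivative_continuous)

lemma continuous_on_grad_polynomials_upto: "p \<in> polynomials_upto l \<Longrightarrow> continuous_on A (grad p)"
proof -
  assume "p \<in> polynomials_upto l"
  then have "continuous_on A (\<lambda>x. \<chi> i. grad p x $ i)"
    using polynomials_upto_GDERIV(2) continuous_on_polynomials_upto by (intro continuous_on_vec_lambda) blast
  then show ?thesis by simp
qed

lemma polynomials_upto_line:
  assumes "p \<in> polynomials_upto l"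
  shows "\<exists>q. degree q \<le> l \<and> (\<forall>t. p (z + t *\<^sub>R y) = poly q t)"
  using assms
proof (induction rule: polynomials_upto_induct)
  case (const c m) show ?case by (intro exI[of _ "[:c:]"]) simp
next
  case (add m p q)
  then obtain P R where "degree P \<le> m" "\<forall>t. p (z + t *\<^sub>R y) = poly P t" "degree R \<le> m" "\<forall>t. q (z + t *\<^sub>R y) = poly R t" by blast
  then show ?case by (intro exI[of _ "P + R"]) (simp add: degree_add_le)
next
  case (scale m p c)
  then obtain P where "degree P \<le> m" "\<forall>t. p (z + t *\<^sub>R y) = poly P t" by blast
  then show ?case by (intro exI[of _ "Polynomial.smult c P"]) (simp add: degree_smult_le[THEN order.trans])
next
  case (coord m p i)
  then obtain P where "degree P \<le> m" "\<forall>t. p (z + t *\<^sub>R y) = poly P t" by blast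
  moreover have "degree ([: z $ i, y $ i :] * P) \<le> Suc m"
    using degree_mult_le[of "[: z $ i, y $ i :]" P] \<open>degree P \<le> m\<close> by (auto split: if_splits)
  ultimately show ?case by (intro exI[of _ "[: z $ i, y $ i :] * P"]) (simp add: algebra_simps)
next
  case (mono m n p) then show ?case by (meson order.trans)
qed

text \<open>Finite differences of order above the degree vanish. In the induction, the factor \<open>j\<close> of
  \<open>j r(j)\<close> is absorbed by \<open>j (n+1 choose j) = (n+1) (n choose j-1)\<close>, which leaves a difference of
  order \<open>n\<close> of the polynomial \<open>r(x + 1)\<close>.\<close>

lemma finite_difference_poly_eq_0:
  fixes q :: "real poly"
  shows "degree q < n \<Longrightarrow> (\<Sum>j\<le>n. (-1) ^ j * real (n choose j) * poly q (real j)) = 0"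
proof (induction n arbitrary: q)
  case (Suc n)
  obtain a r where q: "q = pCons a r" by (cases q)
  have a: "(\<Sum>j\<le>Suc n. (-1) ^ j * real (Suc n choose j) * a) = 0"
    using choose_alternating_sum[of "Suc n", where 'a=real] by (simp only: sum_distrib_right[symmetric])
  have b: "(\<Sum>j\<le>Suc n. (-1) ^ j * real (Suc n choose j) * (real j * poly r (real j))) = 0"
  proof -
    have "(\<Sum>j\<le>Suc n. (-1) ^ j * real (Suc n choose j) * (real j * poly r (real j))) =
      (\<Sum>i\<le>n. (-1) ^ Suc i * real (Suc n choose Suc i) * (real (Suc i) * poly r (real (Suc i))))"
      by (subst sum.atMost_Suc_shift) simp
    also have "\<dots> = (\<Sum>i\<le>n. - real (Suc n) * ((-1) ^ i * real (n choose i) * poly (pcompose r [:1, 1:]) (real i)))"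
    proof (rule sum.cong[OF refl])
      fix i
      have 1: "real (Suc i) * real (Suc n choose Suc i) = real (Suc n) * real (n choose i)"
        by (metis Suc_times_binomial of_nat_mult)
      have 2: "poly (pcompose r [:1, 1:]) (real i) = poly r (real (Suc i))"
        by (simp add: poly_pcompose add.commute)
      have 3: "(-1) ^ Suc i * X * (Y * P) = - ((-1) ^ i * (Y * X) * P)" for X Y P :: real by simp
      have 4: "- ((-1) ^ i * (Y * X) * P) = - Y * ((-1) ^ i * X * P)" for X Y P :: real by simp
      show "(-1) ^ Suc i * real (Suc n choose Suc i) * (real (Suc i) * poly r (real (Suc i))) =
        - real (Suc n) * ((-1) ^ i * real (n choose i) * poly (pcompose r [:1, 1:]) (real i))"
        unfolding 2 3 1 by (rule 4)
    qed
    also have "\<dots> = - real (Suc n) * (\<Sum>i\<le>n. (-1) ^ i * real (n choose i) * poly (pcompose r [:1, 1:]) (real i))"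
      by (simp only: sum_distrib_left)
    also have "\<dots> = 0"
    proof (cases "r = 0")
      case False
      then have "degree (pcompose r [:1, 1:]) < n" using Suc.prems q by (simp add: degree_pcompose)
      from Suc.IH[OF this] show ?thesis by simp
    qed (simp add: pcompose_0)
    finally show ?thesis .
  qed
  show ?case using a b unfolding q by (simp only: poly_pCons distrib_left sum.distrib)
qed simp

section \<open>Inverse estimate\<close>

text \<open>The contraction \<open>y \<mapsto> z + t (y - z)\<close> maps the convex set \<open>K\<close> into itself and scales volumes by
  \<open>t\<^sup>d\<close>.\<close>

lemma integral_contraction_le:
  fixes f :: "real^'n \<Rightarrow> real"
  assumes f: "continuous_on UNIV f" "\<And>x. 0 \<le> f x" and K: "compact K" "convex K" "z \<in> K" and t: "0 < t" "t \<le> 1"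
  shows "(LINT y|lebesgue_on K. f (z + t *\<^sub>R (y - z))) \<le> (1 / t) ^ CARD('n) * (LINT x|lebesgue_on K. f x)"
proof -
  let ?F = "\<lambda>x. indicator K x *\<^sub>R f x" let ?c = "z - t *\<^sub>R z"
  have Fi: "integrable lborel ?F" using f(1) K by (intro borel_integrable_compact) (auto intro: continuous_on_subset)
  then have Fm[measurable]: "?F \<in> borel_measurable borel" using borel_measurable_integrable by fastforce
  then have Fm'[measurable]: "(\<lambda>x. indicat_real K x * f x) \<in> borel_measurable borel" by simp
  have L: "lborel = density (distr lborel borel (\<lambda>x. ?c + t *\<^sub>R x)) (\<lambda>_. ennreal (\<bar>t\<bar>^DIM(real^'n)))"
    using lborel_affine[of t ?c] t by simp
  have i1: "integrable (density (distr lborel borel (\<lambda>x. ?c + t *\<^sub>R x)) (\<lambda>_. ennreal (\<bar>t\<bar>^DIM(real^'n)))) ?F"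
    using Fi L by simp
  then have "integrable (distr lborel borel (\<lambda>x. ?c + t *\<^sub>R x)) (\<lambda>x. t ^ CARD('n) *\<^sub>R ?F x)"
    using t by (subst (asm) integrable_density) auto
  then have i2: "integrable lborel (\<lambda>x. t ^ CARD('n) *\<^sub>R ?F (?c + t *\<^sub>R x))"
    by (subst (asm) integrable_distr_eq) auto
  then have i3: "integrable lborel (\<lambda>x. ?F (?c + t *\<^sub>R x))" using t by simp
  have "(LINT x|lborel. ?F x) = (LINT x|lborel. t ^ CARD('n) *\<^sub>R ?F (?c + t *\<^sub>R x))"
    using t by (subst L, subst integral_density, simp, simp, simp, subst integral_distr) auto
  also have "\<dots> = t ^ CARD('n) * (LINT x|lborel. ?F (?c + t *\<^sub>R x))" by simp
  finally have e1: "(LINT x|lborel. ?F (?c + t *\<^sub>R x)) = (1 / t) ^ CARD('n) * (LINT x|lborel. ?F x)"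
    using t by (simp add: field_simps)
  have conv: "z + t *\<^sub>R (y - z) \<in> K" if "y \<in> K" for y
    using convexD[OF K(2) K(3) that, of "1 - t" t] t by (simp add: algebra_simps)
  have eqarg: "z + t *\<^sub>R (y - z) = ?c + t *\<^sub>R y" for y by (simp add: algebra_simps)
  have g: "continuous_on UNIV (\<lambda>y. f (z + t *\<^sub>R (y - z)))"
    by (rule continuous_on_compose2[OF f(1)]) (auto intro!: continuous_intros)
  have i4: "integrable lborel (\<lambda>y. indicator K y *\<^sub>R f (z + t *\<^sub>R (y - z)))"
    using g K by (intro borel_integrable_compact) (auto intro: continuous_on_subset)
  have "(LINT y|lborel. indicator K y *\<^sub>R f (z + t *\<^sub>R (y - z))) \<le> (LINT y|lborel. ?F (?c + t *\<^sub>R y))"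
    using i4 i3 conv f(2) unfolding eqarg by (intro integral_mono) (auto simp: indicator_def)
  also note e1
  finally have "(LINT y|lborel. indicator K y *\<^sub>R f (z + t *\<^sub>R (y - z))) \<le> (1 / t) ^ CARD('n) * (LINT x|lborel. ?F x)" .
  then show ?thesis using Fi i4 K
    by (simp add: integral_restrict_space compact_in_lebesgue integral_completion borel_measurable_integrable
       del: real_scaleR_def)
qed

definition inverse_const :: "nat \<Rightarrow> nat \<Rightarrow> real" where
  "inverse_const d l = (2 ^ Suc l * real (Suc l) ^ d)\<^sup>2"

lemma inverse_const_pos: "0 < inverse_const d l" by (simp add: inverse_const_def)

text \<open>The value at \<open>z\<close> is extrapolated from \<open>l + 1\<close> equidistant points on the segment from \<open>z\<close> to
  \<open>y\<close>, since the difference of order \<open>l + 1\<close> of \<open>p\<close> along the segment is zero.\<close>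

lemma polynomial_extrapolation:
  assumes "p \<in> polynomials_upto l"
  shows "\<bar>p z\<bar> \<le> (\<Sum>j=1..Suc l. real (Suc l choose j) * \<bar>p (z + (real j / real (Suc l)) *\<^sub>R (y - z))\<bar>)"
proof -
  obtain q where q: "degree q \<le> l" "\<forall>t. p (z + t *\<^sub>R ((1 / real (Suc l)) *\<^sub>R (y - z))) = poly q t"
    using polynomials_upto_line[OF assms] by blast
  have "0 = (\<Sum>j\<le>Suc l. (-1) ^ j * real (Suc l choose j) * poly q (real j))"
    using finite_difference_poly_eq_0[of q "Suc l"] q(1) by simp
  also have "\<dots> = poly q 0 + (\<Sum>j=1..Suc l. (-1) ^ j * real (Suc l choose j) * poly q (real j))"
    by (simp add: sum.atLeast_Suc_atMost atMost_atLeast0 del: sum.cl_ivl_Suc)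
  finally have "\<bar>poly q 0\<bar> = \<bar>\<Sum>j=1..Suc l. (-1) ^ j * real (Suc l choose j) * poly q (real j)\<bar>" by linarith
  also have "\<dots> \<le> (\<Sum>j=1..Suc l. \<bar>(-1) ^ j * real (Suc l choose j) * poly q (real j)\<bar>)" by (rule sum_abs)
  also have "\<dots> = (\<Sum>j=1..Suc l. real (Suc l choose j) * \<bar>poly q (real j)\<bar>)" by (simp only: abs_mult power_abs) simp
  finally show ?thesis using q(2)[rule_format, of 0] q(2)[rule_format, of "real _", symmetric] by simp
qed

text \<open>Averaging the extrapolation formula over all \<open>y \<in> K\<close> bounds \<open>|p z|\<close> by the mean of \<open>|p|\<close> over
  \<open>K\<close>. Of \<open>K\<close> only convexity enters, and therefore the constant depends on degree and dimension alone.\<close>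

lemma polynomial_inverse_estimate:
  fixes K :: "(real^'n) set"
  assumes p: "p \<in> polynomials_upto l" and K: "compact K" "convex K" "z \<in> K"
  shows "(p z)\<^sup>2 * measure lebesgue K \<le> inverse_const CARD('n) l * (LINT x|lebesgue_on K. (p x)\<^sup>2)"
proof -
  let ?m = "measure lebesgue K" let ?n = "Suc l"
  have cp: "continuous_on A p" for A using continuous_on_polynomials_upto[OF p] .
  have cz: "continuous_on UNIV (\<lambda>y. p (z + t *\<^sub>R (y - z)))" for t
    by (rule continuous_on_compose2[OF cp[of UNIV]]) (auto intro!: continuous_intros)
  have Kl: "K \<in> lmeasurable" using K(1) by (rule lmeasurable_compact)
  let ?I = "LINT x|lebesgue_on K. \<bar>p x\<bar>"
  have I0: "0 \<le> ?I" by (rule Bochner_Integration.integral_nonneg) auto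
  have int: "integrable (lebesgue_on K) (\<lambda>y. \<bar>p (z + t *\<^sub>R (y - z))\<bar>)" for t
    using cz[of t] K(1) by (intro integrable_continuous_on_compact continuous_intros) (auto intro: continuous_on_subset)
  have mK: "measure (lebesgue_on K) K = ?m" using Kl by (simp add: measure_restrict_space fmeasurableD)
  have "?m * \<bar>p z\<bar> = (LINT y|lebesgue_on K. \<bar>p z\<bar>)" using mK by simp
  also have "\<dots> \<le> (LINT y|lebesgue_on K. (\<Sum>j=1..?n. real (?n choose j) * \<bar>p (z + (real j / real ?n) *\<^sub>R (y - z))\<bar>))"
    using polynomial_extrapolation[OF p] int
    by (intro integral_mono finite_measure.integrable_const finite_measure_lebesgue_on Kl Bochner_Integration.integrable_sum) auto
  also have "\<dots> = (\<Sum>j=1..?n. real (?n choose j) * (LINT y|lebesgue_on K. \<bar>p (z + (real j / real ?n) *\<^sub>R (y - z))\<bar>))"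
    using int by (subst Bochner_Integration.integral_sum) auto
  also have "\<dots> \<le> (\<Sum>j=1..?n. real (?n choose j) * (real ?n ^ CARD('n) * ?I))"
  proof (intro sum_mono mult_left_mono)
    fix j assume j: "j \<in> {1..?n}"
    have "(LINT y|lebesgue_on K. \<bar>p (z + (real j / real ?n) *\<^sub>R (y - z))\<bar>) \<le> (1 / (real j / real ?n)) ^ CARD('n) * ?I"
      using j by (intro integral_contraction_le K continuous_intros cp) auto
    also have "\<dots> \<le> real ?n ^ CARD('n) * ?I"
      using j I0 mult_left_mono[of 1 "real j" "real ?n"]
      by (intro mult_right_mono power_mono) (auto simp: divide_simps)
    finally show "(LINT y|lebesgue_on K. \<bar>p (z + (real j / real ?n) *\<^sub>R (y - z))\<bar>) \<le> real ?n ^ CARD('n) * ?I" .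
  qed simp
  also have "\<dots> = (\<Sum>j=1..?n. real (?n choose j)) * (real ?n ^ CARD('n) * ?I)" by (simp only: sum_distrib_right)
  also have "\<dots> \<le> 2 ^ ?n * (real ?n ^ CARD('n) * ?I)"
  proof (intro mult_right_mono)
    have "(\<Sum>j=1..?n. ?n choose j) \<le> (\<Sum>j\<le>?n. ?n choose j)" by (intro sum_mono2) auto
    also have "\<dots> = 2 ^ ?n" by (rule choose_row_sum)
    finally have "real (\<Sum>j=1..?n. ?n choose j) \<le> real (2 ^ ?n)" by (simp only: of_nat_le_iff)
    then show "(\<Sum>j=1..?n. real (?n choose j)) \<le> 2 ^ ?n" by (simp only: of_nat_sum of_nat_power of_nat_numeral)
  qed (use I0 in auto)
  finally have "(?m * \<bar>p z\<bar>)\<^sup>2 \<le> (2 ^ ?n * (real ?n ^ CARD('n) * ?I))\<^sup>2" by (intro power_mono) auto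
  also have "\<dots> = inverse_const CARD('n) l * ?I\<^sup>2" by (simp only: inverse_const_def power_mult_distrib mult_ac)
  also have "\<dots> \<le> inverse_const CARD('n) l * (?m * (LINT x|lebesgue_on K. (p x)\<^sup>2))"
    using square_of_integral_le(2)[OF square_integrable_continuous[OF cp K(1)] Kl] inverse_const_pos[of "CARD('n)" l]
    by (intro mult_left_mono) auto
  finally have "?m * (?m * (p z)\<^sup>2) \<le> ?m * (inverse_const CARD('n) l * (LINT x|lebesgue_on K. (p x)\<^sup>2))"
    by (simp add: power_mult_distrib power2_eq_square mult_ac)
  then show ?thesis
    using measure_nonneg[of lebesgue K] inverse_const_pos[of "CARD('n)" l]
    by (cases "?m = 0") (auto simp: mult.commute mult_le_cancel_left Bochner_Integration.integral_nonneg)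
qed

lemma polynomial_gradient_inverse_estimate:
  fixes K :: "(real^'n) set"
  assumes p: "p \<in> polynomials_upto l" and K: "compact K" "convex K" "z \<in> K"
  shows "(norm (grad p z))\<^sup>2 * measure lebesgue K \<le>
    inverse_const CARD('n) l * (LINT x|lebesgue_on K. (norm (grad p x))\<^sup>2)"
proof -
  have n: "(norm (grad p x))\<^sup>2 = (\<Sum>i\<in>UNIV. (grad p x $ i)\<^sup>2)" for x
    unfolding power2_norm_eq_inner inner_vec_def by (simp add: power2_eq_square)
  have "integrable (lebesgue_on K) (\<lambda>x. (grad p x $ i)\<^sup>2)" for i
    using K(1) continuous_on_grad_polynomials_upto[OF p] by (intro integrable_continuous_on_compact continuous_intros)
  then have "(LINT x|lebesgue_on K. (norm (grad p x))\<^sup>2) = (\<Sum>i\<in>UNIV. (LINT x|lebesgue_on K. (grad p x $ i)\<^sup>2))"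
    unfolding n by (rule Bochner_Integration.integral_sum)
  then show ?thesis unfolding n sum_distrib_right sum_distrib_left
    using polynomial_inverse_estimate[OF polynomials_upto_GDERIV(2)[OF p] K]
    by (simp add: sum_distrib_left sum_mono)
qed

lemma polynomial_oscillation_estimate:
  fixes K :: "(real^'n) set"
  assumes p: "p \<in> polynomials_upto l" and K: "compact K" "convex K" "z \<in> K" "y \<in> K"
  shows "(p z - p y)\<^sup>2 * measure lebesgue K \<le>
    (diameter K)\<^sup>2 * inverse_const CARD('n) l * (LINT x|lebesgue_on K. (norm (grad p x))\<^sup>2)"
proof (cases "measure lebesgue K = 0")
  case True then show ?thesis by (auto simp: less_imp_le inverse_const_pos Bochner_Integration.integral_nonneg)
next
  case False
  let ?m = "measure lebesgue K" let ?R = "inverse_const CARD('n) l * (LINT x|lebesgue_on K. (norm (grad p x))\<^sup>2)"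
  have m: "0 < ?m" using False by (simp add: less_le)
  have R: "0 \<le> ?R" by (auto simp: less_imp_le inverse_const_pos Bochner_Integration.integral_nonneg)
  let ?B = "sqrt (?R / ?m)"
  have "norm (p z - p y) \<le> ?B * norm (z - y)"
  proof (rule differentiable_bound[OF K(2), where f = p and f' = "\<lambda>x h. h \<bullet> grad p x"])
    show "(p has_derivative (\<lambda>h. h \<bullet> grad p x)) (at x within K)" for x
      using polynomials_upto_GDERIV(1)[OF p, of x, unfolded gderiv_def] by (rule has_derivative_at_withinI)
    show "onorm (\<lambda>h. h \<bullet> grad p x) \<le> ?B" if x: "x \<in> K" for x
    proof (rule onorm_le)
      fix h :: "real^'n"
      have "norm (grad p x) \<le> ?B"
        using polynomial_gradient_inverse_estimate[OF p K(1,2) x] m by (intro real_le_rsqrt) (simp add: field_simps)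
      then have "norm h * norm (grad p x) \<le> norm h * ?B" by (intro mult_left_mono) auto
      then show "norm (h \<bullet> grad p x) \<le> ?B * norm h"
        using Cauchy_Schwarz_ineq2[of h "grad p x"] by (simp add: mult.commute)
    qed
  qed (use K in auto)
  also have "\<dots> \<le> ?B * diameter K"
    using diameter_bounded_bound[OF compact_imp_bounded[OF K(1)] K(3,4)] R m
    by (intro mult_left_mono) (auto simp: dist_norm)
  finally have "\<bar>p z - p y\<bar>\<^sup>2 \<le> (?B * diameter K)\<^sup>2" by (intro power_mono) auto
  also have "\<dots> = ?R / ?m * (diameter K)\<^sup>2" using R m by (simp add: power_mult_distrib)
  finally show ?thesis using m by (simp add: field_simps)
qed

section \<open>Barycentric coordinates\<close>

definition verts :: "(real^'n) set \<Rightarrow> (real^'n) set" where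
  "verts K = {a. a extreme_point_of K}"

abbreviation full_simplex :: "(real^'n) set \<Rightarrow> bool" where
  "full_simplex K \<equiv> int CARD('n) simplex K"

lemma convex_hull_verts:
  assumes "\<not> affine_dependent C"
  shows "verts (convex hull C) = C"
  using extreme_point_of_convex_hull_affine_independent[OF assms] by (auto simp: verts_def)

lemma full_simplex_verts:
  fixes K :: "(real^'n) set"
  assumes "full_simplex K"
  shows "\<not> affine_dependent (verts K)" "card (verts K) = CARD('n) + 1" "K = convex hull (verts K)" "finite (verts K)"
    "affine hull (verts K) = UNIV"
proof -
  obtain C where C: "\<not> affine_dependent C" "int (card C) = int CARD('n) + 1" "K = convex hull C"
    using assms by (auto simp: simplex_def)
  have v: "verts K = C" using C convex_hull_verts by blast
  show "\<not> affine_dependent (verts K)" "card (verts K) = CARD('n) + 1" "K = convex hull (verts K)" using C v by auto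
  show "finite (verts K)" using v C(1) aff_independent_finite by blast
  have "aff_dim C = int DIM(real^'n)" using aff_dim_affine_independent[OF C(1)] C(2) by simp
  then show "affine hull (verts K) = UNIV" unfolding v using aff_dim_eq_full by blast
qed

lemma full_simplex_compact: "full_simplex K \<Longrightarrow> compact K"
  using full_simplex_verts(3,4) compact_convex_hull finite_imp_compact by metis

lemma full_simplex_convex: "full_simplex K \<Longrightarrow> convex K"
  using full_simplex_verts(3) convex_convex_hull by metis

lemma affine_function_exists:
  fixes V :: "(real^'n) set"
  assumes V: "\<not> affine_dependent V" "a \<in> V"
  shows "\<exists>gb. \<forall>c\<in>V. fst gb \<bullet> c + snd gb = (if c = a then 1 else 0 :: real)"
proof (cases "V = {a}")
  case True then show ?thesis by (intro exI[of _ "(0, 1)"]) auto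
next
  case False
  then obtain z where z: "z \<in> V" "z \<noteq> a" using V(2) by blast
  let ?B = "(\<lambda>x. - z + x) ` (V - {z})"
  have "independent ?B" using V(1) affine_dependent_iff_dependent2[OF z(1)] by blast
  then obtain f where f: "linear f" "\<forall>x\<in>?B. f x = (if x = a - z then 1 else 0 :: real)"
    using linear_independent_extend[of ?B "\<lambda>x. if x = a - z then 1 else 0 :: real"] by blast
  have fz: "f (c - z) = (if c = a then 1 else 0)" if "c \<in> V" for c
  proof (cases "c = z")
    case True then show ?thesis using z(2) linear_0[OF f(1)] by simp
  next
    case False
    then have "c - z \<in> ?B" using that by (auto simp: image_iff)
    then show ?thesis using f(2) by auto
  qed
  have "f x = adjoint f 1 \<bullet> x" for x
    using adjoint_works[OF f(1), of x 1] by (simp add: inner_commute)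
  then have "adjoint f 1 \<bullet> c + - f z = (if c = a then 1 else 0)" if "c \<in> V" for c
    using fz[OF that] linear_diff[OF f(1), of c z] by simp
  then show ?thesis by (intro exI[of _ "(adjoint f 1, - f z)"]) auto
qed

text \<open>Gradient and constant term of the affine function that is one at the vertex \<open>a\<close> and zero at the other
  vertices. The value zero for points \<open>a\<close> that are not vertices makes the coordinates of two elements
  comparable on their common face.\<close>

definition bary_fun :: "(real^'n) set \<Rightarrow> real^'n \<Rightarrow> (real^'n) \<times> real" where
  "bary_fun K a = (if a \<in> verts K
     then (SOME gb. \<forall>c\<in>verts K. fst gb \<bullet> c + snd gb = (if c = a then 1 else 0)) else (0, 0))"

definition bary :: "(real^'n) set \<Rightarrow> real^'n \<Rightarrow> real^'n \<Rightarrow> real" where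
  "bary K a x = fst (bary_fun K a) \<bullet> x + snd (bary_fun K a)"

lemma bary_not_vertex: "a \<notin> verts K \<Longrightarrow> bary K a x = 0"
  by (simp add: bary_def bary_fun_def)

lemma bary_vertex:
  assumes "full_simplex K" "c \<in> verts K"
  shows "bary K a c = (if c = a then 1 else 0)"
proof (cases "a \<in> verts K")
  case True
  have "\<forall>c\<in>verts K. fst (bary_fun K a) \<bullet> c + snd (bary_fun K a) = (if c = a then 1 else 0)"
    using someI_ex[OF affine_function_exists[OF full_simplex_verts(1)[OF assms(1)] True]] True
    by (simp add: bary_fun_def)
  then show ?thesis using assms(2) by (simp add: bary_def)
next
  case False then show ?thesis using assms(2) bary_not_vertex by auto
qed

lemma bary_unique:
  fixes K :: "(real^'n) set"
  assumes K: "full_simplex K" and u: "(\<Sum>c\<in>verts K. u c) = 1" "(\<Sum>c\<in>verts K. u c *\<^sub>R c) = x" and a: "a \<in> verts K"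
  shows "bary K a x = u a"
proof -
  note fin = full_simplex_verts(4)[OF K]
  have "bary K a x = fst (bary_fun K a) \<bullet> (\<Sum>c\<in>verts K. u c *\<^sub>R c) + (\<Sum>c\<in>verts K. u c) * snd (bary_fun K a)"
    by (simp add: bary_def u)
  also have "\<dots> = (\<Sum>c\<in>verts K. u c * bary K a c)"
    by (simp add: inner_sum_right sum_distrib_right sum.distrib[symmetric] bary_def distrib_left)
  also have "\<dots> = (\<Sum>c\<in>verts K. if c = a then u a else 0)" using bary_vertex[OF K] by (intro sum.cong) auto
  also have "\<dots> = u a" using a fin by simp
  finally show ?thesis .
qed

lemma bary_sum:
  fixes K :: "(real^'n) set"
  assumes K: "full_simplex K"
  shows "(\<Sum>a\<in>verts K. bary K a x) = 1" "(\<Sum>a\<in>verts K. bary K a x *\<^sub>R a) = x"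
proof -
  have "x \<in> affine hull (verts K)" using full_simplex_verts(5)[OF K] by simp
  then obtain u where u: "(\<Sum>c\<in>verts K. u c) = 1" "(\<Sum>c\<in>verts K. u c *\<^sub>R c) = x"
    using affine_hull_finite[OF full_simplex_verts(4)[OF K]] by auto
  then show "(\<Sum>a\<in>verts K. bary K a x) = 1" "(\<Sum>a\<in>verts K. bary K a x *\<^sub>R a) = x"
    using bary_unique[OF K u] by simp_all
qed

lemma mem_simplex_iff_bary:
  fixes K :: "(real^'n) set"
  assumes K: "full_simplex K"
  shows "x \<in> K \<longleftrightarrow> (\<forall>a\<in>verts K. 0 \<le> bary K a x)"
proof
  assume "x \<in> K"
  then have "x \<in> convex hull (verts K)" using full_simplex_verts(3)[OF K] by simp
  then obtain u where "\<forall>c\<in>verts K. 0 \<le> u c" "(\<Sum>c\<in>verts K. u c) = 1" "(\<Sum>c\<in>verts K. u c *\<^sub>R c) = x"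
    using convex_hull_finite[OF full_simplex_verts(4)[OF K]] by auto
  then show "\<forall>a\<in>verts K. 0 \<le> bary K a x" using bary_unique[OF K] by auto
next
  assume "\<forall>a\<in>verts K. 0 \<le> bary K a x"
  then have "x \<in> convex hull (verts K)"
    using bary_sum[OF K, of x] convex_hull_finite[OF full_simplex_verts(4)[OF K]] by auto
  then show "x \<in> K" using full_simplex_verts(3)[OF K] by simp
qed

lemma bary_bounds:
  assumes K: "full_simplex K" and x: "x \<in> K"
  shows "0 \<le> bary K a x" "bary K a x \<le> 1"
proof -
  show *: "0 \<le> bary K a x" for a using mem_simplex_iff_bary[OF K] x by (cases "a \<in> verts K") (auto simp: bary_not_vertex)
  show "bary K a x \<le> 1"
  proof (cases "a \<in> verts K")
    case True
    then have "bary K a x \<le> (\<Sum>c\<in>verts K. bary K c x)" using full_simplex_verts(4)[OF K] * by (intro member_le_sum) auto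
    then show ?thesis using bary_sum(1)[OF K] by simp
  qed (simp add: bary_not_vertex)
qed

lemma bary_on_face:
  fixes K :: "(real^'n) set"
  assumes K: "full_simplex K" and F: "F face_of K" and x: "x \<in> F"
  shows "verts F \<subseteq> verts K" "\<And>u. (\<Sum>c\<in>verts F. u c) = 1 \<Longrightarrow> (\<Sum>c\<in>verts F. u c *\<^sub>R c) = x \<Longrightarrow>
      bary K a x = (if a \<in> verts F then u a else 0)"
    "\<exists>u. (\<Sum>c\<in>verts F. u c) = 1 \<and> (\<Sum>c\<in>verts F. u c *\<^sub>R c) = x"
proof -
  have Fe: "F face_of convex hull (verts K)" using F full_simplex_verts(3)[OF K] by simp
  obtain C where C: "C \<subseteq> verts K" "F = convex hull C"
    using face_of_convex_hull_affine_independent[OF full_simplex_verts(1)[OF K]] Fe by blast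
  have "\<not> affine_dependent C" using full_simplex_verts(1)[OF K] C(1) affine_dependent_subset by blast
  then have v: "verts F = C" using C(2) convex_hull_verts by blast
  show "verts F \<subseteq> verts K" using v C(1) by simp
  have fin: "finite (verts K)" using full_simplex_verts(4)[OF K] .
  then have finC: "finite C" using C(1) finite_subset by blast
  show "bary K a x = (if a \<in> verts F then u a else 0)"
    if u: "(\<Sum>c\<in>verts F. u c) = 1" "(\<Sum>c\<in>verts F. u c *\<^sub>R c) = x" for u
  proof (cases "a \<in> verts K")
    case True
    let ?u = "\<lambda>c. if c \<in> verts F then u c else 0"
    have "(\<Sum>c\<in>verts K. ?u c) = (\<Sum>c\<in>verts F. u c)"
      using fin C(1) v by (intro sum.mono_neutral_cong_right) auto
    moreover have "(\<Sum>c\<in>verts K. ?u c *\<^sub>R c) = (\<Sum>c\<in>verts F. u c *\<^sub>R c)"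
      using fin C(1) v by (intro sum.mono_neutral_cong_right) auto
    ultimately show ?thesis using bary_unique[OF K, of ?u x a] u True by simp
  next
    case False then show ?thesis using bary_not_vertex[OF False] v C(1) by auto
  qed
  have "x \<in> convex hull C" using x C(2) by simp
  then show "\<exists>u. (\<Sum>c\<in>verts F. u c) = 1 \<and> (\<Sum>c\<in>verts F. u c *\<^sub>R c) = x"
    unfolding v convex_hull_finite[OF finC] by auto
qed

text \<open>On a face only the coordinates of the vertices of the face are nonzero, and these are determined by
  the face.\<close>

lemma bary_eq_on_common_face:
  assumes K: "full_simplex K" "full_simplex K'" and F: "K \<inter> K' face_of K" "K \<inter> K' face_of K'" and x: "x \<in> K \<inter> K'"
  shows "bary K a x = bary K' a x"
proof -
  obtain u where u: "(\<Sum>c\<in>verts (K \<inter> K'). u c) = 1" "(\<Sum>c\<in>verts (K \<inter> K'). u c *\<^sub>R c) = x"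
    using bary_on_face(3)[OF K(1) F(1) x] by blast
  show ?thesis unfolding bary_on_face(2)[OF K(1) F(1) x u] bary_on_face(2)[OF K(2) F(2) x u] ..
qed

section \<open>Size of simplices\<close>

lemma inball_diameter_bdd:
  fixes K :: "(real^'n) set"
  assumes "bounded K"
  shows "bdd_above {diameter (cball x r) | x r. cball x r \<subseteq> K}"
proof (rule bdd_aboveI[of _ "diameter K"])
  fix D assume "D \<in> {diameter (cball x r) | x r. cball x r \<subseteq> K}"
  then obtain x r where "D = diameter (cball x r)" "cball x r \<subseteq> K" by blast
  then show "D \<le> diameter K" using diameter_subset assms by blast
qed

lemma inball_diameter_ge: 
  fixes K :: "(real^'n) set"
  assumes "bounded K" "cball x r \<subseteq> K" "0 \<le> r"
  shows "2 * r \<le> inball_diameter K"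
proof -
  have "diameter (cball x r) \<le> inball_diameter K" unfolding inball_diameter_def
    using assms inball_diameter_bdd by (intro cSup_upper) blast+
  then show ?thesis using assms(3) by (simp add: diameter_cball)
qed

text \<open>Balls of negative radius are empty and hence contained in every set.\<close>

lemma inball_nonempty: "{diameter (cball x r) | x r. cball x r \<subseteq> (K :: (real^'n) set)} \<noteq> {}"
proof -
  have "cball 0 (- 1) \<subseteq> K" by simp
  then show ?thesis by blast
qed

lemma full_simplex_interior_nonempty: 
  fixes K :: "(real^'n) set"
  assumes "full_simplex K"
  shows "interior K \<noteq> {}"
proof -
  have "affine hull K = UNIV"
    using full_simplex_verts(3,5)[OF assms] affine_hull_convex_hull by metis
  then have "rel_interior K = interior K" "K \<noteq> {}" using rel_interior_interior by auto
  then show ?thesis using rel_interior_eq_empty[OF full_simplex_convex[OF assms]] by simp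
qed

lemma inball_diameter_pos:
  fixes K :: "(real^'n) set"
  assumes K: "full_simplex K"
  shows "0 < inball_diameter K"
proof -
  obtain x where "x \<in> interior K" using full_simplex_interior_nonempty[OF K] by blast
  then obtain e where "e > 0" "cball x e \<subseteq> K" using mem_interior_cball by blast
  then show ?thesis using inball_diameter_ge[OF compact_imp_bounded[OF full_simplex_compact[OF K]], of x e] by linarith
qed

lemma inball_diameter_le_diameter:
  fixes K :: "(real^'n) set"
  assumes "full_simplex K"
  shows "inball_diameter K \<le> diameter K"
  unfolding inball_diameter_def
proof (intro cSup_least inball_nonempty)
  fix D assume "D \<in> {diameter (cball x r) | x r. cball x r \<subseteq> K}"
  then obtain x r where "D = diameter (cball x r)" "cball x r \<subseteq> K" by blast
  then show "D \<le> diameter K" using diameter_subset compact_imp_bounded[OF full_simplex_compact[OF assms]] by blast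
qed

text \<open>A radius above a quarter of the inball diameter exists whether or not the supremum is attained.\<close>

lemma obtain_inball:
  fixes K :: "(real^'n) set"
  assumes K: "full_simplex K"
  obtains x r where "cball x r \<subseteq> K" "inball_diameter K / 4 < r"
proof -
  have "inball_diameter K / 2 < Sup {diameter (cball x r) | x r. cball x r \<subseteq> K}"
    using inball_diameter_pos[OF K] by (simp add: inball_diameter_def)
  then obtain x r where xr: "cball x r \<subseteq> K" "inball_diameter K / 2 < diameter (cball x r)"
    using less_cSupE[OF _ inball_nonempty] by blast
  then have "inball_diameter K / 4 < r"
    using inball_diameter_pos[OF K] by (cases "0 \<le> r") (auto simp: diameter_cball)
  then show ?thesis using that xr by blast
qed

text \<open>Between the two ends of a diameter of an inscribed ball in the direction of its gradient, a
  barycentric coordinate changes by at most one.\<close>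

lemma bary_gradient_bound:
  fixes K :: "(real^'n) set"
  assumes K: "full_simplex K"
  shows "norm (fst (bary_fun K a)) * inball_diameter K \<le> 1"
proof (cases "fst (bary_fun K a) = 0")
  case False
  let ?g = "fst (bary_fun K a)"
  have "inball_diameter K \<le> 1 / norm ?g" unfolding inball_diameter_def
  proof (intro cSup_least inball_nonempty)
    fix D assume "D \<in> {diameter (cball x r) |x r. cball x r \<subseteq> K}"
    then obtain x r where xr: "D = diameter (cball x r)" "cball x r \<subseteq> K" by blast
    show "D \<le> 1 / norm ?g"
    proof (cases "0 \<le> r")
      case True
      have "x + (r / norm ?g) *\<^sub>R ?g \<in> K" "x - (r / norm ?g) *\<^sub>R ?g \<in> K"
        using xr(2) True False by (auto simp: dist_norm subset_iff)
      then have "bary K a (x + (r / norm ?g) *\<^sub>R ?g) - bary K a (x - (r / norm ?g) *\<^sub>R ?g) \<le> 1"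
        using bary_bounds[OF K] by (smt (verit))
      then have "2 * (r / norm ?g) * (?g \<bullet> ?g) \<le> 1" by (simp add: bary_def algebra_simps)
      then have "2 * r * norm ?g \<le> 1" using False by (simp add: dot_square_norm power2_eq_square)
      then show ?thesis using False True by (simp add: xr(1) diameter_cball field_simps)
    qed (use False xr in auto)
  qed
  then show ?thesis using False by (simp add: field_simps)
qed simp

lemma full_simplex_measure:
  fixes K :: "(real^'n) set"
  assumes K: "full_simplex K"
  shows "0 < measure lebesgue K" "measure lebesgue K \<le> (2 * diameter K) ^ CARD('n)"
proof -
  have Kl: "K \<in> lmeasurable" using lmeasurable_compact[OF full_simplex_compact[OF K]] .
  have "\<not> negligible K" using full_simplex_interior_nonempty[OF K] open_not_negligible[OF open_interior]
    negligible_subset interior_subset by metis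
  then have "measure lebesgue K \<noteq> 0" using Kl negligible_iff_measure by blast
  then show "0 < measure lebesgue K" by (simp add: less_le)
  obtain z where z: "z \<in> K" using full_simplex_interior_nonempty[OF K] interior_subset by blast
  let ?h = "diameter K"
  have h: "0 \<le> ?h" using diameter_ge_0 compact_imp_bounded full_simplex_compact[OF K] by blast
  let ?a = "z - (\<chi> i. ?h)" let ?b = "z + (\<chi> i. ?h)"
  have "K \<subseteq> cbox ?a ?b"
  proof
    fix y assume "y \<in> K"
    then have "norm (y - z) \<le> ?h"
      using z diameter_bounded_bound[OF compact_imp_bounded[OF full_simplex_compact[OF K]]] by (metis dist_norm)
    then have "\<bar>y $ i - z $ i\<bar> \<le> ?h" for i using component_le_norm_cart[of "y - z" i] by simp
    then show "y \<in> cbox ?a ?b" by (auto simp: mem_box_cart abs_le_iff algebra_simps)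
  qed
  then have "measure lebesgue K \<le> measure lebesgue (cbox ?a ?b)"
    using Kl by (intro measure_mono_fmeasurable) (auto simp: fmeasurableD)
  also have "\<dots> = (\<Prod>i\<in>UNIV. ?b $ i - ?a $ i)"
  proof -
    have "cbox ?a ?b \<noteq> {}" using z \<open>K \<subseteq> _\<close> by blast
    then show ?thesis using content_cbox_cart[of ?a ?b] by (simp add: measure_completion)
  qed
  also have "\<dots> = (2 * ?h) ^ CARD('n)" by simp
  finally show "measure lebesgue K \<le> (2 * diameter K) ^ CARD('n)" .
qed

section \<open>Lagrange basis\<close>

definition node_indices :: "nat \<Rightarrow> (real^'n) set \<Rightarrow> (real^'n \<Rightarrow> nat) set" where
  "node_indices l K = {k. (\<forall>a. a \<notin> verts K \<longrightarrow> k a = 0) \<and> (\<Sum>a\<in>verts K. k a) = l}"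

text \<open>Nodes are labelled by the multiples \<open>k a\<close> of \<open>1/l\<close> that are their barycentric coordinates.\<close>

definition lattice_node :: "nat \<Rightarrow> (real^'n) set \<Rightarrow> (real^'n \<Rightarrow> nat) \<Rightarrow> real^'n" where
  "lattice_node l K k = (\<Sum>a\<in>verts K. (real (k a) / real l) *\<^sub>R a)"

text \<open>The Lagrange functions without their denominators. They are used for indices \<open>k\<close> of any degree
  \<open>m \<le> l\<close>, where they span the polynomials of degree \<open>m\<close>, as Newton polynomials do in one dimension.\<close>

definition newton_fun :: "nat \<Rightarrow> (real^'n) set \<Rightarrow> (real^'n \<Rightarrow> nat) \<Rightarrow> real^'n \<Rightarrow> real" where
  "newton_fun l K k x = (\<Prod>a\<in>verts K. \<Prod>j<k a. (real l * bary K a x - real j))"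

definition lagrange_fun :: "nat \<Rightarrow> (real^'n) set \<Rightarrow> (real^'n \<Rightarrow> nat) \<Rightarrow> real^'n \<Rightarrow> real" where
  "lagrange_fun l K k x = (\<Prod>a\<in>verts K. \<Prod>j<k a. (real l * bary K a x - real j) / (real (k a) - real j))"

lemma simplex_nodes_eq: "simplex_nodes l K = lattice_node l K ` node_indices l K"
proof (intro equalityI subsetI)
  fix z assume "z \<in> simplex_nodes l K"
  then obtain k where k: "z = (\<Sum>a\<in>verts K. (real (k a) / real l) *\<^sub>R a)" "(\<Sum>a\<in>verts K. k a) = l"
    by (auto simp: simplex_nodes_def verts_def)
  let ?k = "\<lambda>a. if a \<in> verts K then k a else 0"
  have "(\<Sum>a\<in>verts K. ?k a) = l" using k(2) by (simp cong: sum.cong)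
  then have "?k \<in> node_indices l K" by (simp add: node_indices_def)
  moreover have "z = lattice_node l K ?k" unfolding k(1) lattice_node_def by (rule sum.cong) auto
  ultimately show "z \<in> lattice_node l K ` node_indices l K" by blast
qed (auto simp: simplex_nodes_def verts_def node_indices_def lattice_node_def)

lemma finite_node_indices:
  fixes K :: "(real^'n) set"
  assumes K: "full_simplex K"
  shows "finite (node_indices l K)" "card (node_indices l K) \<le> (l + 1) ^ (CARD('n) + 1)"
proof -
  let ?r = "\<lambda>k. restrict k (verts K)" let ?P = "PiE (verts K) (\<lambda>_. {..l})"
  note fin = full_simplex_verts(4)[OF K]
  have inj: "inj_on ?r (node_indices l K)"
  proof (rule inj_onI)
    fix k k' assume *: "k \<in> node_indices l K" "k' \<in> node_indices l K" "?r k = ?r k'"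
    have "k a = k' a" for a
    proof (cases "a \<in> verts K")
      case True then show ?thesis using fun_cong[OF *(3), of a] by simp
    qed (use * in \<open>auto simp: node_indices_def\<close>)
    then show "k = k'" by auto
  qed
  have sub: "?r ` node_indices l K \<subseteq> ?P"
  proof (clarsimp simp: node_indices_def)
    fix k a assume "a \<in> verts K" "l = (\<Sum>a\<in>verts K. k a)"
    then show "k a \<le> (\<Sum>a\<in>verts K. k a)" using fin by (intro member_le_sum) auto
  qed
  have finP: "finite ?P" using fin by (intro finite_PiE) auto
  show "finite (node_indices l K)" using finite_imageD[OF finite_subset[OF sub finP] inj] .
  have "card (node_indices l K) = card (?r ` node_indices l K)" using card_image[OF inj] by simp
  also have "\<dots> \<le> card ?P" using sub finP by (rule card_mono[rotated])
  also have "\<dots> = (l + 1) ^ (CARD('n) + 1)" using fin full_simplex_verts(2)[OF K] by (simp add: card_PiE)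
  finally show "card (node_indices l K) \<le> (l + 1) ^ (CARD('n) + 1)" .
qed

lemma bary_lattice_node:
  assumes K: "full_simplex K" and l: "1 \<le> l" and k: "k \<in> node_indices l K"
  shows "real l * bary K a (lattice_node l K k) = real (k a)" and "lattice_node l K k \<in> K"
proof -
  have k': "(\<Sum>a\<in>verts K. k a) = l" "\<And>a. a \<notin> verts K \<Longrightarrow> k a = 0" using k by (auto simp: node_indices_def)
  have "(\<Sum>a\<in>verts K. real (k a) / real l) = 1"
    using k'(1) l by (simp add: sum_divide_distrib[symmetric] of_nat_sum[symmetric] del: of_nat_sum)
  then have *: "bary K a (lattice_node l K k) = real (k a) / real l" for a
    using bary_unique[OF K, of "\<lambda>a. real (k a) / real l"] bary_not_vertex[of a K] k'(2)[of a]
    by (cases "a \<in> verts K") (auto simp: lattice_node_def)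
  then show "real l * bary K a (lattice_node l K k) = real (k a)" using l by simp
  show "lattice_node l K k \<in> K" using * mem_simplex_iff_bary[OF K] by simp
qed

lemma lagrange_eq_newton:
  "lagrange_fun l K k x = newton_fun l K k x / (\<Prod>a\<in>verts K. \<Prod>j<k a. (real (k a) - real j))"
  by (simp add: lagrange_fun_def newton_fun_def prod_dividef)

lemma lagrange_denominator_ge_1: "1 \<le> (\<Prod>a\<in>verts K. \<Prod>j<k a. (real (k a) - real j))"
  by (intro prod_ge_1) (auto simp: of_nat_diff[symmetric] less_imp_le simp del: of_nat_diff)

text \<open>Two indices of the same degree that differ have a vertex \<open>a\<close> with \<open>k' a < k a\<close>; there the factor
  with \<open>j = k' a\<close> is zero.\<close>

lemma lagrange_fun_node:
  assumes K: "full_simplex K" and l: "1 \<le> l" and k: "k \<in> node_indices l K" "k' \<in> node_indices l K"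
  shows "lagrange_fun l K k (lattice_node l K k') = (if k' = k then 1 else 0)"
proof (cases "k' = k")
  case True
  then show ?thesis using k by (auto simp: lagrange_fun_def bary_lattice_node(1)[OF K l] intro!: prod.neutral)
next
  case False
  note fin = full_simplex_verts(4)[OF K]
  have "\<exists>a\<in>verts K. k' a < k a"
  proof (rule ccontr)
    assume "\<not> ?thesis"
    then have le: "\<And>a. a \<in> verts K \<Longrightarrow> k a \<le> k' a" by (auto simp: not_less)
    have "k a = k' a" if "a \<in> verts K" for a
    proof (rule ccontr)
      assume "k a \<noteq> k' a"
      then have "(\<Sum>a\<in>verts K. k a) < (\<Sum>a\<in>verts K. k' a)"
        using le[OF that] by (intro sum_strict_mono_ex1[OF fin]) (use le that in force)+
      then show False using k by (simp add: node_indices_def)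
    qed
    then have "k' a = k a" for a using k by (cases "a \<in> verts K") (auto simp: node_indices_def)
    then show False using False by auto
  qed
  then obtain a where a: "a \<in> verts K" "k' a < k a" by blast
  have "(\<Prod>j<k a. (real l * bary K a (lattice_node l K k') - real j) / (real (k a) - real j)) = 0"
    using a by (intro prod_zero) (auto simp: bary_lattice_node(1)[OF K l k(2)])
  then show ?thesis using False a fin by (auto simp: lagrange_fun_def intro!: prod_zero)
qed

lemma newton_fun_Sigma:
  assumes K: "full_simplex K"
  shows "newton_fun l K k x = (\<Prod>(a, j)\<in>Sigma (verts K) (\<lambda>a. {..<k a}).
    ((real l *\<^sub>R fst (bary_fun K a)) \<bullet> x + (real l * snd (bary_fun K a) - real j)))"
  unfolding newton_fun_def using full_simplex_verts(4)[OF K]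
  by (subst prod.Sigma) (auto simp: bary_def algebra_simps)

lemma card_newton_Sigma:
  assumes "k \<in> node_indices l K" "finite (verts K)"
  shows "card (Sigma (verts K) (\<lambda>a. {..<k a})) = l"
  using assms by (simp add: card_SigmaI node_indices_def)

lemma lagrange_fun_polynomial:
  assumes K: "full_simplex K" and k: "k \<in> node_indices l K"
  shows "lagrange_fun l K k \<in> polynomials_upto l"
proof -
  let ?S = "Sigma (verts K) (\<lambda>a. {..<k a})"
  have fin: "finite ?S" using full_simplex_verts(4)[OF K] by auto
  have "newton_fun l K k \<in> polynomials_upto (card ?S)"
    unfolding newton_fun_Sigma[OF K, abs_def] case_prod_beta by (rule polynomials_upto_affine_prod[OF fin])
  then have "newton_fun l K k \<in> polynomials_upto l" using card_newton_Sigma[OF k full_simplex_verts(4)[OF K]] by simp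
  from polynomials_upto_scale[OF this, of "1 / (\<Prod>a\<in>verts K. \<Prod>j<k a. (real (k a) - real j))"]
  show ?thesis by (simp add: lagrange_eq_newton[abs_def])
qed

lemma affine_prod_gradient_bound:
  assumes "finite A" "1 \<le> M" "\<And>i. i \<in> A \<Longrightarrow> \<bar>g i \<bullet> x + b i\<bar> \<le> M" "\<And>i. i \<in> A \<Longrightarrow> norm (g i) \<le> N"
  shows "\<bar>\<Prod>i\<in>A. (g i \<bullet> x + b i)\<bar> \<le> M ^ card A \<and>
    (\<exists>G. GDERIV (\<lambda>x. \<Prod>i\<in>A. (g i \<bullet> x + b i)) x :> G \<and> norm G \<le> real (card A) * M ^ card A * N)"
  using assms
proof (induction A rule: finite_induct)
  case empty then show ?case by (auto intro!: exI[of _ 0] GDERIV_const)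
next
  case (insert i A)
  let ?P = "\<lambda>x. \<Prod>i\<in>A. (g i \<bullet> x + b i)"
  have P: "\<bar>?P x\<bar> \<le> M ^ card A" using insert by simp
  obtain G where G: "GDERIV ?P x :> G" "norm G \<le> real (card A) * M ^ card A * N" using insert by auto
  have N: "0 \<le> N" using order.trans[OF norm_ge_zero insert.prems(3)[of i]] by simp
  have f: "GDERIV (\<lambda>x. g i \<bullet> x + b i) x :> g i" unfolding gderiv_def
    by (auto intro!: derivative_eq_intros simp: inner_commute)
  have "\<bar>(g i \<bullet> x + b i) * ?P x\<bar> \<le> M * M ^ card A"
    unfolding abs_mult using insert.prems P by (intro mult_mono) auto
  moreover have "norm ((g i \<bullet> x + b i) *\<^sub>R G + ?P x *\<^sub>R g i) \<le> real (Suc (card A)) * (M * M ^ card A) * N"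
  proof -
    have "norm ((g i \<bullet> x + b i) *\<^sub>R G + ?P x *\<^sub>R g i) \<le> \<bar>g i \<bullet> x + b i\<bar> * norm G + \<bar>?P x\<bar> * norm (g i)"
      using norm_triangle_ineq[of "(g i \<bullet> x + b i) *\<^sub>R G" "?P x *\<^sub>R g i"] by simp
    also have "\<dots> \<le> M * (real (card A) * M ^ card A * N) + M ^ card A * N"
      using insert.prems P G(2) by (intro add_mono mult_mono) auto
    also have "\<dots> \<le> M * (real (card A) * M ^ card A * N) + M * (M ^ card A * N)"
      using insert.prems(1) N mult_right_mono[of 1 M "M ^ card A * N"] by simp
    also have "\<dots> = real (Suc (card A)) * (M * M ^ card A) * N" by (simp add: algebra_simps)
    finally show ?thesis .
  qed
  ultimately show ?case using insert.hyps GDERIV_mult[OF f G(1)] by auto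
qed

lemma lagrange_fun_bounds:
  fixes K :: "(real^'n) set"
  assumes K: "full_simplex K" and l: "1 \<le> l" and k: "k \<in> node_indices l K" and x: "x \<in> K"
  shows "\<bar>lagrange_fun l K k x\<bar> \<le> real l ^ (l + 2)"
    and "norm (grad (lagrange_fun l K k) x) * inball_diameter K \<le> real l ^ (l + 2)"
proof -
  let ?S = "Sigma (verts K) (\<lambda>a. {..<k a})"
  let ?g = "\<lambda>(a, j :: nat). real l *\<^sub>R fst (bary_fun K a)" and ?b = "\<lambda>(a, j). real l * snd (bary_fun K a) - real j"
  let ?D = "\<Prod>a\<in>verts K. \<Prod>j<k a. (real (k a) - real j)"
  note finV = full_simplex_verts(4)[OF K]
  have fin: "finite ?S" using finV by auto
  have rho: "0 < inball_diameter K" by (rule inball_diameter_pos[OF K])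
  have card: "card ?S = l" using card_newton_Sigma[OF k finV] .
  have eq: "newton_fun l K k = (\<lambda>x. \<Prod>i\<in>?S. (?g i \<bullet> x + ?b i))"
    by (auto simp: newton_fun_Sigma[OF K] case_prod_beta fun_eq_iff)
  have "\<bar>?g i \<bullet> x + ?b i\<bar> \<le> real l" if "i \<in> ?S" for i
  proof -
    obtain a j where i: "i = (a, j)" "a \<in> verts K" "j < k a" using \<open>i \<in> ?S\<close> by blast
    have "k a \<le> l" using k i(2) finV unfolding node_indices_def by (auto intro: member_le_sum)
    moreover have "0 \<le> real l * bary K a x" "real l * bary K a x \<le> real l * 1"
      using bary_bounds(1)[OF K x, of a] mult_left_mono[OF bary_bounds(2)[OF K x, of a], of "real l"] by auto
    moreover have "?g i \<bullet> x + ?b i = real l * bary K a x - real j" by (simp add: i bary_def algebra_simps)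
    moreover have "real j \<le> real l" using \<open>k a \<le> l\<close> i(3) by simp
    ultimately show ?thesis by linarith
  qed
  moreover have "norm (?g i) \<le> real l / inball_diameter K" for i
    using mult_left_mono[OF bary_gradient_bound[OF K, of "fst i"], of "real l"] rho
    by (auto simp: case_prod_beta field_simps)
  ultimately obtain G where 1: "\<bar>newton_fun l K k x\<bar> \<le> real l ^ l" and
    G: "GDERIV (newton_fun l K k) x :> G" "norm G \<le> real l * real l ^ l * (real l / inball_diameter K)"
    using affine_prod_gradient_bound[OF fin, of "real l" ?g x ?b "real l / inball_diameter K"] l
    unfolding eq card by auto
  have D: "1 \<le> ?D" by (rule lagrange_denominator_ge_1)
  have "\<bar>lagrange_fun l K k x\<bar> = \<bar>newton_fun l K k x\<bar> / ?D"
    using D by (simp add: lagrange_eq_newton)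
  also have "\<dots> \<le> \<bar>newton_fun l K k x\<bar> / 1" using D by (intro divide_left_mono) auto
  also have "\<dots> \<le> real l ^ (l + 2)"
    using order.trans[OF 1 power_increasing[of l "l + 2" "real l"]] l by simp
  finally show "\<bar>lagrange_fun l K k x\<bar> \<le> real l ^ (l + 2)" .
  have "GDERIV (\<lambda>x. 1 / ?D * newton_fun l K k x) x :> (1 / ?D) *\<^sub>R G"
    using GDERIV_mult[OF GDERIV_const[of "1 / ?D"] G(1)] by simp
  then have "grad (lagrange_fun l K k) x = (1 / ?D) *\<^sub>R G"
    by (intro grad_eq) (simp add: lagrange_eq_newton[abs_def])
  then have "norm (grad (lagrange_fun l K k) x) = norm G / ?D" using D by simp
  also have "\<dots> \<le> norm G / 1" using D by (intro divide_left_mono) auto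
  finally have "norm (grad (lagrange_fun l K k) x) * inball_diameter K \<le> norm G * inball_diameter K"
    using rho by (intro mult_right_mono) auto
  also have "\<dots> \<le> real l * real l ^ l * (real l / inball_diameter K) * inball_diameter K"
    using G(2) rho by (intro mult_right_mono) auto
  also have "\<dots> = real l ^ (l + 2)" using rho by (simp add: power_add power2_eq_square)
  finally show "norm (grad (lagrange_fun l K k) x) * inball_diameter K \<le> real l ^ (l + 2)" .
qed

section \<open>Unisolvence\<close>

definition newton_span :: "nat \<Rightarrow> (real^'n) set \<Rightarrow> nat \<Rightarrow> (real^'n \<Rightarrow> real) set" where
  "newton_span l K m = {f. \<exists>c. f = (\<lambda>x. \<Sum>k\<in>node_indices m K. c k * newton_fun l K k x)}"

lemma newton_span_add:
  "f \<in> newton_span l K m \<Longrightarrow> g \<in> newton_span l K m \<Longrightarrow> (\<lambda>x. f x + g x) \<in> newton_span l K m"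
  unfolding newton_span_def by clarsimp (rule exI, simp add: sum.distrib[symmetric] distrib_right[symmetric])

lemma newton_span_scale:
  "f \<in> newton_span l K m \<Longrightarrow> (\<lambda>x. c * f x) \<in> newton_span l K m"
  unfolding newton_span_def by clarsimp (rule exI, simp add: sum_distrib_left mult.assoc[symmetric])

lemma newton_span_zero: "(\<lambda>x. 0) \<in> newton_span l K m"
  unfolding newton_span_def by (auto intro!: exI[of _ "\<lambda>_. 0"])

lemma newton_span_sum:
  "(\<And>i. i \<in> A \<Longrightarrow> f i \<in> newton_span l K m) \<Longrightarrow> (\<lambda>x. \<Sum>i\<in>A. f i x) \<in> newton_span l K m"
  by (induction A rule: infinite_finite_induct) (auto intro: newton_span_zero newton_span_add)

lemma newton_span_newton:
  assumes K: "full_simplex K" and k: "k \<in> node_indices m K"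
  shows "newton_fun l K k \<in> newton_span l K m"
proof -
  have "newton_fun l K k x = (\<Sum>k'\<in>node_indices m K. (if k' = k then 1 else 0) * newton_fun l K k' x)" for x
    using k finite_node_indices(1)[OF K] by (simp add: if_distrib[of "\<lambda>c. c * _"] cong: if_cong)
  then show ?thesis unfolding newton_span_def by (intro CollectI exI[of _ "\<lambda>k'. if k' = k then 1 else 0"]) auto
qed

lemma newton_fun_raise:
  assumes K: "full_simplex K" and k: "k \<in> node_indices m K" and a: "a \<in> verts K"
  shows "k(a := Suc (k a)) \<in> node_indices (Suc m) K"
    and "newton_fun l K (k(a := Suc (k a))) x = (real l * bary K a x - real (k a)) * newton_fun l K k x"
proof -
  note fin = full_simplex_verts(4)[OF K]
  let ?k = "k(a := Suc (k a))"
  have "(\<Sum>c\<in>verts K - {a}. ?k c) = (\<Sum>c\<in>verts K - {a}. k c)" by (rule sum.cong) auto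
  then have "(\<Sum>c\<in>verts K. ?k c) = Suc (\<Sum>c\<in>verts K. k c)" by (simp add: sum.remove[OF fin a])
  then show "?k \<in> node_indices (Suc m) K" using k a by (auto simp: node_indices_def)
  have "(\<Prod>c\<in>verts K - {a}. \<Prod>j<?k c. (real l * bary K c x - real j)) =
      (\<Prod>c\<in>verts K - {a}. \<Prod>j<k c. (real l * bary K c x - real j))" by (rule prod.cong) auto
  then show "newton_fun l K ?k x = (real l * bary K a x - real (k a)) * newton_fun l K k x"
    by (simp add: newton_fun_def prod.remove[OF fin a] lessThan_Suc mult_ac)
qed

text \<open>Raising the index \<open>k\<close> at the vertex \<open>a\<close> multiplies the function by \<open>l \<lambda>\<^sub>a - k a\<close>. These factors
  add up to \<open>l - m\<close>, so a function of degree \<open>m < l\<close> is a combination of its raised versions; this in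
  turn handles the multiplication by a single coordinate \<open>\<lambda>\<^sub>a\<close>.\<close>

lemma newton_span_Suc:
  fixes K :: "(real^'n) set"
  assumes K: "full_simplex K" and m: "m < l" and f: "f \<in> newton_span l K m"
  shows "f \<in> newton_span l K (Suc m)" and "a \<in> verts K \<Longrightarrow> (\<lambda>x. bary K a x * f x) \<in> newton_span l K (Suc m)"
proof -
  have 1: "newton_fun l K k \<in> newton_span l K (Suc m)" if k: "k \<in> node_indices m K" for k
  proof -
    have "newton_fun l K k x = (1 / (real l - real m)) * (\<Sum>a\<in>verts K. newton_fun l K (k(a := Suc (k a))) x)" for x
    proof -
      have "(\<Sum>a\<in>verts K. real (k a)) = real m" using k by (simp add: node_indices_def flip: of_nat_sum)
      then have "(\<Sum>a\<in>verts K. (real l * bary K a x - real (k a))) = real l - real m"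
        using bary_sum(1)[OF K, of x] by (simp add: sum_subtractf sum_distrib_left[symmetric])
      moreover have "(\<Sum>a\<in>verts K. newton_fun l K (k(a := Suc (k a))) x) =
          (\<Sum>a\<in>verts K. (real l * bary K a x - real (k a))) * newton_fun l K k x"
        unfolding sum_distrib_right using newton_fun_raise(2)[OF K k] by (intro sum.cong) auto
      ultimately show ?thesis using m by simp
    qed
    then have "newton_fun l K k = (\<lambda>x. (1 / (real l - real m)) * (\<Sum>a\<in>verts K. newton_fun l K (k(a := Suc (k a))) x))" by auto
    moreover have "\<dots> \<in> newton_span l K (Suc m)"
      by (intro newton_span_scale newton_span_sum newton_span_newton[OF K] newton_fun_raise(1)[OF K k])
    ultimately show ?thesis by simp
  qed
  have 2: "(\<lambda>x. bary K a x * newton_fun l K k x) \<in> newton_span l K (Suc m)"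
    if k: "k \<in> node_indices m K" and a: "a \<in> verts K" for k a
  proof -
    have "(\<lambda>x. bary K a x * newton_fun l K k x) =
      (\<lambda>x. (1 / real l) * newton_fun l K (k(a := Suc (k a))) x + (real (k a) / real l) * newton_fun l K k x)"
      using m newton_fun_raise(2)[OF K k a] by (auto simp: field_simps fun_eq_iff)
    moreover have "\<dots> \<in> newton_span l K (Suc m)"
      by (intro newton_span_add newton_span_scale newton_span_newton[OF K] newton_fun_raise(1)[OF K k a] 1[OF k])
    ultimately show ?thesis by simp
  qed
  obtain c where c: "f = (\<lambda>x. \<Sum>k\<in>node_indices m K. c k * newton_fun l K k x)" using f by (auto simp: newton_span_def)
  show "f \<in> newton_span l K (Suc m)" unfolding c by (intro newton_span_sum newton_span_scale 1)
  show "(\<lambda>x. bary K a x * f x) \<in> newton_span l K (Suc m)" if a: "a \<in> verts K"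
  proof -
    have "(\<lambda>x. \<Sum>k\<in>node_indices m K. c k * (bary K a x * newton_fun l K k x)) \<in> newton_span l K (Suc m)"
      by (intro newton_span_sum newton_span_scale 2 a)
    then show ?thesis unfolding c by (simp add: sum_distrib_left mult_ac)
  qed
qed

lemma newton_span_mono:
  fixes K :: "(real^'n) set"
  assumes K: "full_simplex K" and f: "f \<in> newton_span l K m" and n: "m \<le> n" "n \<le> l"
  shows "f \<in> newton_span l K n"
  using n
proof (induction n rule: dec_induct)
  case (step n) then show ?case using newton_span_Suc(1)[OF K] by simp
qed (rule f)

lemma polynomials_upto_newton_span:
  fixes K :: "(real^'n) set"
  assumes K: "full_simplex K" and p: "p \<in> polynomials_upto l"
  shows "p \<in> newton_span l K l"
proof -
  have "m \<le> l \<Longrightarrow> p \<in> newton_span l K m" if "p \<in> polynomials_upto m" for m p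
    using that
  proof (induction rule: polynomials_upto_induct)
    case (const c m)
    have "(\<lambda>_. 0) \<in> node_indices 0 K" by (simp add: node_indices_def)
    from newton_span_scale[OF newton_span_newton[OF K this], where c = c]
    have "(\<lambda>x. c) \<in> newton_span l K 0" by (simp add: newton_fun_def)
    then show ?case using newton_span_mono[OF K] const by blast
  next
    case (coord m p i)
    then have p: "p \<in> newton_span l K m" by simp
    have "(\<lambda>x. \<Sum>a\<in>verts K. a $ i * (bary K a x * p x)) \<in> newton_span l K (Suc m)"
      using coord.prems by (intro newton_span_sum newton_span_scale newton_span_Suc(2)[OF K _ p]) auto
    moreover have "(\<Sum>a\<in>verts K. a $ i * (bary K a x * p x)) = x $ i * p x" for x
    proof -
      have "(\<Sum>a\<in>verts K. a $ i * (bary K a x * p x)) = (\<Sum>a\<in>verts K. bary K a x *\<^sub>R a) $ i * p x"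
        by (simp add: sum_distrib_right sum_distrib_left mult_ac)
      then show ?thesis using bary_sum(2)[OF K, of x] by simp
    qed
    ultimately show ?case by simp
  next
    case (mono m n p) then show ?case using newton_span_mono[OF K] by (meson order.trans)
  qed (auto intro: newton_span_add newton_span_scale)
  then show ?thesis using p by blast
qed

text \<open>Unisolvence: \<open>p\<close> is some combination of the Lagrange functions, and
  evaluation at the nodes identifies the coefficients.\<close>

lemma polynomial_nodal_representation:
  fixes K :: "(real^'n) set"
  assumes K: "full_simplex K" and l: "1 \<le> l" and p: "p \<in> polynomials_upto l"
  shows "p x = (\<Sum>k\<in>node_indices l K. p (lattice_node l K k) * lagrange_fun l K k x)"
proof -
  let ?D = "\<lambda>k. \<Prod>a\<in>verts K. \<Prod>j<k a. (real (k a) - real j)"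
  have D: "?D k \<noteq> 0" for k using lagrange_denominator_ge_1[where k = k and K = K] by linarith
  obtain c where c: "\<And>x. p x = (\<Sum>k\<in>node_indices l K. c k * newton_fun l K k x)"
    using polynomials_upto_newton_span[OF K p] by (auto simp: newton_span_def)
  have c': "p x = (\<Sum>k\<in>node_indices l K. (c k * ?D k) * lagrange_fun l K k x)" for x
    unfolding c using D by (intro sum.cong) (auto simp: lagrange_eq_newton)
  have "p (lattice_node l K k) = c k * ?D k" if "k \<in> node_indices l K" for k
    unfolding c' using that finite_node_indices(1)[OF K]
    by (simp add: lagrange_fun_node[OF K l _ that] if_distrib[of "\<lambda>c. _ * c"] cong: if_cong sum.cong)
  then show ?thesis unfolding c'[of x] by (intro sum.cong) auto
qed

section \<open>Nodal interpolation on a mesh\<close>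

definition nodal_interpolant :: "nat \<Rightarrow> (real^'n) set \<Rightarrow> (real^'n \<Rightarrow> real) \<Rightarrow> real^'n \<Rightarrow> real" where
  "nodal_interpolant l K V x = (\<Sum>k\<in>node_indices l K. V (lattice_node l K k) * lagrange_fun l K k x)"

text \<open>On the common face, Lagrange functions of nodes off the face vanish and those of nodes in the face
  depend on the coordinates of the face only. Both interpolants reduce to the same sum over the shared
  indices. This is what makes the elementwise interpolants continuous.\<close>

lemma nodal_interpolant_on_common_face:
  fixes K K' :: "(real^'n) set"
  assumes K: "full_simplex K" "full_simplex K'" and F: "K \<inter> K' face_of K" "K \<inter> K' face_of K'" and x: "x \<in> K \<inter> K'"
  shows "nodal_interpolant l K V x = nodal_interpolant l K' V x"
proof -
  have key: "nodal_interpolant l K V x =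
     (\<Sum>k\<in>node_indices l K \<inter> node_indices l K'. V (\<Sum>a | 0 < k a. (real (k a) / real l) *\<^sub>R a) *
        (\<Prod>a | 0 < k a. \<Prod>j<k a. (real l * bary K a x - real j) / (real (k a) - real j)))"
    if K: "full_simplex K" "full_simplex K'" and eq: "\<And>a. bary K a x = bary K' a x" for K K' :: "(real^'n) set"
  proof -
    note fin = full_simplex_verts(4)[OF K(1)]
    have sub: "{a. 0 < k a} \<subseteq> verts K" if "k \<in> node_indices l K" for k using that by (auto simp: node_indices_def)
    have z: "lagrange_fun l K k x = 0" if k: "k \<in> node_indices l K - node_indices l K'" for k
    proof -
      have "\<exists>a. a \<notin> verts K' \<and> 0 < k a"
      proof (rule ccontr)
        assume *: "\<not> ?thesis"
        then have "(\<Sum>a\<in>verts K. k a) = (\<Sum>a | 0 < k a. k a)" "(\<Sum>a\<in>verts K'. k a) = (\<Sum>a | 0 < k a. k a)"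
          using k fin full_simplex_verts(4)[OF K(2)] by (auto intro!: sum.mono_neutral_right simp: node_indices_def)
        then show False using k * by (auto simp: node_indices_def)
      qed
      then obtain a where a: "a \<notin> verts K'" "0 < k a" by blast
      then have "bary K a x = 0" using eq bary_not_vertex by metis
      then have "(\<Prod>j<k a. (real l * bary K a x - real j) / (real (k a) - real j)) = 0"
        using a by (intro prod_zero) (auto intro!: bexI[of _ 0])
      moreover have "a \<in> verts K" using sub k a by blast
      ultimately show ?thesis unfolding lagrange_fun_def using fin by (intro prod_zero) auto
    qed
    have "nodal_interpolant l K V x = (\<Sum>k\<in>node_indices l K \<inter> node_indices l K'. V (lattice_node l K k) * lagrange_fun l K k x)"
      unfolding nodal_interpolant_def using z finite_node_indices(1)[OF K(1)] by (intro sum.mono_neutral_right) auto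
    also have "\<dots> = (\<Sum>k\<in>node_indices l K \<inter> node_indices l K'. V (\<Sum>a | 0 < k a. (real (k a) / real l) *\<^sub>R a) *
        (\<Prod>a | 0 < k a. \<Prod>j<k a. (real l * bary K a x - real j) / (real (k a) - real j)))"
    proof (intro sum.cong refl arg_cong2[of _ _ _ _ "(*)"] arg_cong[of _ _ V])
      fix k assume k: "k \<in> node_indices l K \<inter> node_indices l K'"
      show "lattice_node l K k = (\<Sum>a | 0 < k a. (real (k a) / real l) *\<^sub>R a)"
        unfolding lattice_node_def using sub[of k] k fin by (intro sum.mono_neutral_right) auto
      show "lagrange_fun l K k x = (\<Prod>a | 0 < k a. \<Prod>j<k a. (real l * bary K a x - real j) / (real (k a) - real j))"
        unfolding lagrange_fun_def using sub[of k] k fin by (intro prod.mono_neutral_right) auto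
    qed
    finally show ?thesis .
  qed
  have eq: "bary K a x = bary K' a x" for a using bary_eq_on_common_face[OF K F x] .
  show ?thesis unfolding key[OF K eq] key[OF K(2,1) eq[symmetric]] eq by (simp only: Int_commute)
qed

lemma nodal_interpolant_polynomial:
  assumes "full_simplex K"
  shows "nodal_interpolant l K V \<in> polynomials_upto l"
  unfolding nodal_interpolant_def[abs_def]
  by (intro polynomials_upto_sum polynomials_upto_scale lagrange_fun_polynomial[OF assms])

lemma nodal_interpolation:
  fixes \<T> :: "(real^'n) set set"
  assumes T: "triangulation \<T>" and full: "\<forall>K\<in>\<T>. full_simplex K"
  obtains v where "v \<in> fe_space l \<T>" "\<And>K x. K \<in> \<T> \<Longrightarrow> x \<in> K \<Longrightarrow> v x = nodal_interpolant l K V x"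
proof -
  define v where "v x = nodal_interpolant l (SOME K. K \<in> \<T> \<and> x \<in> K) V x" for x
  have v: "v x = nodal_interpolant l K V x" if "K \<in> \<T>" "x \<in> K" for K x
  proof -
    let ?K = "SOME K. K \<in> \<T> \<and> x \<in> K"
    have "?K \<in> \<T> \<and> x \<in> ?K" using that by (rule_tac someI[of _ K]) auto
    moreover have "L \<inter> M face_of L \<and> L \<inter> M face_of M" if "L \<in> \<T>" "M \<in> \<T>" for L M
      using T that unfolding triangulation_def by (metis Int_commute)
    ultimately show ?thesis unfolding v_def using that full
      by (intro nodal_interpolant_on_common_face) auto
  qed
  have "continuous_on (\<Union>K\<in>\<T>. K) v"
  proof (rule continuous_on_closed_Union)
    show "finite \<T>" using T by (simp add: triangulation_def)
    show "closed K" if "K \<in> \<T>" for K using full that full_simplex_compact compact_imp_closed by blast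
    show "continuous_on K v" if K: "K \<in> \<T>" for K
    proof -
      have "continuous_on K (nodal_interpolant l K V)"
        using continuous_on_polynomials_upto[OF nodal_interpolant_polynomial] full K by blast
      then show ?thesis by (subst continuous_on_cong[OF refl v[OF K]])
    qed
  qed
  then have "v \<in> fe_space l \<T>" unfolding fe_space_def using v nodal_interpolant_polynomial full by force
  then show ?thesis using that v by blast
qed

definition local_energy :: "real \<Rightarrow> (real^'n \<Rightarrow> real) \<Rightarrow> (real^'n \<Rightarrow> real^'n) \<Rightarrow> (real^'n) set \<Rightarrow> (real^'n \<Rightarrow> real) \<Rightarrow> real" where
  "local_energy \<epsilon> u g K p = (LINT x|lebesgue_on K. (norm (u x - p x))\<^sup>2) + \<epsilon> * (LINT x|lebesgue_on K. (norm (g x - grad p x))\<^sup>2)"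

lemma local_energy_nonneg: "0 \<le> \<epsilon> \<Longrightarrow> 0 \<le> local_energy \<epsilon> u g K p"
  by (auto simp: local_energy_def intro!: add_nonneg_nonneg mult_nonneg_nonneg Bochner_Integration.integral_nonneg)

section \<open>Meshes\<close>

locale mesh =
  fixes \<Omega> :: "(real^'n) set" and \<T> :: "(real^'n) set set"
  assumes domain: "polyhedral_domain \<Omega>" and conforming: "conforming_simplicial_mesh \<Omega> \<T>"
begin

lemma finite_mesh: "finite \<T>"
  and mesh_triangulation: "triangulation \<T>"
  and mesh_simplex: "K \<in> \<T> \<Longrightarrow> full_simplex K"
  and Union_mesh: "\<Union>\<T> = closure \<Omega>"
  using conforming by (auto simp: conforming_simplicial_mesh_def triangulation_def)

lemma Int_face: "K \<in> \<T> \<Longrightarrow> K' \<in> \<T> \<Longrightarrow> K \<inter> K' face_of K" "K \<in> \<T> \<Longrightarrow> K' \<in> \<T> \<Longrightarrow> K \<inter> K' face_of K'"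
  using mesh_triangulation unfolding triangulation_def by (blast, metis Int_commute)

lemma open_domain: "open \<Omega>" using domain by (auto simp: polyhedral_domain_def)

text \<open>The domain is the interior of a closed set and therefore regular open. Hence interiors of patches,
  which are only known to lie in its closure, lie in the domain.\<close>

lemma interior_closure_domain: "interior (closure \<Omega>) = \<Omega>"
proof -
  obtain \<P> where P: "finite \<P>" "\<forall>P\<in>\<P>. polytope P" "\<Omega> = interior (\<Union>\<P>)"
    using domain by (auto simp: polyhedral_domain_def)
  have "closed (\<Union>\<P>)" using P by (intro closed_Union) (auto intro: compact_imp_closed polytope_imp_compact)
  then have "closure \<Omega> \<subseteq> \<Union>\<P>" using P(3) interior_subset closure_minimal by metis
  then have "interior (closure \<Omega>) \<subseteq> \<Omega>" using P(3) interior_mono by blast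
  moreover have "\<Omega> \<subseteq> interior (closure \<Omega>)" using open_domain closure_subset interior_maximal by blast
  ultimately show ?thesis by blast
qed

lemma interior_subset_domain: "\<A> \<subseteq> \<T> \<Longrightarrow> interior (\<Union>\<A>) \<subseteq> \<Omega>"
  using interior_mono[of "\<Union>\<A>" "closure \<Omega>"] interior_closure_domain Union_mesh by blast

lemma interior_element_subset: "K \<in> \<T> \<Longrightarrow> interior K \<subseteq> \<Omega>"
  using interior_subset_domain[of "{K}"] by simp

lemma mesh_in_lebesgue: "K \<in> \<T> \<Longrightarrow> K \<in> sets lebesgue"
  using mesh_simplex full_simplex_compact compact_in_lebesgue by blast

definition skeleton :: "(real^'n) set" where "skeleton = (\<Union>K\<in>\<T>. frontier K)"

lemma negligible_skeleton: "negligible skeleton"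
  unfolding skeleton_def using finite_mesh mesh_simplex full_simplex_convex negligible_convex_frontier
  by (intro negligible_Union) auto

lemma not_skeleton: "K \<in> \<T> \<Longrightarrow> x \<in> K \<Longrightarrow> x \<notin> skeleton \<Longrightarrow> x \<in> interior K"
  using closure_subset by (fastforce simp: skeleton_def frontier_def)

lemma patch_interior: "\<A> \<subseteq> \<T> \<Longrightarrow> \<Union>\<A> - interior (\<Union>\<A>) \<subseteq> skeleton"
  using not_skeleton interior_mono[of _ "\<Union>\<A>"] by blast

lemma domain_closure: "x \<in> closure \<Omega> \<Longrightarrow> x \<notin> skeleton \<Longrightarrow> x \<in> \<Omega>"
  using not_skeleton interior_element_subset Union_mesh by blast

lemma element_subset_imp_eq:
  assumes "K \<in> \<T>" "K' \<in> \<T>" "K \<subseteq> K'"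
  shows "K = K'"
proof (rule ccontr)
  assume "K \<noteq> K'"
  then have "K \<inter> interior K' = {}"
    using face_of_disjoint_interior[OF Int_face(2)[OF assms(1,2)]] assms(3) by (auto simp: Int_absorb2)
  moreover have "interior K \<subseteq> interior K'" "interior K \<subseteq> K" using interior_mono assms(3) interior_subset by blast+
  ultimately show False using full_simplex_interior_nonempty[OF mesh_simplex[OF assms(1)]] by blast
qed

lemma interiors_disjoint:
  assumes "K \<in> \<T>" "K' \<in> \<T>" "K \<noteq> K'"
  shows "K \<inter> K' \<inter> interior K = {}"
  using face_of_disjoint_interior[OF Int_face(1)[OF assms(1,2)]] element_subset_imp_eq[OF assms(1,2)] assms(3) by blast

lemma negligible_overlap:
  assumes "K \<in> \<T>" "K' \<in> \<T>" "K \<noteq> K'"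
  shows "negligible (K \<inter> K')"
proof (rule negligible_subset[OF negligible_skeleton])
  show "K \<inter> K' \<subseteq> skeleton" using interiors_disjoint[OF assms] not_skeleton[OF assms(1)] by blast
qed

lemma square_integrable_Un:
  fixes f :: "real^'n \<Rightarrow> 'b::euclidean_space"
  assumes "f square_integrable_on S" "f square_integrable_on T" "S \<in> sets lebesgue" "T \<in> sets lebesgue"
  shows "f square_integrable_on (S \<union> T)"
proof -
  have ST: "S \<union> T \<in> sets lebesgue" using assms by blast
  have i: "indicator (S \<union> T) x *\<^sub>R f x = (if x \<in> S then indicator S x *\<^sub>R f x else indicator T x *\<^sub>R f x)" for x
    by (auto simp: indicator_def)
  have "(\<lambda>x. indicator S x *\<^sub>R f x) \<in> borel_measurable lebesgue" "(\<lambda>x. indicator T x *\<^sub>R f x) \<in> borel_measurable lebesgue"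
    using assms by (auto simp: square_integrable_on_def borel_measurable_restrict_space_iff)
  then have "(\<lambda>x. indicator (S \<union> T) x *\<^sub>R f x) \<in> borel_measurable lebesgue"
    unfolding i using assms(3) by (intro measurable_If_set) auto
  moreover have "set_integrable lebesgue (S \<union> T) (\<lambda>x. (norm (f x))\<^sup>2)"
    using assms by (intro set_integrable_Un) (auto simp: square_integrable_on_def integrable_restrict_space set_integrable_def)
  ultimately show ?thesis using ST
    by (auto simp: square_integrable_on_def borel_measurable_restrict_space_iff integrable_restrict_space set_integrable_def)
qed

lemma square_integrable_Union:
  fixes f :: "real^'n \<Rightarrow> 'b::euclidean_space"
  assumes "finite \<A>" "\<And>S. S \<in> \<A> \<Longrightarrow> f square_integrable_on S" "\<And>S. S \<in> \<A> \<Longrightarrow> S \<in> sets lebesgue"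
  shows "f square_integrable_on (\<Union>\<A>)"
  using assms
proof (induction \<A> rule: finite_induct)
  case empty show ?case by (simp add: square_integrable_on_def integrable_restrict_space borel_measurable_restrict_space_iff)
next
  case (insert S \<A>)
  have "\<Union>\<A> \<in> sets lebesgue" using insert by (intro sets.finite_Union) auto
  then show ?case using insert by (simp add: square_integrable_Un)
qed

lemma square_integrable_transfer:
  fixes f g :: "real^'n \<Rightarrow> 'b::euclidean_space"
  assumes f: "f square_integrable_on S" and S: "S \<in> sets lebesgue" "T \<in> sets lebesgue" and N: "negligible N"
    and ST: "\<And>x. x \<notin> N \<Longrightarrow> x \<in> S \<longleftrightarrow> x \<in> T" and eq: "\<And>x. x \<in> S \<Longrightarrow> x \<notin> N \<Longrightarrow> f x = g x"
  shows "g square_integrable_on T"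
    and "(LINT x|lebesgue_on S. (norm (f x))\<^sup>2) = (LINT x|lebesgue_on T. (norm (g x))\<^sup>2)"
proof -
  have n: "\<And>x. x \<in> S \<Longrightarrow> x \<notin> N \<Longrightarrow> (norm (f x))\<^sup>2 = (norm (g x))\<^sup>2" using eq by simp
  show "g square_integrable_on T"
    using borel_measurable_transfer[OF S N ST eq] integrable_transfer[OF S N ST n] f by (auto simp: square_integrable_on_def)
  show "(LINT x|lebesgue_on S. (norm (f x))\<^sup>2) = (LINT x|lebesgue_on T. (norm (g x))\<^sup>2)"
    using integral_transfer[OF S N ST n] f by (auto simp: square_integrable_on_def)
qed

lemma integral_patch:
  fixes f :: "real^'n \<Rightarrow> real"
  assumes A: "\<A> \<subseteq> \<T>" and f: "integrable (lebesgue_on (\<Union>\<A>)) f"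
  shows "(LINT x|lebesgue_on (\<Union>\<A>). f x) = (\<Sum>K\<in>\<A>. LINT x|lebesgue_on K. f x)"
proof -
  have fin: "finite \<A>" using A finite_mesh finite_subset by blast
  have m: "K \<in> sets lebesgue" if "K \<in> \<A>" for K using A that mesh_in_lebesgue by blast
  have mU: "\<Union>\<A> \<in> sets lebesgue" using fin m by (intro sets.finite_Union) auto
  have i: "integrable (lebesgue_on K) f" if "K \<in> \<A>" for K
    using integrable_lebesgue_on_subset[OF f mU m[OF that]] that by blast
  have "(f has_integral (\<Sum>K\<in>\<A>. LINT x|lebesgue_on K. f x)) (\<Union>\<A>)"
  proof (rule has_integral_Union[OF fin])
    show "pairwise (\<lambda>S S'. negligible (S \<inter> S')) \<A>"
      using A negligible_overlap by (auto simp: pairwise_def)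
  qed (use has_integral_integral_lebesgue_on i m in blast)
  moreover have "(f has_integral (LINT x|lebesgue_on (\<Union>\<A>). f x)) (\<Union>\<A>)"
    using has_integral_integral_lebesgue_on f mU by blast
  ultimately show ?thesis using has_integral_unique by blast
qed

section \<open>Finite element functions\<close>

lemma fe_piece:
  assumes v: "v \<in> fe_space l \<T>" and K: "K \<in> \<T>"
  obtains p where "p \<in> polynomials_upto l" "\<And>x. x \<in> K \<Longrightarrow> v x = p x"
    "\<And>x. x \<in> interior K \<Longrightarrow> GDERIV v x :> grad p x" "\<And>x. x \<in> interior K \<Longrightarrow> grad v x = grad p x"
proof -
  obtain p where p: "p \<in> polynomials_upto l" "\<And>x. x \<in> K \<Longrightarrow> v x = p x" using v K by (auto simp: fe_space_def)
  have *: "GDERIV v x :> grad p x" if "x \<in> interior K" for x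
    unfolding gderiv_def
    by (rule has_derivative_transform_within_open[OF polynomials_upto_GDERIV(1)[OF p(1), of x, unfolded gderiv_def] open_interior that])
      (use p(2) interior_subset in fastforce)
  then show ?thesis using that p grad_eq by blast
qed

lemma fe_piece_norms:
  assumes v: "v \<in> fe_space l \<T>" and K: "K \<in> \<T>"
  shows "v square_integrable_on K" "grad v square_integrable_on K"
proof -
  obtain p where p: "p \<in> polynomials_upto l" "\<And>x. x \<in> K \<Longrightarrow> v x = p x" "\<And>x. x \<in> interior K \<Longrightarrow> grad v x = grad p x"
    using fe_piece[OF v K] by metis
  have K': "compact K" "K \<in> sets lebesgue" using K mesh_simplex full_simplex_compact mesh_in_lebesgue by auto
  have "p square_integrable_on K" "grad p square_integrable_on K"
    using continuous_on_polynomials_upto[OF p(1)] continuous_on_grad_polynomials_upto[OF p(1)] K'(1) square_integrable_continuous by blast+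
  then show "v square_integrable_on K" "grad v square_integrable_on K"
    using square_integrable_transfer(1)[OF _ K'(2,2) negligible_skeleton] p(2,3) not_skeleton[OF K] by (metis, metis)
qed

lemma square_integrable_on_domain_iff:
  fixes f :: "real^'n \<Rightarrow> 'b::euclidean_space"
  shows "f square_integrable_on \<Omega> \<longleftrightarrow> f square_integrable_on (\<Union>\<T>)"
proof -
  have m: "\<Omega> \<in> sets lebesgue" "\<Union>\<T> \<in> sets lebesgue"
    using open_domain Union_mesh by (auto intro: borel_open borel_closed)
  have "x \<in> \<Omega> \<longleftrightarrow> x \<in> \<Union>\<T>" if "x \<notin> skeleton" for x using that domain_closure closure_subset[of \<Omega>] Union_mesh by auto
  then show ?thesis
    using square_integrable_transfer(1)[OF _ m negligible_skeleton, of f f] square_integrable_transfer(1)[OF _ m(2,1) negligible_skeleton, of f f] by blast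
qed

lemma fe_norms:
  assumes v: "v \<in> fe_space l \<T>"
  shows "v square_integrable_on \<Omega>" "grad v square_integrable_on \<Omega>"
  unfolding square_integrable_on_domain_iff
  using fe_piece_norms[OF v] finite_mesh mesh_in_lebesgue square_integrable_Union by blast+

text \<open>The segment from \<open>x\<close> to \<open>y\<close> is covered by the closed preimages of the elements and of the complement
  of the domain, and \<open>f\<close> is Lipschitz on each of them.\<close>

lemma piecewise_lipschitz:
  fixes f :: "real^'n \<Rightarrow> real"
  assumes L: "0 \<le> L" and K: "\<And>K. K \<in> \<T> \<Longrightarrow> L-lipschitz_on K f" and z: "\<And>x. x \<notin> \<Omega> \<Longrightarrow> f x = 0"
  shows "\<bar>f y - f x\<bar> \<le> L * norm (y - x)"
proof -
  let ?g = "\<lambda>t. x + t *\<^sub>R (y - x)"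
  let ?U = "\<lambda>S. ?g -` S"
  have "(L * norm (y - x))-lipschitz_on {0..1} (f \<circ> ?g)"
  proof (rule lipschitz_on_closed_Union[where I = "insert (- \<Omega>) \<T>" and U = ?U])
    show "(L * norm (y - x))-lipschitz_on (?U S) (f \<circ> ?g)" if "S \<in> insert (- \<Omega>) \<T>" for S
    proof (rule lipschitz_onI)
      fix s t assume st: "s \<in> ?U S" "t \<in> ?U S"
      have "dist (f (?g s)) (f (?g t)) \<le> L * dist (?g s) (?g t)"
      proof (cases "S = - \<Omega>")
        case True then show ?thesis using st z L by auto
      next
        case False
        then have "S \<in> \<T>" using that by simp
        from lipschitz_onD[OF K[OF this], of "?g s" "?g t"] show ?thesis using st by blast
      qed
      also have "dist (?g s) (?g t) = \<bar>s - t\<bar> * norm (y - x)"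
        by (simp add: dist_norm scaleR_diff_left[symmetric])
      finally show "dist ((f \<circ> ?g) s) ((f \<circ> ?g) t) \<le> L * norm (y - x) * dist s t"
        by (simp add: dist_real_def mult_ac)
    qed (use L in auto)
    show "closed (?U S)" if "S \<in> insert (- \<Omega>) \<T>" for S
    proof -
      have "closed S" using that open_domain mesh_simplex full_simplex_compact compact_imp_closed by auto
      then show ?thesis by (rule closed_vimage) (intro continuous_intros)
    qed
    show "{0..1} \<subseteq> (\<Union>S\<in>insert (- \<Omega>) \<T>. ?U S)" using Union_mesh closure_subset by fastforce
  qed (use finite_mesh L in auto)
  from lipschitz_onD[OF this, of 1 0] show ?thesis by (simp add: dist_real_def)
qed

text \<open>Integration by parts on the whole mesh at once. The product \<open>\<phi> v\<close>, which vanishes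
  outside the domain, is Lipschitz on the whole space, so its difference quotients in a coordinate
  direction are bounded and converge off the skeleton to the partial derivative. Their integrals are
  zero by translation invariance; dominated convergence gives \<open>\<integral> (\<phi> \<nabla>v + v \<nabla>\<phi>) = 0\<close>.\<close>

lemma fe_integration_by_parts:
  assumes v: "v \<in> fe_space l \<T>" and \<phi>: "\<phi> \<in> test_functions \<Omega>" and D: "\<And>x. GDERIV \<phi> x :> D x"
  shows "(LINT x|lebesgue. v x *\<^sub>R D x) = - (LINT x|lebesgue. \<phi> x *\<^sub>R grad v x)"
proof -
  obtain S where S: "compact S" "S \<subseteq> \<Omega>" "\<And>x. x \<notin> S \<Longrightarrow> \<phi> x = 0" "\<And>x. x \<notin> S \<Longrightarrow> D x = 0"
    "continuous_on UNIV \<phi>" "continuous_on UNIV D" using test_function_gradient[OF \<phi> D] by metis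
  define f where "f x = \<phi> x * v x" for x
  have f0: "f x = 0" if "x \<notin> S" for x using S(3) that by (simp add: f_def)
  have lip: "\<exists>L\<ge>0. L-lipschitz_on K f" if K: "K \<in> \<T>" for K
  proof -
    obtain p where p: "p \<in> polynomials_upto l" "\<And>x. x \<in> K \<Longrightarrow> v x = p x" using fe_piece[OF v K] by metis
    note Ks = mesh_simplex[OF K]
    let ?G = "\<lambda>x. \<phi> x *\<^sub>R grad p x + p x *\<^sub>R D x"
    have "continuous_on K ?G"
      using continuous_on_polynomials_upto[OF p(1)] continuous_on_grad_polynomials_upto[OF p(1)] S(5,6)
      by (intro continuous_intros) (auto intro: continuous_on_subset)
    then have "bounded (?G ` K)" using full_simplex_compact[OF Ks] compact_continuous_image compact_imp_bounded by blast
    then obtain L where L: "\<And>x. x \<in> K \<Longrightarrow> norm (?G x) \<le> L" by (auto simp: bounded_iff)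
    have L0: "norm (?G x) \<le> max L 0" if "x \<in> K" for x using L[OF that] by simp
    have "norm (\<phi> y * p y - \<phi> x * p x) \<le> max L 0 * norm (y - x)" if "x \<in> K" "y \<in> K" for x y
    proof (rule differentiable_bound[OF full_simplex_convex[OF Ks], where f' = "\<lambda>x h. h \<bullet> ?G x"])
      show "((\<lambda>x. \<phi> x * p x) has_derivative (\<lambda>h. h \<bullet> ?G x)) (at x within K)" for x
        using GDERIV_mult[OF D polynomials_upto_GDERIV(1)[OF p(1)], of x, unfolded gderiv_def] by (rule has_derivative_at_withinI)
      show "onorm (\<lambda>h. h \<bullet> ?G x) \<le> max L 0" if x: "x \<in> K" for x
      proof (rule onorm_le)
        fix h :: "real^'n"
        have "norm (h \<bullet> ?G x) \<le> norm h * norm (?G x)" using Cauchy_Schwarz_ineq2 by auto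
        also have "\<dots> \<le> norm h * max L 0" using L0[OF x] by (intro mult_left_mono) auto
        finally show "norm (h \<bullet> ?G x) \<le> max L 0 * norm h" by (simp add: mult.commute)
      qed
    qed (use that in auto)
    then have "dist (f y) (f x) \<le> max L 0 * dist y x" if "x \<in> K" "y \<in> K" for x y
      using that by (simp add: f_def p(2) dist_norm)
    then have "(max L 0)-lipschitz_on K f" by (intro lipschitz_onI) auto
    then show ?thesis by (intro exI[of _ "max L 0"]) simp
  qed
  then obtain LK where LK: "\<And>K. K \<in> \<T> \<Longrightarrow> 0 \<le> LK K" "\<And>K. K \<in> \<T> \<Longrightarrow> (LK K)-lipschitz_on K f" by metis
  define L where "L = (\<Sum>K\<in>\<T>. LK K)"
  have L0: "0 \<le> L" unfolding L_def using LK by (intro sum_nonneg) auto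
  have lipf: "\<bar>f y - f x\<bar> \<le> L * norm (y - x)" for x y
  proof (rule piecewise_lipschitz[OF L0])
    show "L-lipschitz_on K f" if K: "K \<in> \<T>" for K
    proof -
      have "LK K \<le> L" unfolding L_def using finite_mesh LK(1) K by (intro member_le_sum) auto
      then show ?thesis by (rule lipschitz_on_le[OF LK(2)[OF K]])
    qed
    show "f x = 0" if "x \<notin> \<Omega>" for x using that S(2) f0 by blast
  qed
  have "L-lipschitz_on UNIV f" using lipf L0 by (intro lipschitz_onI) (auto simp: dist_norm norm_minus_commute)
  then have fc: "continuous_on UNIV f" by (rule lipschitz_on_continuous_on)
  have fi: "integrable lborel f" using integrable_continuous_compact_support(2)[OF fc S(1) f0] .
  have fm[measurable]: "f \<in> borel_measurable borel" using fc by (rule borel_measurable_continuous_onI)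
  have trans: "integrable lborel (\<lambda>x. f (c + x))" "(LINT x|lborel. f (c + x)) = (LINT x|lborel. f x)" for c
  proof -
    have "integrable (distr lborel borel ((+) c)) f" using fi by (simp add: lborel_distr_plus)
    then show "integrable lborel (\<lambda>x. f (c + x))" by (subst (asm) integrable_distr_eq) auto
    have "(LINT x|lborel. f x) = (LINT x|distr lborel borel ((+) c). f x)" by (simp add: lborel_distr_plus)
    also have "\<dots> = (LINT x|lborel. f (c + x))" by (subst integral_distr) auto
    finally show "(LINT x|lborel. f (c + x)) = (LINT x|lborel. f x)" by simp
  qed
  have loc: "v locally_integrable_on \<Omega>" "grad v locally_integrable_on \<Omega>"
    using fe_norms[OF v] open_domain by (auto intro!: square_integrable_imp_locally_integrable borel_open)
  have i1: "integrable lebesgue (\<lambda>x. v x *\<^sub>R D x)"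
    using integrable_locally_times_continuous_vector[OF loc(1) S(1,2,6,4)] .
  have i2: "integrable lebesgue (\<lambda>x. \<phi> x *\<^sub>R grad v x)"
    using integrable_locally_times_continuous[OF loc(2) S(1,2,5,3)] .
  let ?F = "\<lambda>x. \<phi> x *\<^sub>R grad v x + v x *\<^sub>R D x"
  have iF: "integrable lebesgue ?F" using i1 i2 by auto
  have deriv: "GDERIV f x :> ?F x" if x: "x \<notin> skeleton" for x
  proof (cases "x \<in> closure \<Omega>")
    case True
    then obtain K where K: "K \<in> \<T>" "x \<in> interior K" using Union_mesh not_skeleton x by blast
    obtain p where "GDERIV v x :> grad p x" "grad v x = grad p x" using fe_piece[OF v K(1)] K(2) by metis
    then have "GDERIV v x :> grad v x" by simp
    from GDERIV_mult[OF D this] show ?thesis by (simp add: f_def[abs_def])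
  next
    case False
    then have "x \<notin> S" using S(2) closure_subset by blast
    have "((\<lambda>x. 0) has_derivative (\<lambda>h. h \<bullet> 0)) (at x)" by simp
    then have "(f has_derivative (\<lambda>h. h \<bullet> 0)) (at x)"
      by (rule has_derivative_transform_within_open[of _ _ _ _ "- S"])
        (use \<open>x \<notin> S\<close> S(1) f0 compact_imp_closed in \<open>auto simp: open_Compl\<close>)
    then show ?thesis using S(3,4)[OF \<open>x \<notin> S\<close>] by (simp add: gderiv_def)
  qed
  obtain R where R: "\<And>x. x \<in> S \<Longrightarrow> norm x \<le> R" using compact_imp_bounded[OF S(1)] by (auto simp: bounded_iff)
  have "(LINT x|lebesgue. ?F x $ i) = 0" for i
  proof -
    let ?h = "\<lambda>m. inverse (real (Suc m))"
    let ?c = "\<lambda>m. ?h m *\<^sub>R axis i 1 :: real^'n"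
    let ?q = "\<lambda>m x. (f (?c m + x) - f x) / ?h m"
    have nc: "norm (?c m) = ?h m" for m by simp
    have "(\<lambda>m. LINT x|lebesgue. ?q m x) \<longlonglongrightarrow> (LINT x|lebesgue. ?F x $ i)"
    proof (rule integral_dominated_convergence[where w = "\<lambda>x. L * indicator (cball 0 (R + 1)) x"])
      show "(\<lambda>x. ?F x $ i) \<in> borel_measurable lebesgue"
        using integrable_bounded_linear[OF bounded_linear_vec_nth iF, of i] by (rule borel_measurable_integrable)
      show "?q m \<in> borel_measurable lebesgue" for m
        by (intro measurable_completion) (simp, measurable)
      show "integrable lebesgue (\<lambda>x. L * indicator (cball 0 (R + 1)) x)"
        by (intro integrable_mult_right lmeasurable_iff_integrable[THEN iffD1] lmeasurable_cball)
      show "AE x in lebesgue. (\<lambda>m. ?q m x) \<longlonglongrightarrow> ?F x $ i"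
      proof (rule AE_I'[of skeleton])
        show "skeleton \<in> null_sets lebesgue" using negligible_skeleton by (simp add: negligible_iff_null_sets)
        have "(\<lambda>m. ?q m x) \<longlonglongrightarrow> ?F x $ i" if x: "x \<notin> skeleton" for x
        proof -
          have "((\<lambda>t. f (x + t *\<^sub>R axis i 1)) has_derivative (\<lambda>t. (t *\<^sub>R axis i 1) \<bullet> ?F x)) (at 0)"
          proof (rule has_derivative_compose[where g = f and f = "\<lambda>t. x + t *\<^sub>R axis i 1"])
            show "((\<lambda>t. x + t *\<^sub>R axis i 1) has_derivative (\<lambda>t. t *\<^sub>R axis i 1)) (at (0::real))"
              by (auto intro!: derivative_eq_intros)
            show "(f has_derivative (\<lambda>h. h \<bullet> ?F x)) (at (x + 0 *\<^sub>R axis i 1))"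
              using deriv[OF x] by (simp add: gderiv_def)
          qed
          then have "DERIV (\<lambda>t. f (x + t *\<^sub>R axis i 1)) 0 :> ?F x $ i"
            by (simp add: has_field_derivative_def inner_axis' inner_commute mult_commute_abs)
          then have "((\<lambda>t. (f (x + t *\<^sub>R axis i 1) - f x) / t) \<longlongrightarrow> ?F x $ i) (at 0)" by (simp add: DERIV_def)
          moreover have "filterlim ?h (at 0) sequentially"
            unfolding filterlim_at using LIMSEQ_inverse_real_of_nat by auto
          ultimately have "(\<lambda>m. (f (x + ?h m *\<^sub>R axis i 1) - f x) / ?h m) \<longlonglongrightarrow> ?F x $ i" by (rule filterlim_compose)
          then show ?thesis by (simp add: add.commute)
        qed
        then show "{x \<in> space lebesgue. \<not> (\<lambda>m. ?q m x) \<longlonglongrightarrow> ?F x $ i} \<subseteq> skeleton" by blast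
      qed
      show "AE x in lebesgue. norm (?q m x) \<le> L * indicator (cball 0 (R + 1)) x" for m
      proof (rule AE_I2)
        fix x
        have h: "0 < ?h m" "?h m \<le> 1" by (auto simp: field_simps)
        show "norm (?q m x) \<le> L * indicator (cball 0 (R + 1)) x"
        proof (cases "x \<in> cball 0 (R + 1)")
          case True
          have "\<bar>f (?c m + x) - f x\<bar> \<le> L * ?h m" using lipf[where x = x and y = "?c m + x"] nc[of m] by simp
          then have "\<bar>f (?c m + x) - f x\<bar> / ?h m \<le> L" using h(1) by (subst pos_divide_le_eq) auto
          then show ?thesis using True h by (simp add: abs_divide del: of_nat_Suc)
        next
          case False
          then have n: "norm x > R + 1" by simp
          have "norm x \<le> norm (?c m + x) + norm (?c m)" by (metis add_diff_cancel_left' norm_triangle_sub add.commute norm_triangle_ineq4)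
          then have "norm (?c m + x) > R" using n nc[of m] h(2) by linarith
          then have "f (?c m + x) = 0" "f x = 0" using R f0 n by (metis not_le, metis not_le add_increasing2 less_le_trans zero_le_one order_less_imp_le)
          then show ?thesis using False by simp
        qed
      qed
    qed
    moreover have "(LINT x|lebesgue. ?q m x) = 0" for m
    proof -
      have "(LINT x|lebesgue. ?q m x) = (LINT x|lborel. ?q m x)"
        by (intro integral_completion) measurable
      also have "\<dots> = 0" using trans[of "?c m"] fi by simp
      finally show ?thesis .
    qed
    ultimately show ?thesis by (simp add: LIMSEQ_const_iff)
  qed
  then have "(LINT x|lebesgue. ?F x) = 0"
    using integral_bounded_linear[OF bounded_linear_vec_nth iF] by (auto simp: vec_eq_iff)
  then show ?thesis using i1 i2 by (simp add: add_eq_0_iff)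
qed

lemma fe_weak_gradient:
  assumes v: "v \<in> fe_space l \<T>"
  shows "has_weak_gradient \<Omega> v (grad v)"
  using fe_integration_by_parts[OF v] fe_norms[OF v] open_domain
  by (auto simp: has_weak_gradient_iff intro!: square_integrable_imp_locally_integrable borel_open)

section \<open>Splitting of the energy norm\<close>

text \<open>Elements overlap in null sets only, and the interior of a patch differs from the patch by a part of
  the skeleton.\<close>

lemma energy_norm_patch:
  assumes u: "u square_integrable_on \<Omega>" "has_weak_gradient \<Omega> u g" "g square_integrable_on \<Omega>"
    and v: "v \<in> fe_space l \<T>" and A: "\<A> \<subseteq> \<T>" and w: "\<And>x. x \<in> \<Union>\<A> \<Longrightarrow> w x = v x" and e: "0 \<le> \<epsilon>"
    and \<omega>: "\<omega> = \<Union>\<A> \<or> \<omega> = \<Omega> \<and> \<A> = \<T>"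
  shows "(energy_norm \<epsilon> \<omega> (\<lambda>x. u x - w x))\<^sup>2 = (\<Sum>K\<in>\<A>. local_energy \<epsilon> u g K v)"
proof -
  have fin: "finite \<A>" using A finite_mesh finite_subset by blast
  have mU: "\<Union>\<A> \<in> sets lebesgue" using fin A mesh_in_lebesgue by (intro sets.finite_Union) auto
  have m\<omega>: "\<omega> \<in> sets lebesgue" using \<omega> mU open_domain by (auto intro: borel_open)
  have mO: "\<Omega> \<in> sets lebesgue" "\<Union>\<T> \<in> sets lebesgue"
    using open_domain Union_mesh by (auto intro: borel_open borel_closed)
  have \<omega>A: "\<omega> \<subseteq> \<Union>\<A>" using \<omega> Union_mesh closure_subset[of \<Omega>] by auto
  have ns: "x \<in> \<Union>\<A> \<longleftrightarrow> x \<in> \<omega>" if "x \<notin> skeleton" for x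
    using \<omega> that domain_closure closure_subset[of \<Omega>] Union_mesh by auto
  have int\<omega>: "interior \<omega> \<subseteq> \<Omega>" using \<omega> interior_subset_domain[OF A] interior_subset by auto
  have diff: "(\<lambda>x. u x - v x) square_integrable_on (\<Union>\<A>)" "(\<lambda>x. g x - grad v x) square_integrable_on (\<Union>\<A>)"
    using square_integrable_diff u(1,3) fe_norms[OF v] unfolding square_integrable_on_domain_iff
    using square_integrable_subset[OF _ mO(2) mU] A by (metis Union_mono)+
  have "has_weak_gradient (interior \<omega>) (\<lambda>x. u x - v x) (\<lambda>x. g x - grad v x)"
    using has_weak_gradient_subset[OF has_weak_gradient_diff[OF u(2) fe_weak_gradient[OF v] open_domain] open_domain open_interior int\<omega>] .
  moreover have "u x - v x = u x - w x" if "x \<in> interior \<omega>" for x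
  proof -
    have "x \<in> \<Union>\<A>" using that \<omega>A interior_subset[of \<omega>] by blast
    then show ?thesis using w by simp
  qed
  ultimately have wg: "has_weak_gradient (interior \<omega>) (\<lambda>x. u x - w x) (\<lambda>x. g x - grad v x)"
    by (rule has_weak_gradient_cong[OF _ _ open_interior])
  have g\<omega>: "(\<lambda>x. g x - grad v x) square_integrable_on \<omega>"
    using square_integrable_subset[OF diff(2) mU m\<omega> \<omega>A] .
  have neg: "negligible (\<omega> - interior \<omega>)"
  proof (rule negligible_subset[OF negligible_skeleton])
    show "\<omega> - interior \<omega> \<subseteq> skeleton" using \<omega> patch_interior[OF A] open_domain by (auto simp: interior_open)
  qed
  have "(energy_norm \<epsilon> \<omega> (\<lambda>x. u x - w x))\<^sup>2 =
     (LINT x|lebesgue_on \<omega>. (norm (u x - w x))\<^sup>2) + \<epsilon> * (LINT x|lebesgue_on \<omega>. (norm (g x - grad v x))\<^sup>2)"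
    unfolding energy_norm_eq[OF wg g\<omega> m\<omega> neg] using e
    by (intro real_sqrt_pow2 add_nonneg_nonneg mult_nonneg_nonneg Bochner_Integration.integral_nonneg) auto
  also have "(LINT x|lebesgue_on \<omega>. (norm (u x - w x))\<^sup>2) = (LINT x|lebesgue_on (\<Union>\<A>). (norm (u x - v x))\<^sup>2)"
    by (rule square_integrable_transfer(2)[OF diff(1) mU m\<omega> negligible_skeleton, symmetric]) (use ns w in auto)
  also have "(LINT x|lebesgue_on \<omega>. (norm (g x - grad v x))\<^sup>2) = (LINT x|lebesgue_on (\<Union>\<A>). (norm (g x - grad v x))\<^sup>2)"
    by (rule square_integrable_transfer(2)[OF diff(2) mU m\<omega> negligible_skeleton, symmetric]) (use ns in auto)
  also have "(LINT x|lebesgue_on (\<Union>\<A>). (norm (u x - v x))\<^sup>2) = (\<Sum>K\<in>\<A>. LINT x|lebesgue_on K. (norm (u x - v x))\<^sup>2)"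
    using diff(1) by (intro integral_patch A) (auto simp: square_integrable_on_def)
  also have "(LINT x|lebesgue_on (\<Union>\<A>). (norm (g x - grad v x))\<^sup>2) = (\<Sum>K\<in>\<A>. LINT x|lebesgue_on K. (norm (g x - grad v x))\<^sup>2)"
    using diff(2) by (intro integral_patch A) (auto simp: square_integrable_on_def)
  finally show ?thesis by (simp add: local_energy_def sum.distrib sum_distrib_left)
qed

lemma local_energy_cong:
  assumes u: "u square_integrable_on K" "g square_integrable_on K" and v: "v \<in> fe_space l \<T>" and K: "K \<in> \<T>"
    and p: "p \<in> polynomials_upto l" "\<And>x. x \<in> K \<Longrightarrow> v x = p x"
  shows "local_energy \<epsilon> u g K v = local_energy \<epsilon> u g K p"
proof -
  obtain q where q: "q \<in> polynomials_upto l" "\<And>x. x \<in> K \<Longrightarrow> v x = q x" "\<And>x. x \<in> interior K \<Longrightarrow> grad v x = grad q x"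
    using fe_piece[OF v K] by metis
  note mK = mesh_in_lebesgue[OF K]
  have "grad p x = grad v x" if x: "x \<in> interior K" for x
  proof -
    have "(v has_derivative (\<lambda>h. h \<bullet> grad p x)) (at x)"
      by (rule has_derivative_transform_within_open[OF polynomials_upto_GDERIV(1)[OF p(1), of x, unfolded gderiv_def] open_interior x])
        (use p(2) interior_subset in fastforce)
    then show ?thesis using grad_eq unfolding gderiv_def[symmetric] by metis
  qed
  then show ?thesis unfolding local_energy_def
    using square_integrable_transfer(2)[OF square_integrable_diff[OF u(2) fe_piece_norms(2)[OF v K]] mK mK negligible_skeleton, of "\<lambda>x. g x - grad p x"]
      square_integrable_transfer(2)[OF square_integrable_diff[OF u(1) fe_piece_norms(1)[OF v K]] mK mK negligible_skeleton, of "\<lambda>x. u x - p x"]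
      not_skeleton[OF K] p(2) by auto
qed

end

section \<open>Weighted averages over moving balls\<close>

lemma unit_box_bump_gradient:
  "GDERIV unit_box_bump y :> grad unit_box_bump (y :: real^'n)"
  "\<exists>M. \<forall>y :: real^'n. norm (grad unit_box_bump y) \<le> M"
proof -
  have tf: "(unit_box_bump :: real^'n \<Rightarrow> real) \<in> test_functions UNIV"
    using unit_box_bump_outside C_times_box_bump
    by (auto simp: test_functions_def unit_box_bump_def not_le intro!: exI[of _ "cball 0 1"])
  then obtain D where "\<forall>y :: real^'n. GDERIV unit_box_bump y :> D y" by (auto simp: test_functions_def dest!: spec[of _ "Suc 0"])
  then have D: "\<And>y :: real^'n. GDERIV unit_box_bump y :> grad unit_box_bump y" using grad_eq by metis
  then show "GDERIV unit_box_bump y :> grad unit_box_bump (y :: real^'n)" .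
  show "\<exists>M. \<forall>y :: real^'n. norm (grad unit_box_bump y) \<le> M"
  proof (rule test_function_gradient[OF tf D])
    fix K :: "(real^'n) set"
    assume K: "compact K" "\<And>x. x \<notin> K \<Longrightarrow> grad unit_box_bump x = 0"
      "continuous_on UNIV (grad unit_box_bump :: real^'n \<Rightarrow> real^'n)"
    have "bounded ((grad unit_box_bump) ` K)"
      using compact_imp_bounded[OF compact_continuous_image[OF continuous_on_subset[OF K(3)] K(1)]] by auto
    then obtain M where M: "\<And>y. y \<in> K \<Longrightarrow> norm (grad unit_box_bump y) \<le> M" by (auto simp: bounded_iff)
    have "norm (grad unit_box_bump y) \<le> max M 0" for y :: "real^'n"
      using M[of y] K(2)[of y] by (cases "y \<in> K") (auto simp: le_max_iff_disj)
    then show ?thesis by blast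
  qed
qed

lemma bump_GDERIV:
  fixes x :: "real^'n"
  assumes r: "0 < r"
  shows "GDERIV (bump c r) x :> grad (bump c r) x"
    and "grad (bump c r) x = (1 / (bump_mass TYPE('n) * r ^ CARD('n) * r)) *\<^sub>R grad unit_box_bump ((1/r) *\<^sub>R x + - (1/r) *\<^sub>R c)"
proof -
  let ?y = "\<lambda>x. (1/r) *\<^sub>R x + - (1/r) *\<^sub>R c" and ?k = "1 / (bump_mass TYPE('n) * r ^ CARD('n))"
  have "(?y has_derivative (\<lambda>h. (1/r) *\<^sub>R h)) (at x)" by (auto intro!: derivative_eq_intros)
  from has_derivative_compose[OF this unit_box_bump_gradient(1)[unfolded gderiv_def]]
  have "GDERIV (\<lambda>x. unit_box_bump (?y x)) x :> (1/r) *\<^sub>R grad unit_box_bump (?y x)" by (simp add: gderiv_def)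
  from GDERIV_mult[OF GDERIV_const[of ?k] this]
  have *: "GDERIV (bump c r) x :> (1 / (bump_mass TYPE('n) * r ^ CARD('n) * r)) *\<^sub>R grad unit_box_bump (?y x)"
    by (simp add: bump_def[abs_def])
  from grad_eq[OF this] show "grad (bump c r) x = (1 / (bump_mass TYPE('n) * r ^ CARD('n) * r)) *\<^sub>R grad unit_box_bump (?y x)" .
  then show "GDERIV (bump c r) x :> grad (bump c r) x" using * by simp
qed

lemma grad_bump_outside:
  assumes "0 < r" "x \<notin> cball c r"
  shows "grad (bump c r) x = 0"
proof -
  have "((\<lambda>x. 0) has_derivative (\<lambda>h. h \<bullet> 0)) (at x)" by simp
  then have "(bump c r has_derivative (\<lambda>h. h \<bullet> 0)) (at x)"
    by (rule has_derivative_transform_within_open[of _ _ _ _ "- cball c r"])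
      (use assms bump_outside in \<open>auto simp: open_Compl\<close>)
  then show ?thesis using grad_eq by (metis gderiv_def)
qed

text \<open>While the ball moves from centre \<open>z\<close> with velocity \<open>a\<close> and its radius grows at the rate \<open>b\<close>, mass is
  transported by the velocity field \<open>V x = a + (b / r) (x - c)\<close>. The formula is the continuity equation
  \<open>\<partial>\<^sub>s \<eta> = - div (V \<eta>)\<close> with \<open>div V = d b / r\<close>.\<close>

lemma bump_path_derivative:
  fixes x a z :: "real^'n" and r\<^sub>1 b :: real
  defines "c \<equiv> \<lambda>s. z + s *\<^sub>R a" and "r \<equiv> \<lambda>s. r\<^sub>1 + s * b"
  assumes r: "0 < r s"
  shows "((\<lambda>s. bump (c s) (r s) x) has_real_derivative
    - ((a + (b / r s) *\<^sub>R (x - c s)) \<bullet> grad (bump (c s) (r s)) x + (real CARD('n) * b / r s) * bump (c s) (r s) x)) (at s)"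
proof -
  let ?m = "bump_mass TYPE('n)" and ?d = "CARD('n)"
  let ?y = "\<lambda>s. (1 / r s) *\<^sub>R x + - (1 / r s) *\<^sub>R c s"
  let ?V = "a + (b / r s) *\<^sub>R (x - c s)"
  let ?G = "grad unit_box_bump (?y s)"
  have m: "0 < ?m" by (rule bump_mass_pos)
  have dr: "(r has_real_derivative b) (at s)" unfolding r_def by (auto intro!: derivative_eq_intros)
  have dc: "(c has_vector_derivative a) (at s)" unfolding c_def
    by (auto intro!: derivative_eq_intros simp: has_vector_derivative_def)
  have di: "((\<lambda>s. 1 / r s) has_real_derivative - (b / (r s * r s))) (at s)"
    using r by (auto intro!: derivative_eq_intros dr simp: divide_simps)
  have "((\<lambda>s. (1 / r s) *\<^sub>R (x - c s)) has_vector_derivative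
      ((1 / r s) *\<^sub>R (0 - a) + (- (b / (r s * r s))) *\<^sub>R (x - c s))) (at s)"
    by (intro has_vector_derivative_scaleR di has_vector_derivative_diff dc has_vector_derivative_const)
  moreover have "(\<lambda>s. (1 / r s) *\<^sub>R (x - c s)) = ?y" by (auto simp: algebra_simps)
  moreover have "(1 / r s) *\<^sub>R (0 - a) + (- (b / (r s * r s))) *\<^sub>R (x - c s) = - (1 / r s) *\<^sub>R ?V"
    by (simp add: scaleR_add_right)
  ultimately have dy: "(?y has_vector_derivative - (1 / r s) *\<^sub>R ?V) (at s)" by simp
  have "((\<lambda>s. unit_box_bump (?y s)) has_derivative (\<lambda>h. (h *\<^sub>R (- (1 / r s) *\<^sub>R ?V)) \<bullet> ?G)) (at s)"
    by (rule has_derivative_compose[OF dy[unfolded has_vector_derivative_def] unit_box_bump_gradient(1)[unfolded gderiv_def]])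
  then have dB: "((\<lambda>s. unit_box_bump (?y s)) has_real_derivative - (1 / r s) * (?V \<bullet> ?G)) (at s)"
    unfolding has_field_derivative_def by (rule has_derivative_eq_rhs) (auto simp: fun_eq_iff)
  have rd: "r s ^ (?d - 1) * r s = r s ^ ?d" by (rule power_minus_mult) simp
  have dP: "((\<lambda>s. 1 / (?m * r s ^ ?d)) has_real_derivative - (real ?d * b / r s) / (?m * r s ^ ?d)) (at s)"
  proof -
    have "((\<lambda>s. 1 / (?m * r s ^ ?d)) has_real_derivative
        - (?m * (real ?d * r s ^ (?d - 1) * b)) / (?m * r s ^ ?d)\<^sup>2) (at s)"
      using r m by (auto intro!: derivative_eq_intros dr simp: power2_eq_square)
    moreover have "- (?m * (real ?d * r s ^ (?d - 1) * b)) / (?m * r s ^ ?d)\<^sup>2 = - (real ?d * b / r s) / (?m * r s ^ ?d)"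
    proof -
      have "?m * (real ?d * r s ^ (?d - 1) * b) * r s = real ?d * b * (?m * r s ^ ?d)" by (simp add: rd[symmetric] mult_ac)
      then show ?thesis using r m by (simp add: divide_simps power2_eq_square)
    qed
    ultimately show ?thesis by simp
  qed
  have "((\<lambda>s. unit_box_bump (?y s) * (1 / (?m * r s ^ ?d))) has_real_derivative
     - (1 / r s) * (?V \<bullet> ?G) * (1 / (?m * r s ^ ?d)) + - (real ?d * b / r s) / (?m * r s ^ ?d) * unit_box_bump (?y s)) (at s)"
    by (rule DERIV_mult[OF dB dP])
  moreover have "- (1 / r s) * (?V \<bullet> ?G) * (1 / (?m * r s ^ ?d)) + - (real ?d * b / r s) / (?m * r s ^ ?d) * unit_box_bump (?y s) =
     - (?V \<bullet> grad (bump (c s) (r s)) x + (real ?d * b / r s) * bump (c s) (r s) x)"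
    using r m by (simp add: bump_GDERIV(2)[OF r] bump_def field_simps)
  ultimately show ?thesis by (simp add: bump_def)
qed

lemma bump_integrable_product:
  fixes w :: "real^'n \<Rightarrow> 'b::euclidean_space"
  assumes w: "w locally_integrable_on U" and c: "cball c r \<subseteq> U" "0 < r" and f: "continuous_on UNIV f"
  shows "integrable lebesgue (\<lambda>x. (f x * bump c r x) *\<^sub>R w x)"
proof (rule integrable_locally_times_continuous[OF w compact_cball c(1)])
  show "continuous_on UNIV (\<lambda>x. f x * bump c r x)"
    using f continuous_on_C_times[OF C_times_bump] by (intro continuous_on_mult) auto
qed (use bump_outside[OF c(2)] in auto)

text \<open>The definition of the weak gradient, tested with the components of the vector field \<open>V \<eta>\<close>.\<close>

lemma weak_divergence_bump:
  fixes a c :: "real^'n" and t :: real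
  assumes w: "has_weak_gradient U w g" and U: "open U" and c: "cball c r \<subseteq> U" "0 < r"
  defines "V \<equiv> \<lambda>x. a + t *\<^sub>R (x - c)"
  shows "(LINT x|lebesgue. w x * (V x \<bullet> grad (bump c r) x + real CARD('n) * t * bump c r x)) =
     - (LINT x|lebesgue. bump c r x * (V x \<bullet> g x))"
    and "integrable lebesgue (\<lambda>x. w x * (V x \<bullet> grad (bump c r) x + real CARD('n) * t * bump c r x))"
    and "integrable lebesgue (\<lambda>x. bump c r x * (V x \<bullet> g x))"
proof -
  let ?\<phi> = "\<lambda>i x. V x $ i * bump c r x"
  let ?D = "\<lambda>i x. V x $ i *\<^sub>R grad (bump c r) x + bump c r x *\<^sub>R (t *\<^sub>R axis i 1)"
  have l: "w locally_integrable_on U" "g locally_integrable_on U" using w by (auto simp: has_weak_gradient_def)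
  have V: "GDERIV (\<lambda>x. V x $ i) x :> t *\<^sub>R axis i 1" for i x
    unfolding gderiv_def V_def
    by (auto intro!: derivative_eq_intros bounded_linear_imp_has_derivative bounded_linear_vec_nth simp: inner_axis)
  have D: "GDERIV (?\<phi> i) x :> ?D i x" for i x by (rule GDERIV_mult[OF V bump_GDERIV(1)[OF c(2)]])
  have tf: "?\<phi> i \<in> test_functions U" for i
  proof -
    have "C_times k (?\<phi> i)" for k
    proof -
      have "continuous_on UNIV (\<lambda>x. V x $ i)" unfolding V_def by (intro continuous_intros)
      moreover have "C_times m (\<lambda>x. (t *\<^sub>R axis i 1 :: real^'n) $ j)" for m j by (rule C_times_const)
      ultimately have "C_times k (\<lambda>x. V x $ i)" using V
        by (cases k) (auto simp del: scaleR_vec_def vector_scaleR_component intro!: exI[of _ "\<lambda>x. t *\<^sub>R axis i 1"])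
      then show ?thesis by (intro C_times_mult C_times_bump)
    qed
    then show ?thesis using bump_outside[OF c(2), of _ c] c(1)
      by (auto simp: test_functions_def intro!: exI[of _ "cball c r"])
  qed
  have wd: "(LINT x|lebesgue. w x *\<^sub>R ?D i x) = - (LINT x|lebesgue. ?\<phi> i x *\<^sub>R g x)" for i
  proof -
    have "\<forall>\<phi>\<in>test_functions U. \<forall>D. (\<forall>x. GDERIV \<phi> x :> D x) \<longrightarrow>
        (LINT x|lebesgue. w x *\<^sub>R D x) = - (LINT x|lebesgue. \<phi> x *\<^sub>R g x)"
      using w by (simp add: has_weak_gradient_iff[OF U])
    from spec[OF bspec[OF this tf[of i]], of "?D i"] show ?thesis using D by blast
  qed
  have i1: "integrable lebesgue (\<lambda>x. w x *\<^sub>R ?D i x)" for i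
  proof -
    show ?thesis
      by (rule test_function_gradient[OF tf D]) (rule integrable_locally_times_continuous_vector[OF l(1)])
  qed
  have i2: "integrable lebesgue (\<lambda>x. ?\<phi> i x *\<^sub>R g x)" for i
    by (rule bump_integrable_product[OF l(2) c]) (auto simp: V_def intro!: continuous_intros)
  have i1': "integrable lebesgue (\<lambda>x. (w x *\<^sub>R ?D i x) $ i)" and i2': "integrable lebesgue (\<lambda>x. (?\<phi> i x *\<^sub>R g x) $ i)" for i
    using integrable_bounded_linear[OF bounded_linear_vec_nth] i1 i2 by blast+
  have e1: "(\<lambda>x. \<Sum>i\<in>UNIV. (w x *\<^sub>R ?D i x) $ i) = (\<lambda>x. w x * (V x \<bullet> grad (bump c r) x + real CARD('n) * t * bump c r x))"
    by (auto simp: inner_vec_def sum.distrib sum_distrib_left distrib_left mult_ac)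
  have e2: "(\<lambda>x. \<Sum>i\<in>UNIV. (?\<phi> i x *\<^sub>R g x) $ i) = (\<lambda>x. bump c r x * (V x \<bullet> g x))"
    by (auto simp: inner_vec_def sum_distrib_left mult_ac)
  show "integrable lebesgue (\<lambda>x. w x * (V x \<bullet> grad (bump c r) x + real CARD('n) * t * bump c r x))"
    unfolding e1[symmetric] by (intro Bochner_Integration.integrable_sum i1')
  show "integrable lebesgue (\<lambda>x. bump c r x * (V x \<bullet> g x))"
    unfolding e2[symmetric] by (intro Bochner_Integration.integrable_sum i2')
  have "(LINT x|lebesgue. (w x *\<^sub>R ?D i x) $ i) = - (LINT x|lebesgue. (?\<phi> i x *\<^sub>R g x) $ i)" for i
    unfolding integral_bounded_linear[OF bounded_linear_vec_nth i1] integral_bounded_linear[OF bounded_linear_vec_nth i2] wd by simp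
  then show "(LINT x|lebesgue. w x * (V x \<bullet> grad (bump c r) x + real CARD('n) * t * bump c r x)) =
     - (LINT x|lebesgue. bump c r x * (V x \<bullet> g x))"
    unfolding e1[symmetric] e2[symmetric] Bochner_Integration.integral_sum[OF i1'] Bochner_Integration.integral_sum[OF i2']
    by (simp add: sum_negf)
qed

text \<open>This takes the place of a Poincare inequality. The weighted average of \<open>w\<close> is followed along the path
  of balls. By the continuity equation its derivative is \<open>\<integral> \<eta> V \<bullet> g\<close>, where \<open>V\<close> is at most
  \<open>|c\<^sub>2 - c\<^sub>1| + |r\<^sub>2 - r\<^sub>1|\<close> on the ball. The derivative in the path parameter falls on the
  smooth weight, so a weak gradient of \<open>w\<close> is enough.\<close>

lemma average_difference_bound:
  fixes w :: "real^'n \<Rightarrow> real" and c\<^sub>1 c\<^sub>2 :: "real^'n"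
  assumes w: "has_weak_gradient U w g" and U: "open U" and S: "compact S" "S \<subseteq> U"
    and r: "0 < \<rho>" "\<rho> \<le> r\<^sub>1" "\<rho> \<le> r\<^sub>2"
    and path: "\<And>s. 0 \<le> s \<Longrightarrow> s \<le> 1 \<Longrightarrow> cball (c\<^sub>1 + s *\<^sub>R (c\<^sub>2 - c\<^sub>1)) (r\<^sub>1 + s * (r\<^sub>2 - r\<^sub>1)) \<subseteq> S"
  shows "\<bar>(LINT x|lebesgue. bump c\<^sub>2 r\<^sub>2 x * w x) - (LINT x|lebesgue. bump c\<^sub>1 r\<^sub>1 x * w x)\<bar> \<le>
    (norm (c\<^sub>2 - c\<^sub>1) + \<bar>r\<^sub>2 - r\<^sub>1\<bar>) * (1 / (bump_mass TYPE('n) * \<rho> ^ CARD('n))) * (LINT x|lebesgue_on S. norm (g x))"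
proof -
  let ?d = "CARD('n)" and ?m = "bump_mass TYPE('n)"
  define a where "a = c\<^sub>2 - c\<^sub>1" define b where "b = r\<^sub>2 - r\<^sub>1"
  define c where "c s = c\<^sub>1 + s *\<^sub>R a" for s define rr where "rr s = r\<^sub>1 + s * b" for s
  define V where "V s x = a + (b / rr s) *\<^sub>R (x - c s)" for s x
  define F where "F s = (LINT x|lebesgue. bump (c s) (rr s) x * w x)" for s
  define F' where "F' s = (LINT x|lebesgue. bump (c s) (rr s) x * (V s x \<bullet> g x))" for s
  define k' where "k' s x = - (V s x \<bullet> grad (bump (c s) (rr s)) x + (real ?d * (b / rr s)) * bump (c s) (rr s) x)" for s x
  have m: "0 < ?m" by (rule bump_mass_pos)
  have l: "w locally_integrable_on U" "g locally_integrable_on U" using w by (auto simp: has_weak_gradient_def)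
  have rr: "\<rho> \<le> rr s" "0 < rr s" if "s \<in> {0..1}" for s
  proof -
    have "0 \<le> (1 - s) * (r\<^sub>1 - \<rho>) + s * (r\<^sub>2 - \<rho>)" using that r by (intro add_nonneg_nonneg mult_nonneg_nonneg) auto
    then show "\<rho> \<le> rr s" by (simp add: rr_def b_def algebra_simps)
    then show "0 < rr s" using r by simp
  qed
  have cb: "cball (c s) (rr s) \<subseteq> S" "cball (c s) (rr s) \<subseteq> U" if "s \<in> {0..1}" for s
    using path[of s] S(2) that by (auto simp: c_def rr_def a_def b_def)
  have Vb: "norm (V s x) \<le> norm a + \<bar>b\<bar>" if s: "s \<in> {0..1}" and x: "x \<in> cball (c s) (rr s)" for s x
  proof -
    have "norm (V s x) \<le> norm a + norm ((b / rr s) *\<^sub>R (x - c s))" unfolding V_def by (rule norm_triangle_ineq)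
    also have "norm ((b / rr s) *\<^sub>R (x - c s)) = \<bar>b\<bar> * (norm (x - c s) / rr s)" using rr[OF s] by simp
    also have "\<dots> \<le> \<bar>b\<bar> * 1"
      using x rr[OF s] by (intro mult_left_mono) (auto simp: dist_norm norm_minus_commute)
    finally show ?thesis by simp
  qed
  obtain M where M: "\<And>y :: real^'n. norm (grad unit_box_bump y) \<le> M" using unit_box_bump_gradient(2) by blast
  have M0: "0 \<le> M" using order.trans[OF norm_ge_zero M] .
  have kd: "((\<lambda>s. bump (c s) (rr s) x) has_real_derivative k' s x) (at s)" if "s \<in> {0..1}" for s x
    using bump_path_derivative[of r\<^sub>1 s b c\<^sub>1 a x] rr[OF that] by (simp add: c_def rr_def V_def k'_def)
  \<comment> \<open>\<open>L\<close> dominates the difference quotients of the weight\<close>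
  define L where "L = (norm a + \<bar>b\<bar>) * (M / (?m * \<rho> ^ ?d * \<rho>)) + real ?d * (\<bar>b\<bar> / \<rho>) * (1 / (?m * \<rho> ^ ?d))"
  have L0: "0 \<le> L" unfolding L_def using M0 m r by (intro add_nonneg_nonneg mult_nonneg_nonneg divide_nonneg_nonneg) auto
  have bb: "bump (c s) (rr s) x \<le> 1 / (?m * \<rho> ^ ?d)" if s: "s \<in> {0..1}" for s x
  proof -
    have "bump (c s) (rr s) x \<le> 1 / (?m * rr s ^ ?d)" by (rule bump_le[OF rr(2)[OF s]])
    also have "\<dots> \<le> 1 / (?m * \<rho> ^ ?d)"
      using m r rr[OF s] by (intro divide_left_mono mult_left_mono power_mono mult_pos_pos zero_less_power) auto
    finally show ?thesis .
  qed
  have kb: "\<bar>k' s x\<bar> \<le> L" if s: "s \<in> {0..1}" for s x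
  proof (cases "x \<in> cball (c s) (rr s)")
    case True
    have "norm (grad (bump (c s) (rr s)) x) = (1 / (?m * rr s ^ ?d * rr s)) * norm (grad unit_box_bump ((1/rr s) *\<^sub>R x + - (1/rr s) *\<^sub>R c s))"
      using m rr[OF s] by (simp add: bump_GDERIV(2))
    also have "\<dots> \<le> (1 / (?m * \<rho> ^ ?d * \<rho>)) * M"
      using m r rr[OF s] M M0
      by (intro mult_mono divide_left_mono power_mono mult_pos_pos zero_less_power mult_left_mono) auto
    finally have g: "norm (grad (bump (c s) (rr s)) x) \<le> M / (?m * \<rho> ^ ?d * \<rho>)" by simp
    have "\<bar>k' s x\<bar> \<le> \<bar>V s x \<bullet> grad (bump (c s) (rr s)) x\<bar> + \<bar>(real ?d * (b / rr s)) * bump (c s) (rr s) x\<bar>"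
      unfolding k'_def by (simp only: abs_minus_cancel abs_triangle_ineq)
    also have "\<dots> \<le> norm (V s x) * norm (grad (bump (c s) (rr s)) x) + (real ?d * (\<bar>b\<bar> / rr s)) * bump (c s) (rr s) x"
      using rr[OF s] bump_nonneg[OF rr(2)[OF s], of "c s" x]
      by (intro add_mono Cauchy_Schwarz_ineq2) (auto simp: abs_mult abs_divide)
    also have "\<dots> \<le> L" unfolding L_def
      using Vb[OF s True] g bb[OF s, of x] rr[OF s] bump_nonneg[OF rr(2)[OF s], of "c s" x] r
      by (intro add_mono mult_mono divide_left_mono mult_pos_pos mult_nonneg_nonneg divide_nonneg_nonneg) auto
    finally show ?thesis .
  next
    case False
    then show ?thesis using L0 bump_outside[OF rr(2)[OF s] False] grad_bump_outside[OF rr(2)[OF s] False]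
      by (simp add: k'_def)
  qed
  have lip: "\<bar>bump (c s) (rr s) x - bump (c t) (rr t) x\<bar> \<le> L * \<bar>s - t\<bar>" if "s \<in> {0..1}" "t \<in> {0..1}" for s t x
  proof -
    have "norm (bump (c s) (rr s) x - bump (c t) (rr t) x) \<le> L * norm (s - t)"
    proof (rule field_differentiable_bound[of "{0..1}" "\<lambda>s. bump (c s) (rr s) x" "\<lambda>s. k' s x"])
      show "((\<lambda>s. bump (c s) (rr s) x) has_field_derivative k' u x) (at u within {0..1})" if "u \<in> {0..1}" for u
        using kd[OF that] has_field_derivative_at_within by blast
    qed (use kb that in auto)
    then show ?thesis by simp
  qed
  have intS: "integrable lebesgue (\<lambda>x. bump (c s) (rr s) x * w x)" if s: "s \<in> {0..1}" for s
    using bump_integrable_product[OF l(1) cb(2)[OF s] rr(2)[OF s], of "\<lambda>_. 1"] by simp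
  have wS: "integrable lebesgue (\<lambda>x. indicator S x *\<^sub>R w x)"
    using l(1) S by (auto simp: locally_integrable_on_def integrable_restrict_space compact_in_lebesgue)
  have gS: "integrable (lebesgue_on S) g" using l(2) S by (auto simp: locally_integrable_on_def)
  have F'eq: "F' s = (LINT x|lebesgue. w x * k' s x)" and k'i: "integrable lebesgue (\<lambda>x. w x * k' s x)" if s: "s \<in> {0..1}" for s
  proof -
    have "(LINT x|lebesgue. w x * k' s x) = - (LINT x|lebesgue. w x * (V s x \<bullet> grad (bump (c s) (rr s)) x + real ?d * (b / rr s) * bump (c s) (rr s) x))"
      unfolding k'_def mult_minus_right by (rule Bochner_Integration.integral_minus)
    then show "F' s = (LINT x|lebesgue. w x * k' s x)"
      unfolding F'_def V_def using weak_divergence_bump(1)[OF w U cb(2)[OF s] rr(2)[OF s], of a "b / rr s"] by simp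
    show "integrable lebesgue (\<lambda>x. w x * k' s x)"
      using weak_divergence_bump(2)[OF w U cb(2)[OF s] rr(2)[OF s], of a "b / rr s"]
      unfolding k'_def V_def mult_minus_right by (rule Bochner_Integration.integrable_minus)
  qed
  have Fd: "(F has_field_derivative F' s) (at s within {0..1})" if s: "s \<in> {0..1}" for s
    unfolding has_field_derivative_iff tendsto_at_iff_sequentially
  proof (intro allI impI)
    fix X :: "nat \<Rightarrow> real" assume X: "\<forall>i. X i \<in> {0..1} - {s}" "X \<longlonglongrightarrow> s"
    let ?q = "\<lambda>n x. ((bump (c (X n)) (rr (X n)) x - bump (c s) (rr s) x) / (X n - s)) * w x"
    have "(\<lambda>n. LINT x|lebesgue. ?q n x) \<longlonglongrightarrow> (LINT x|lebesgue. w x * k' s x)"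
    proof (rule integral_dominated_convergence[where w = "\<lambda>x. L * norm (indicator S x *\<^sub>R w x)"])
      show "(\<lambda>x. w x * k' s x) \<in> borel_measurable lebesgue" using k'i[OF s] by auto
      have "integrable lebesgue (?q n)" for n
      proof -
        have "integrable lebesgue (\<lambda>x. (bump (c (X n)) (rr (X n)) x * w x - bump (c s) (rr s) x * w x) / (X n - s))"
          using intS X(1) s by (intro integrable_divide Bochner_Integration.integrable_diff) auto
        then show ?thesis by (simp add: algebra_simps diff_divide_distrib)
      qed
      then show "?q n \<in> borel_measurable lebesgue" for n by auto
      show "integrable lebesgue (\<lambda>x. L * norm (indicator S x *\<^sub>R w x))"
        using integrable_norm[OF wS] by (intro integrable_mult_right)
      show "AE x in lebesgue. (\<lambda>n. ?q n x) \<longlonglongrightarrow> w x * k' s x"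
      proof (rule AE_I2)
        fix x
        have "((\<lambda>s. bump (c s) (rr s) x) has_field_derivative k' s x) (at s within {0..1})"
          using kd[OF s] has_field_derivative_at_within by blast
        then have "(\<lambda>n. (bump (c (X n)) (rr (X n)) x - bump (c s) (rr s) x) / (X n - s)) \<longlonglongrightarrow> k' s x"
          using X unfolding has_field_derivative_iff tendsto_at_iff_sequentially by (auto simp: o_def)
        then have "(\<lambda>n. ?q n x) \<longlonglongrightarrow> k' s x * w x" by (rule tendsto_mult_right)
        then show "(\<lambda>n. ?q n x) \<longlonglongrightarrow> w x * k' s x" by (simp only: mult.commute[of "w x"])
      qed
      show "AE x in lebesgue. norm (?q n x) \<le> L * norm (indicator S x *\<^sub>R w x)" for n
      proof (rule AE_I2)
        fix x
        have Xn: "X n \<in> {0..1}" "X n \<noteq> s" using X(1) by auto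
        show "norm (?q n x) \<le> L * norm (indicator S x *\<^sub>R w x)"
        proof (cases "x \<in> S")
          case True
          have "\<bar>bump (c (X n)) (rr (X n)) x - bump (c s) (rr s) x\<bar> / \<bar>X n - s\<bar> \<le> L"
            using lip[OF Xn(1) s, of x] Xn(2) by (subst pos_divide_le_eq) auto
          from mult_right_mono[OF this, of "\<bar>w x\<bar>"] show ?thesis using True by (simp add: abs_mult abs_divide)
        next
          case False
          then have "bump (c (X n)) (rr (X n)) x = 0" "bump (c s) (rr s) x = 0"
            using cb(1)[OF Xn(1)] cb(1)[OF s] rr(2)[OF Xn(1)] rr(2)[OF s] by (auto intro!: bump_outside)
          then show ?thesis using False by simp
        qed
      qed
    qed
    also have "(LINT x|lebesgue. w x * k' s x) = F' s" using F'eq[OF s] by simp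
    also have "(\<lambda>n. LINT x|lebesgue. ?q n x) = (\<lambda>y. (F y - F s) / (y - s)) \<circ> X"
    proof
      fix n
      have "(LINT x|lebesgue. ?q n x) = (LINT x|lebesgue. (bump (c (X n)) (rr (X n)) x * w x - bump (c s) (rr s) x * w x) / (X n - s))"
        by (simp add: algebra_simps diff_divide_distrib)
      also have "\<dots> = (F (X n) - F s) / (X n - s)"
        unfolding F_def using intS[of "X n"] intS[OF s] X(1) by (simp add: integral_divide_zero)
      finally show "(LINT x|lebesgue. ?q n x) = ((\<lambda>y. (F y - F s) / (y - s)) \<circ> X) n" by simp
    qed
    finally show "((\<lambda>y. (F y - F s) / (y - s)) \<circ> X) \<longlonglongrightarrow> F' s" .
  qed
  let ?B = "(norm a + \<bar>b\<bar>) * (1 / (?m * \<rho> ^ ?d)) * (LINT x|lebesgue_on S. norm (g x))"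
  have F'b: "norm (F' s) \<le> ?B" if s: "s \<in> {0..1}" for s
  proof -
    let ?k = "(norm a + \<bar>b\<bar>) * (1 / (?m * \<rho> ^ ?d))"
    have i: "integrable lebesgue (\<lambda>x. indicator S x *\<^sub>R norm (g x))"
      using integrable_norm[OF gS] S by (simp add: integrable_restrict_space compact_in_lebesgue)
    have "norm (F' s) \<le> (LINT x|lebesgue. norm (bump (c s) (rr s) x * (V s x \<bullet> g x)))"
      unfolding F'_def by (rule integral_norm_bound)
    also have "\<dots> \<le> (LINT x|lebesgue. ?k * (indicator S x *\<^sub>R norm (g x)))"
    proof (rule integral_mono)
      show "integrable lebesgue (\<lambda>x. norm (bump (c s) (rr s) x * (V s x \<bullet> g x)))"
        using weak_divergence_bump(3)[OF w U cb(2)[OF s] rr(2)[OF s], of a "b / rr s"] unfolding V_def by (rule integrable_norm)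
      show "integrable lebesgue (\<lambda>x. ?k * (indicator S x *\<^sub>R norm (g x)))" using i by (rule integrable_mult_right)
      fix x
      show "norm (bump (c s) (rr s) x * (V s x \<bullet> g x)) \<le> ?k * (indicator S x *\<^sub>R norm (g x))"
      proof (cases "x \<in> cball (c s) (rr s)")
        case True
        have "norm (bump (c s) (rr s) x * (V s x \<bullet> g x)) = bump (c s) (rr s) x * \<bar>V s x \<bullet> g x\<bar>"
          using bump_nonneg[OF rr(2)[OF s], of "c s" x] by (simp add: abs_mult)
        also have "\<dots> \<le> (1 / (?m * \<rho> ^ ?d)) * ((norm a + \<bar>b\<bar>) * norm (g x))"
          using bb[OF s, of x] bump_nonneg[OF rr(2)[OF s], of "c s" x] Vb[OF s True] m r
          by (intro mult_mono order.trans[OF Cauchy_Schwarz_ineq2] mult_right_mono) auto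
        finally show ?thesis using True cb(1)[OF s] by (auto simp: mult_ac)
      next
        case False
        then show ?thesis using bump_outside[OF rr(2)[OF s] False] m r
          by (auto intro!: mult_nonneg_nonneg divide_nonneg_nonneg)
      qed
    qed
    also have "\<dots> = ?B" using S by (simp add: integral_restrict_space compact_in_lebesgue)
    finally show ?thesis .
  qed
  have "norm (F 1 - F 0) \<le> ?B * norm (1 - 0 :: real)"
    by (rule field_differentiable_bound[of "{0..1}" F F']) (use Fd F'b in auto)
  then show ?thesis by (simp add: F_def c_def rr_def a_def b_def)
qed

section \<open>Facets\<close>

lemma facet_convex_hull:
  fixes K :: "(real^'n) set"
  assumes K: "full_simplex K" and E: "E facet_of K"
  obtains a where "a \<in> verts K" "E = convex hull (verts K - {a})" "verts E = verts K - {a}"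
proof -
  have "E facet_of convex hull (verts K)" using E full_simplex_verts(3)[OF K] by simp
  then obtain a where a: "a \<in> verts K" "E = convex hull (verts K - {a})"
    using facet_of_convex_hull_affine_independent[OF full_simplex_verts(1)[OF K]] by blast
  have "\<not> affine_dependent (verts K - {a})"
    using affine_dependent_subset[of "verts K - {a}" "verts K"] full_simplex_verts(1)[OF K] by blast
  then have "verts E = verts K - {a}" using a(2) convex_hull_verts by blast
  then show ?thesis using that a by blast
qed

lemma card_facets:
  fixes K :: "(real^'n) set"
  assumes K: "full_simplex K"
  shows "finite {E. E facet_of K}" "card {E. E facet_of K} \<le> CARD('n) + 1"
proof -
  note fin = full_simplex_verts(4)[OF K]
  have sub: "{E. E facet_of K} \<subseteq> (\<lambda>a. convex hull (verts K - {a})) ` verts K"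
  proof
    fix E assume "E \<in> {E. E facet_of K}"
    then have "E facet_of K" by simp
    then obtain a where "a \<in> verts K" "E = convex hull (verts K - {a})" using facet_convex_hull[OF K] by metis
    then show "E \<in> (\<lambda>a. convex hull (verts K - {a})) ` verts K" by simp
  qed
  then show "finite {E. E facet_of K}" using fin finite_surj by blast
  have "card {E. E facet_of K} \<le> card (verts K)" using surj_card_le[OF fin sub] .
  then show "card {E. E facet_of K} \<le> CARD('n) + 1" using full_simplex_verts(2)[OF K] by simp
qed

lemma facet_subset_frontier:
  fixes K :: "(real^'n) set"
  assumes K: "full_simplex K" and E: "E facet_of K"
  shows "E \<subseteq> frontier K"
proof -
  have f: "E face_of K" "E \<noteq> K" using facet_of_imp_face_of[OF E] E facet_of_irrefl[of K] by auto
  have "E \<inter> interior K = {}" "E \<subseteq> K" using face_of_disjoint_interior[OF f] face_of_imp_subset[OF f(1)] .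
  then show ?thesis using closure_subset[of K] by (auto simp: frontier_def)
qed

text \<open>At the barycentre of the common facet the coordinates of the vertices of the facet are \<open>1 / d\<close>, and
  their slopes are at most the reciprocal inball diameter. They remain positive within this radius, for
  both elements.\<close>

definition facet_radius :: "(real^'n) set \<Rightarrow> (real^'n) set \<Rightarrow> real" where
  "facet_radius K K' = min (inball_diameter K) (inball_diameter K') / (2 * real CARD('n))"

definition facet_center :: "(real^'n) set \<Rightarrow> real^'n" where
  "facet_center E = (\<Sum>a\<in>verts E. (1 / real CARD('n)) *\<^sub>R a)"

definition inball :: "(real^'n) set \<Rightarrow> (real^'n) \<times> real" where
  "inball K = (SOME p. cball (fst p) (snd p) \<subseteq> K \<and> inball_diameter K / 4 < snd p)"

text \<open>Half of the inball radius is used so that even the ball of twice the averaging radius lies in the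
  element. This leaves room for the interior of the patch.\<close>

definition elem_avg :: "(real^'n) set \<Rightarrow> (real^'n \<Rightarrow> real) \<Rightarrow> real" where
  "elem_avg K f = (LINT x|lebesgue. bump (fst (inball K)) (snd (inball K) / 2) x * f x)"

context mesh
begin

text \<open>The intersection of \<open>K\<close> with an element that has the facet \<open>E\<close> is a face containing \<open>E\<close>. Unless the
  two elements coincide, it has no larger dimension than \<open>E\<close>, so it is \<open>E\<close>.\<close>

lemma face_is_facet:
  assumes E: "E \<in> faces \<T>" and K: "K \<in> \<T>" "E \<subseteq> K"
  shows "E facet_of K"
proof -
  obtain K\<^sub>0 where K0: "K\<^sub>0 \<in> \<T>" "E facet_of K\<^sub>0" using E by (auto simp: faces_def)
  have E0: "E face_of K\<^sub>0" "E \<noteq> {}" "aff_dim E = aff_dim K\<^sub>0 - 1" using K0(2) by (auto simp: facet_of_def)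
  have ad: "aff_dim K\<^sub>0 = aff_dim K" using aff_dim_simplex mesh_simplex K0(1) K(1) by metis
  have cv: "convex K\<^sub>0" using full_simplex_convex mesh_simplex K0(1) by blast
  let ?F = "K\<^sub>0 \<inter> K"
  show ?thesis
  proof (cases "?F = K\<^sub>0")
    case True
    then have "K\<^sub>0 = K" using element_subset_imp_eq[OF K0(1) K(1)] by blast
    then show ?thesis using K0 by simp
  next
    case False
    have F: "?F face_of K\<^sub>0" "?F face_of K" using Int_face K0(1) K(1) by blast+
    have EF: "E \<subseteq> ?F" using K(2) E0(1) face_of_imp_subset by blast
    have "aff_dim ?F < aff_dim K\<^sub>0" using face_of_aff_dim_lt[OF cv F(1) False] .
    then have dF: "aff_dim ?F \<le> aff_dim E" using E0(3) by simp
    have "E = ?F"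
    proof (rule ccontr)
      assume "E \<noteq> ?F"
      moreover have "E face_of ?F" using face_of_subset[OF E0(1) EF] by simp
      ultimately have "aff_dim E < aff_dim ?F" using face_of_aff_dim_lt face_of_imp_convex F(1) by blast
      then show False using dF by simp
    qed
    then show ?thesis using F(2) E0 ad by (simp add: facet_of_def)
  qed
qed

lemma face_frontier_iff:
  assumes "E \<in> faces \<T>" "K \<in> \<T>"
  shows "E \<subseteq> frontier K \<longleftrightarrow> E facet_of K"
proof
  assume "E \<subseteq> frontier K"
  moreover have "frontier K \<subseteq> K"
    using frontier_subset_closed compact_imp_closed full_simplex_compact mesh_simplex assms(2) by blast
  ultimately show "E facet_of K" using face_is_facet[OF assms] by blast
qed (use facet_subset_frontier mesh_simplex assms in blast)

section \<open>Two elements with a common facet\<close>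

lemma affine_combination_bary:
  assumes "full_simplex K" "finite W" "(\<Sum>a\<in>W. u a) = 1"
  shows "bary K c (\<Sum>a\<in>W. u a *\<^sub>R a) = (\<Sum>a\<in>W. u a * bary K c a)"
proof -
  have "(\<Sum>a\<in>W. u a * bary K c a) = (\<Sum>a\<in>W. u a * (fst (bary_fun K c) \<bullet> a)) + (\<Sum>a\<in>W. u a) * snd (bary_fun K c)"
    by (simp add: bary_def distrib_left sum.distrib sum_distrib_right)
  then show ?thesis using assms by (simp add: bary_def inner_sum_right)
qed

lemma bary_convex_combination:
  "bary K c ((1 - s) *\<^sub>R x + s *\<^sub>R y) = (1 - s) * bary K c x + s * bary K c y"
  by (simp add: bary_def inner_add_right algebra_simps)

lemma facet_center_mem:
  fixes K :: "(real^'n) set"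
  assumes K: "full_simplex K" and E: "E facet_of K"
  shows "facet_center E \<in> E"
proof -
  obtain a where a: "a \<in> verts K" "verts E = verts K - {a}" "E = convex hull (verts K - {a})"
    by (rule facet_convex_hull[OF K E]) (rule that, assumption+)
  have "card (verts E) = CARD('n)" "finite (verts E)" using a full_simplex_verts(2,4)[OF K] by simp_all
  then have "facet_center E \<in> convex hull verts E" unfolding facet_center_def
    by (subst convex_hull_finite) (auto intro!: exI[of _ "\<lambda>_. 1 / real CARD('n)"])
  then show ?thesis using a by simp
qed

lemma bary_near_facet_center:
  assumes K: "K \<in> \<T>" and E: "E facet_of K" and a: "a \<in> verts E"
    and R: "R * real CARD('n) < inball_diameter K" and x: "x \<in> cball (facet_center E) R"
  shows "0 < bary K a x" "bary K a (facet_center E) = 1 / real CARD('n)"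
proof -
  note Ks = mesh_simplex[OF K]
  note fin = full_simplex_verts(4)[OF Ks]
  obtain b where b: "b \<in> verts K" "verts E = verts K - {b}"
    by (rule facet_convex_hull[OF Ks E]) (rule that, assumption+)
  have cardE: "card (verts E) = CARD('n)" using b full_simplex_verts(2)[OF Ks] fin by simp
  have finE: "finite (verts E)" using b(2) fin by simp
  have "bary K a (facet_center E) = (\<Sum>c\<in>verts E. (1 / real CARD('n)) * bary K a c)"
    unfolding facet_center_def by (rule affine_combination_bary[OF Ks finE]) (simp add: cardE)
  also have "\<dots> = (\<Sum>c\<in>verts E. if c = a then 1 / real CARD('n) else 0)"
    using b(2) bary_vertex[OF Ks] by (intro sum.cong) auto
  also have "\<dots> = 1 / real CARD('n)" using a finE by simp
  finally show c: "bary K a (facet_center E) = 1 / real CARD('n)" .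
  let ?g = "fst (bary_fun K a)"
  have rho: "0 < inball_diameter K" by (rule inball_diameter_pos[OF Ks])
  have "\<bar>bary K a x - bary K a (facet_center E)\<bar> = \<bar>?g \<bullet> (x - facet_center E)\<bar>" by (simp add: bary_def inner_diff_right)
  also have "\<dots> \<le> norm ?g * norm (x - facet_center E)" by (rule Cauchy_Schwarz_ineq2)
  also have "\<dots> \<le> norm ?g * R" using x by (intro mult_left_mono) (auto simp: dist_norm norm_minus_commute)
  also have "\<dots> \<le> (1 / inball_diameter K) * R"
  proof (rule mult_right_mono)
    show "norm ?g \<le> 1 / inball_diameter K" using bary_gradient_bound[OF Ks, of a] rho by (simp add: field_simps)
    have "0 \<le> dist (facet_center E) x" "dist (facet_center E) x \<le> R" using x by auto
    then show "0 \<le> R" by linarith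
  qed
  also have "\<dots> < 1 / real CARD('n)" using R rho by (simp add: field_simps)
  finally show "0 < bary K a x" using c by linarith
qed

text \<open>Both coordinates vanish on the facet, so the second is a multiple of the first. Were the factor
  nonnegative, points of \<open>K\<close> off the facet but close to its barycentre would lie in \<open>K'\<close> as well.\<close>

lemma opposite_sides:
  assumes K: "K \<in> \<T>" "K' \<in> \<T>" and E: "K \<inter> K' facet_of K" "K \<inter> K' facet_of K'"
    and p: "p \<in> verts K" "verts (K \<inter> K') = verts K - {p}" and q: "q \<in> verts K'" "verts (K \<inter> K') = verts K' - {q}"
  shows "bary K' q x = bary K p x * bary K' q p" "bary K' q p < 0"
proof -
  note Ks = mesh_simplex[OF K(1)] mesh_simplex[OF K(2)]
  let ?E = "K \<inter> K'" let ?m = "facet_center ?E"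
  show eq: "bary K' q x = bary K p x * bary K' q p" for x
  proof -
    have "bary K' q x = bary K' q (\<Sum>a\<in>verts K. bary K a x *\<^sub>R a)" using bary_sum(2)[OF Ks(1)] by simp
    also have "\<dots> = (\<Sum>a\<in>verts K. bary K a x * bary K' q a)"
      by (rule affine_combination_bary[OF Ks(2) full_simplex_verts(4)[OF Ks(1)] bary_sum(1)[OF Ks(1)]])
    also have "\<dots> = (\<Sum>a\<in>verts K. if a = p then bary K p x * bary K' q p else 0)"
    proof (rule sum.cong[OF refl])
      fix a assume a: "a \<in> verts K"
      show "bary K a x * bary K' q a = (if a = p then bary K p x * bary K' q p else 0)"
      proof (cases "a = p")
        case False
        then have "a \<in> verts K' - {q}" using a p q by blast
        then show ?thesis using bary_vertex[OF Ks(2), of a q] False by auto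
      qed simp
    qed
    also have "\<dots> = bary K p x * bary K' q p" using p(1) full_simplex_verts(4)[OF Ks(1)] by simp
    finally show ?thesis .
  qed
  show "bary K' q p < 0"
  proof (rule ccontr)
    assume n: "\<not> ?thesis"
    define R where "R = facet_radius K K'"
    have rho: "0 < inball_diameter K" "0 < inball_diameter K'" using inball_diameter_pos Ks by blast+
    have R: "0 < R" "R * real CARD('n) < inball_diameter K'"
      using rho by (auto simp: R_def facet_radius_def min_def field_simps)
    have mE: "?m \<in> ?E" by (rule facet_center_mem[OF Ks(1) E(1)])
    obtain t where t: "0 < t" "t \<le> 1" "t * norm (p - ?m) \<le> R"
    proof (cases "norm (p - ?m) = 0")
      case True then show ?thesis using that[of 1] R by simp
    next
      case False
      then show ?thesis using that[of "min 1 (R / norm (p - ?m))"] R by (auto simp: min_def field_simps)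
    qed
    define y where "y = (1 - t) *\<^sub>R ?m + t *\<^sub>R p"
    have oK: "p \<in> K" using p(1) by (auto simp: verts_def extreme_point_of_def)
    have yK: "y \<in> K" unfolding y_def using convexD[OF full_simplex_convex[OF Ks(1)], of ?m p "1 - t" t] mE oK t by auto
    have "y - ?m = t *\<^sub>R (p - ?m)" by (simp add: y_def algebra_simps)
    then have yb: "y \<in> cball ?m R" using t by (simp add: dist_norm norm_minus_commute)
    have bo: "bary K p ?m = 0" using bary_on_face(2)[OF Ks(1) facet_of_imp_face_of[OF E(1)] mE]
      bary_on_face(3)[OF Ks(1) facet_of_imp_face_of[OF E(1)] mE] p by force
    have by': "bary K p y = t" using bo bary_vertex[OF Ks(1) p(1), of p] by (simp add: y_def bary_convex_combination)
    have "0 \<le> bary K' a y" if "a \<in> verts K'" for a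
    proof (cases "a = q")
      case True then show ?thesis using eq[of y] by' t n by simp
    next
      case False
      then have "a \<in> verts ?E" using that q by simp
      then show ?thesis using bary_near_facet_center(1)[OF K(2) E(2) _ R(2) yb] by (simp add: less_imp_le)
    qed
    then have "y \<in> ?E" using mem_simplex_iff_bary[OF Ks(2)] yK by blast
    then have "bary K p y = 0" using bary_on_face(2)[OF Ks(1) facet_of_imp_face_of[OF E(1)]]
      bary_on_face(3)[OF Ks(1) facet_of_imp_face_of[OF E(1)]] p by force
    then show False using by' t by simp
  qed
qed

text \<open>If \<open>x\<close> is not in \<open>K\<close>, then it lies in \<open>K'\<close>, and the segment either stays in \<open>K\<close> or crosses to
  \<open>K'\<close> through the common facet, because the coordinates in \<open>K\<close> of the vertices of the facet are
  nonnegative along it.\<close>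

lemma patch_star_shaped:
  assumes K: "K \<in> \<T>" "K' \<in> \<T>" and E: "K \<inter> K' facet_of K" "K \<inter> K' facet_of K'"
    and y: "y \<in> K" and x: "x \<in> cball (facet_center (K \<inter> K')) (facet_radius K K')" and s: "0 \<le> s" "s \<le> 1"
  shows "(1 - s) *\<^sub>R y + s *\<^sub>R x \<in> K \<union> K'"
proof -
  note Ks = mesh_simplex[OF K(1)] mesh_simplex[OF K(2)]
  let ?E = "K \<inter> K'" let ?R = "facet_radius K K'"
  have rho: "0 < inball_diameter K" "0 < inball_diameter K'" using inball_diameter_pos Ks by blast+
  have R: "?R * real CARD('n) < inball_diameter K" "?R * real CARD('n) < inball_diameter K'"
    using rho by (auto simp: facet_radius_def min_def field_simps)
  obtain a where a: "a \<in> verts K" "verts ?E = verts K - {a}" "?E = convex hull (verts K - {a})"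
    by (rule facet_convex_hull[OF Ks(1) E(1)]) (rule that, assumption+)
  obtain b where b: "b \<in> verts K'" "verts ?E = verts K' - {b}"
    by (rule facet_convex_hull[OF Ks(2) E(2)]) (rule that, assumption+)
  note opp = opposite_sides[OF K E a(1,2) b]
  have pos: "0 < bary K c x" if "c \<in> verts ?E" for c using bary_near_facet_center(1)[OF K(1) E(1) that R(1) x] .
  have pos': "0 < bary K' c x" if "c \<in> verts ?E" for c using bary_near_facet_center(1)[OF K(2) E(2) that R(2) x] .
  let ?q = "(1 - s) *\<^sub>R y + s *\<^sub>R x"
  show ?thesis
  proof (cases "0 \<le> bary K a x")
    case True
    then have "0 \<le> bary K c x" if "c \<in> verts K" for c using pos that a(2) by (cases "c = a") (auto simp: less_imp_le)
    then have "x \<in> K" using mem_simplex_iff_bary[OF Ks(1)] by blast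
    then show ?thesis using convexD[OF full_simplex_convex[OF Ks(1)] y, of x "1 - s" s] s by auto
  next
    case False
    then have "0 < bary K' b x" unfolding opp(1)[of x] using opp(2) by (intro mult_neg_neg) auto
    then have "0 \<le> bary K' c x" if "c \<in> verts K'" for c
      using pos'[of c] that b(2) by (cases "c = b") (auto simp: less_imp_le)
    then have xK': "x \<in> K'" using mem_simplex_iff_bary[OF Ks(2)] by blast
    have yb: "0 \<le> bary K c y" for c using bary_bounds(1)[OF Ks(1) y] .
    show ?thesis
    proof (cases "0 \<le> bary K a ?q")
      case True
      then have "0 \<le> bary K c ?q" if "c \<in> verts K" for c
      proof (cases "c = a")
        case False
        then have "0 < bary K c x" using pos that a(2) by simp
        then show ?thesis using s yb[of c] by (simp add: bary_convex_combination)
      qed (use True in simp)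
      then show ?thesis using mem_simplex_iff_bary[OF Ks(1)] by blast
    next
      case q: False
      \<comment> \<open>the segment crosses the facet in \<open>e\<close>\<close>
      let ?h = "bary K a"
      have hx: "?h x < 0" and hy: "0 \<le> ?h y" using False yb by auto
      define t where "t = ?h y / (?h y - ?h x)"
      have t: "0 \<le> t" "t < 1" using hx hy by (auto simp: t_def)
      define e where "e = (1 - t) *\<^sub>R y + t *\<^sub>R x"
      have he: "?h e = 0" using hx hy unfolding e_def bary_convex_combination t_def by (simp add: field_simps)
      have "?h ?q < 0" using q by simp
      then have "?h y - s * (?h y - ?h x) < 0" unfolding bary_convex_combination by (simp add: algebra_simps)
      then have ts: "t < s" using hx hy by (simp add: t_def divide_less_eq)
      have eb: "0 \<le> bary K c e" if "c \<in> verts K" for c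
      proof (cases "c = a")
        case False
        then have "0 < bary K c x" using pos that a(2) by simp
        then show ?thesis using t yb[of c] by (simp add: e_def bary_convex_combination)
      qed (use he in simp)
      have "e \<in> convex hull (verts K - {a})"
      proof (subst convex_hull_finite)
        show "finite (verts K - {a})" using full_simplex_verts(4)[OF Ks(1)] by simp
        have "(\<Sum>c\<in>verts K - {a}. bary K c e) = 1" "(\<Sum>c\<in>verts K - {a}. bary K c e *\<^sub>R c) = e"
          using bary_sum[OF Ks(1), of e] he sum.remove[OF full_simplex_verts(4)[OF Ks(1)] a(1), of "\<lambda>c. bary K c e"]
            sum.remove[OF full_simplex_verts(4)[OF Ks(1)] a(1), of "\<lambda>c. bary K c e *\<^sub>R c"] by simp_all
        then show "e \<in> {y. \<exists>u. (\<forall>x\<in>verts K - {a}. 0 \<le> u x) \<and> sum u (verts K - {a}) = 1 \<and> (\<Sum>x\<in>verts K - {a}. u x *\<^sub>R x) = y}"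
          using eb by (intro CollectI exI[of _ "\<lambda>c. bary K c e"]) simp
      qed
      then have eK': "e \<in> K'" using a(3) by blast
      define r where "r = (s - t) / (1 - t)"
      have r: "0 \<le> r" "r \<le> 1" using t ts s by (auto simp: r_def)
      have "r * (1 - t) = s - t" using t by (simp add: r_def)
      then have "(1 - r) * (1 - t) = 1 - s" "(1 - r) * t + r = s" by (simp_all add: algebra_simps)
      then have "?q = (1 - r) *\<^sub>R e + r *\<^sub>R x"
        by (simp add: e_def scaleR_add_right add.assoc scaleR_left_distrib[symmetric])
      then show ?thesis using convexD[OF full_simplex_convex[OF Ks(2)] eK' xK', of "1 - r" r] r by auto
    qed
  qed
qed

section \<open>Averages over inscribed balls\<close>

lemma inball:
  assumes K: "K \<in> \<T>"
  shows "cball (fst (inball K)) (snd (inball K)) \<subseteq> K" "inball_diameter K / 4 < snd (inball K)"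
    "0 < snd (inball K)" "2 * snd (inball K) \<le> diameter K"
proof -
  obtain x r where "cball x r \<subseteq> K \<and> inball_diameter K / 4 < r" using obtain_inball[OF mesh_simplex[OF K]] by metis
  then have "\<exists>p. cball (fst p) (snd p) \<subseteq> K \<and> inball_diameter K / 4 < snd p"
    by (intro exI[of _ "(x, r)"]) simp
  from someI_ex[OF this]
  show *: "cball (fst (inball K)) (snd (inball K)) \<subseteq> K" "inball_diameter K / 4 < snd (inball K)"
    unfolding inball_def by blast+
  then show pos: "0 < snd (inball K)" using inball_diameter_pos[OF mesh_simplex[OF K]] by linarith
  show "2 * snd (inball K) \<le> diameter K"
    using inball_diameter_ge[OF compact_imp_bounded[OF full_simplex_compact[OF mesh_simplex[OF K]]] *(1)] pos
      inball_diameter_le_diameter[OF mesh_simplex[OF K]] by linarith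
qed

lemma bump_average_deviation:
  fixes f :: "real^'n \<Rightarrow> real"
  assumes f: "continuous_on UNIV f" and c: "cball c r \<subseteq> K" "0 < r" and B: "\<And>y. y \<in> K \<Longrightarrow> \<bar>a - f y\<bar> \<le> B"
  shows "\<bar>a - (LINT x|lebesgue. bump c r x * f x)\<bar> \<le> B"
proof -
  have cb: "continuous_on UNIV (bump c r)" using continuous_on_C_times[OF C_times_bump] .
  have i1: "integrable lebesgue (\<lambda>x. bump c r x * f x)"
    by (rule integrable_continuous_compact_support(1)[of _ "cball c r"]) (use f cb bump_outside[OF c(2)] in \<open>auto intro: continuous_on_mult\<close>)
  have i0: "integrable lebesgue (\<lambda>x. bump c r x * b)" for b using bump_integrable[OF c(2), of c] by simp
  have I: "(LINT x|lebesgue. bump c r x * b) = b" for b using bump_integral[OF c(2), of c] by simp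
  have "a - (LINT x|lebesgue. bump c r x * f x) = (LINT x|lebesgue. bump c r x * a - bump c r x * f x)"
    using i0 i1 I by (subst Bochner_Integration.integral_diff) auto
  also have "\<bar>\<dots>\<bar> \<le> (LINT x|lebesgue. \<bar>bump c r x * a - bump c r x * f x\<bar>)"
    using integral_norm_bound[of lebesgue "\<lambda>x. bump c r x * a - bump c r x * f x"] by simp
  also have "\<dots> \<le> (LINT x|lebesgue. bump c r x * B)"
  proof (rule integral_mono)
    show "integrable lebesgue (\<lambda>x. \<bar>bump c r x * a - bump c r x * f x\<bar>)" using i0 i1 by auto
    fix x
    show "\<bar>bump c r x * a - bump c r x * f x\<bar> \<le> bump c r x * B"
    proof (cases "x \<in> cball c r")
      case True
      then have "\<bar>a - f x\<bar> \<le> B" using c B by blast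
      then show ?thesis using bump_nonneg[OF c(2), of c x]
        by (simp add: right_diff_distrib[symmetric] abs_mult mult_left_mono)
    next
      case False then show ?thesis using bump_outside[OF c(2) False] by simp
    qed
  qed (rule i0)
  finally show ?thesis by (simp only: I)
qed

end

abbreviation sq_int :: "(real^'n) set \<Rightarrow> (real^'n \<Rightarrow> 'b::euclidean_space) \<Rightarrow> real" where
  "sq_int K f \<equiv> LINT x|lebesgue_on K. (norm (f x))\<^sup>2"

lemma sq_int_nonneg: "0 \<le> sq_int K f"
  by (rule Bochner_Integration.integral_nonneg) auto

lemma sq_int_diff_le:
  fixes f g h :: "real^'n \<Rightarrow> 'b::euclidean_space"
  assumes "f square_integrable_on S" "g square_integrable_on S" "\<And>x. h x = f x - g x"
  shows "sq_int S h \<le> 2 * sq_int S f + 2 * sq_int S g"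
  using square_integrable_add(2)[OF assms(1) square_integrable_uminus[OF assms(2)]] assms(3) by simp

lemma sum4_sq_le: "(a + b + c + d)\<^sup>2 \<le> 4 * (a\<^sup>2 + b\<^sup>2 + c\<^sup>2 + d\<^sup>2 :: real)"
proof -
  have "4 * (a\<^sup>2 + b\<^sup>2 + c\<^sup>2 + d\<^sup>2) - (a + b + c + d)\<^sup>2 =
    (a - b)\<^sup>2 + (a - c)\<^sup>2 + (a - d)\<^sup>2 + (b - c)\<^sup>2 + (b - d)\<^sup>2 + (c - d)\<^sup>2"
    by (simp add: power2_eq_square algebra_simps)
  then show ?thesis by (smt (verit) zero_le_power2)
qed

lemma diff_sq_le: "(a - b)\<^sup>2 \<le> 2 * a\<^sup>2 + 2 * (b :: real)\<^sup>2"
  using norm_add_sq[of a "- b"] by simp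

context mesh
begin

lemma square_integrable_element:
  "f square_integrable_on \<Omega> \<Longrightarrow> K \<in> \<T> \<Longrightarrow> f square_integrable_on K"
proof -
  assume *: "f square_integrable_on \<Omega>" "K \<in> \<T>"
  have "\<Union>\<T> \<in> sets lebesgue" using Union_mesh by (auto intro: borel_closed)
  then show "f square_integrable_on K"
    using square_integrable_subset[of f "\<Union>\<T>" K] * mesh_in_lebesgue unfolding square_integrable_on_domain_iff by blast
qed

section \<open>Jumps at nodes\<close>

text \<open>The inverse estimate for the polynomial \<open>v - p = (u - p) - (u - v)\<close> on \<open>K\<close>.\<close>

lemma nodal_value_bound:
  assumes K: "K \<in> \<T>" "z \<in> K" and u: "u square_integrable_on \<Omega>" and v: "v \<in> fe_space l \<T>" and p: "p \<in> polynomials_upto l"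
  shows "(v z - p z)\<^sup>2 * measure lebesgue K \<le>
    2 * inverse_const CARD('n) l * (sq_int K (\<lambda>x. u x - p x) + sq_int K (\<lambda>x. u x - v x))"
proof -
  obtain q where q: "q \<in> polynomials_upto l" "\<And>x. x \<in> K \<Longrightarrow> v x = q x" using fe_piece[OF v K(1)] by metis
  note Ks = mesh_simplex[OF K(1)]
  note C = full_simplex_compact[OF Ks]
  have eq: "sq_int K (\<lambda>x. u x - v x) = sq_int K (\<lambda>x. u x - q x)"
    using q(2) by (intro Bochner_Integration.integral_cong) (auto simp: space_restrict_space)
  have uK: "u square_integrable_on K" using square_integrable_element[OF u K(1)] .
  have s: "(\<lambda>x. u x - r x) square_integrable_on K" if "r \<in> polynomials_upto l" for r
    by (intro square_integrable_diff uK square_integrable_continuous C continuous_on_polynomials_upto[OF that])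
  have "(q z - p z)\<^sup>2 * measure lebesgue K \<le> inverse_const CARD('n) l * sq_int K (\<lambda>x. q x - p x)"
    using polynomial_inverse_estimate[OF polynomials_upto_diff[OF q(1) p] C full_simplex_convex[OF Ks] K(2)] by simp
  also have "\<dots> \<le> inverse_const CARD('n) l * (2 * sq_int K (\<lambda>x. u x - p x) + 2 * sq_int K (\<lambda>x. u x - q x))"
    using inverse_const_pos[of "CARD('n)" l] by (intro mult_left_mono sq_int_diff_le s p q) auto
  finally show ?thesis unfolding eq using q(2)[OF K(2)] by (simp add: algebra_simps)
qed

text \<open>The first bound for a jump at a common node: compare both polynomials with the function \<open>v\<close>, which
  has a single value there. The weight \<open>m\<close> will be a multiple of the volume of a third element at the
  same node.\<close>

lemma jump_L2:
  assumes K: "K \<in> \<T>" "z \<in> K" "K' \<in> \<T>" "z \<in> K'" and u: "u square_integrable_on \<Omega>" and v: "v \<in> fe_space l \<T>"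
    and p: "p \<in> polynomials_upto l" "p' \<in> polynomials_upto l"
    and m: "m \<le> \<theta> * measure lebesgue K" "m \<le> \<theta> * measure lebesgue K'" "0 \<le> \<theta>"
  shows "m * (p z - p' z)\<^sup>2 \<le> 4 * \<theta> * inverse_const CARD('n) l *
    ((sq_int K (\<lambda>x. u x - p x) + sq_int K (\<lambda>x. u x - v x)) + (sq_int K' (\<lambda>x. u x - p' x) + sq_int K' (\<lambda>x. u x - v x)))"
proof -
  have d: "(p z - p' z)\<^sup>2 \<le> 2 * (v z - p z)\<^sup>2 + 2 * (v z - p' z)\<^sup>2"
    using diff_sq_le[of "v z - p' z" "v z - p z"] by (simp add: algebra_simps)
  have b: "m * (v z - q z)\<^sup>2 \<le> \<theta> * (2 * inverse_const CARD('n) l * (sq_int L (\<lambda>x. u x - q x) + sq_int L (\<lambda>x. u x - v x)))"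
    if "L \<in> \<T>" "z \<in> L" "q \<in> polynomials_upto l" "m \<le> \<theta> * measure lebesgue L" for L q
  proof -
    have "m * (v z - q z)\<^sup>2 \<le> (\<theta> * measure lebesgue L) * (v z - q z)\<^sup>2" using that by (intro mult_right_mono) auto
    also have "\<dots> = \<theta> * ((v z - q z)\<^sup>2 * measure lebesgue L)" by simp
    also have "\<dots> \<le> \<theta> * (2 * inverse_const CARD('n) l * (sq_int L (\<lambda>x. u x - q x) + sq_int L (\<lambda>x. u x - v x)))"
      using nodal_value_bound[OF that(1,2) u v that(3)] m(3) by (rule mult_left_mono)
    finally show ?thesis .
  qed
  show ?thesis
  proof (cases "0 \<le> m")
    case True
    then have "m * (p z - p' z)\<^sup>2 \<le> m * (2 * (v z - p z)\<^sup>2 + 2 * (v z - p' z)\<^sup>2)" using d by (rule mult_left_mono[rotated])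
    then show ?thesis using b[OF K(1,2) p(1) m(1)] b[OF K(3,4) p(2) m(2)] by (simp add: algebra_simps)
  next
    case False
    then have "m * (p z - p' z)\<^sup>2 \<le> 0" by (simp add: mult_nonpos_nonneg)
    also have "0 \<le> 4 * \<theta> * inverse_const CARD('n) l *
      ((sq_int K (\<lambda>x. u x - p x) + sq_int K (\<lambda>x. u x - v x)) + (sq_int K' (\<lambda>x. u x - p' x) + sq_int K' (\<lambda>x. u x - v x)))"
      using m(3) inverse_const_pos[of "CARD('n)" l] by (intro mult_nonneg_nonneg add_nonneg_nonneg sq_int_nonneg) auto
    finally show ?thesis .
  qed
qed

lemma oscillation_bound:
  assumes K: "K \<in> \<T>" "z \<in> K" "y \<in> K" and g: "g square_integrable_on \<Omega>" and v: "v \<in> fe_space l \<T>" and p: "p \<in> polynomials_upto l"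
    and q: "q \<in> polynomials_upto l" "\<And>x. x \<in> K \<Longrightarrow> v x = q x" "\<And>x. x \<in> interior K \<Longrightarrow> grad v x = grad q x"
  shows "((q z - p z) - (q y - p y))\<^sup>2 * measure lebesgue K \<le> (diameter K)\<^sup>2 *
    (2 * inverse_const CARD('n) l * (sq_int K (\<lambda>x. g x - grad p x) + sq_int K (\<lambda>x. g x - grad v x)))"
proof -
  note Ks = mesh_simplex[OF K(1)]
  note C = full_simplex_compact[OF Ks]
  have gK: "g square_integrable_on K" using square_integrable_element[OF g K(1)] .
  have s: "(\<lambda>x. g x - grad r x) square_integrable_on K" if "r \<in> polynomials_upto l" for r
    by (intro square_integrable_diff gK square_integrable_continuous C continuous_on_grad_polynomials_upto[OF that])
  have eq: "sq_int K (\<lambda>x. g x - grad v x) = sq_int K (\<lambda>x. g x - grad q x)"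
    by (rule square_integrable_transfer(2)[OF square_integrable_diff[OF gK fe_piece_norms(2)[OF v K(1)]]
        mesh_in_lebesgue[OF K(1)] mesh_in_lebesgue[OF K(1)] negligible_skeleton])
      (use q(3) not_skeleton[OF K(1)] in auto)
  have gr: "grad (\<lambda>x. q x - p x) x = grad q x - grad p x" for x
    by (intro grad_eq GDERIV_diff polynomials_upto_GDERIV(1)[OF q(1)] polynomials_upto_GDERIV(1)[OF p])
  have "((q z - p z) - (q y - p y))\<^sup>2 * measure lebesgue K \<le>
      (diameter K)\<^sup>2 * inverse_const CARD('n) l * sq_int K (grad (\<lambda>x. q x - p x))"
    by (rule polynomial_oscillation_estimate[OF polynomials_upto_diff[OF q(1) p] C full_simplex_convex[OF Ks] K(2,3)])
  also have "\<dots> \<le> (diameter K)\<^sup>2 * inverse_const CARD('n) l * (2 * sq_int K (\<lambda>x. g x - grad p x) + 2 * sq_int K (\<lambda>x. g x - grad q x))"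
    using inverse_const_pos[of "CARD('n)" l] by (intro mult_left_mono sq_int_diff_le s p q(1)) (auto simp: gr)
  finally show ?thesis unfolding eq by (simp add: algebra_simps)
qed

text \<open>The balls move from the inscribed ball of \<open>K\<close> to the ball about the barycentre of the facet. Since the
  patch is star-shaped with respect to the latter, all balls of doubled radius on the way lie in the
  patch, hence those of simple radius lie in its interior.\<close>

lemma facet_average_difference:
  fixes w :: "real^'n \<Rightarrow> real"
  assumes K: "K \<in> \<T>" "K' \<in> \<T>" and E: "K \<inter> K' facet_of K" "K \<inter> K' facet_of K'"
    and w: "has_weak_gradient \<Omega> w g" and g: "g square_integrable_on \<Omega>"
    and H: "diameter K \<le> H" "diameter K' \<le> H" and \<rho>: "0 < \<rho>" "\<rho> \<le> inball_diameter K" "\<rho> \<le> inball_diameter K'"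
  defines "A \<equiv> LINT x|lebesgue. bump (facet_center (K \<inter> K')) (facet_radius K K' / 2) x * w x"
  shows "(A - elem_avg K w)\<^sup>2 \<le> 8 * H\<^sup>2 * (2 * H) ^ CARD('n) * (1 / (bump_mass TYPE('n) * (\<rho> / (8 * real CARD('n))) ^ CARD('n)))\<^sup>2 *
    (sq_int K g + sq_int K' g)"
proof -
  let ?d = "real CARD('n)" and ?E = "K \<inter> K'" and ?P = "K \<union> K'"
  let ?m = "facet_center ?E" and ?R = "facet_radius K K'" and ?x = "fst (inball K)" and ?r = "snd (inball K)"
  note Ks = mesh_simplex[OF K(1)] mesh_simplex[OF K(2)]
  have d1: "1 \<le> ?d" by (simp add: Suc_le_eq)
  then have d2: "1 \<le> 2 * ?d" by linarith
  have R: "\<rho> / (2 * ?d) \<le> ?R" "?R \<le> inball_diameter K"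
  proof -
    show "\<rho> / (2 * ?d) \<le> ?R" unfolding facet_radius_def using \<rho> d1 by (intro divide_right_mono) auto
    have "?R \<le> inball_diameter K / (2 * ?d)" unfolding facet_radius_def using d1 by (intro divide_right_mono) auto
    also have "\<dots> \<le> inball_diameter K / 1" using inball_diameter_pos[OF Ks(1)] d2 by (intro divide_left_mono) auto
    finally show "?R \<le> inball_diameter K" by simp
  qed
  have R0: "0 < ?R" using less_le_trans[OF _ R(1)] \<rho>(1) d1 by simp
  note ib = inball[OF K(1)]
  let ?c = "\<lambda>s. ?x + s *\<^sub>R (?m - ?x)" and ?rr = "\<lambda>s. ?r / 2 + s * (?R / 2 - ?r / 2)"
  have rr0: "0 < ?rr s" if "0 \<le> s" "s \<le> 1" for s
  proof -
    have "?rr s = (1 - s) * (?r / 2) + s * (?R / 2)" by (simp add: field_simps)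
    also have "\<dots> > 0" using that ib(3) R0 by (cases "s = 0") (auto intro!: add_nonneg_pos)
    finally show ?thesis .
  qed
  have big: "cball (?c s) (2 * ?rr s) \<subseteq> ?P" if s: "0 \<le> s" "s \<le> 1" for s
  proof
    fix y assume y: "y \<in> cball (?c s) (2 * ?rr s)"
    define e where "e = (1 / (2 * ?rr s)) *\<^sub>R (y - ?c s)"
    have e1: "norm e \<le> 1" using y rr0[OF s] by (simp add: e_def dist_norm norm_minus_commute)
    have "y = ?c s + (2 * ?rr s) *\<^sub>R e" using rr0[OF s] by (simp add: e_def)
    also have "\<dots> = (1 - s) *\<^sub>R (?x + ?r *\<^sub>R e) + s *\<^sub>R (?m + ?R *\<^sub>R e)"
      by (simp add: algebra_simps)
    finally have y': "y = (1 - s) *\<^sub>R (?x + ?r *\<^sub>R e) + s *\<^sub>R (?m + ?R *\<^sub>R e)" .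
    have re: "norm (r *\<^sub>R e) \<le> r" if "0 < r" for r using e1 that mult_left_mono[of "norm e" 1 r] by simp
    have "?x + ?r *\<^sub>R e \<in> K" using ib(1) re[OF ib(3)] by (auto simp: subset_iff dist_norm)
    moreover have "?m + ?R *\<^sub>R e \<in> cball ?m ?R" using re[OF R0] by (simp add: dist_norm)
    ultimately show "y \<in> ?P" unfolding y' using patch_star_shaped[OF K E _ _ s] by blast
  qed
  define S where "S = (\<lambda>(s, e). ?c s + ?rr s *\<^sub>R e) ` ({0..1} \<times> cball 0 1)"
  have Scomp: "compact S" unfolding S_def case_prod_beta
    by (intro compact_continuous_image compact_Times compact_Icc compact_cball continuous_intros)
  have Sint: "S \<subseteq> interior ?P"
  proof
    fix y assume "y \<in> S"
    then obtain s e where se: "y = ?c s + ?rr s *\<^sub>R e" "0 \<le> s" "s \<le> 1" "norm e \<le> 1" by (auto simp: S_def)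
    have "dist (?c s) y = ?rr s * norm e" using rr0[OF se(2,3)] by (simp add: se(1) dist_norm)
    also have "\<dots> \<le> ?rr s * 1" using rr0[OF se(2,3)] se(4) by (intro mult_left_mono) auto
    also have "\<dots> < 2 * ?rr s"
    proof -
      have "r * 1 < 2 * r" if "0 < r" for r :: real using that by simp
      then show ?thesis using rr0[OF se(2,3)] .
    qed
    finally have "y \<in> ball (?c s) (2 * ?rr s)" by simp
    moreover have "ball (?c s) (2 * ?rr s) \<subseteq> ?P" using big[OF se(2,3)] ball_subset_cball by blast
    ultimately show "y \<in> interior ?P" using open_ball interior_maximal by blast
  qed
  have PO: "interior ?P \<subseteq> \<Omega>" using interior_subset_domain[of "{K, K'}"] K by simp
  have path: "cball (?c s) (?rr s) \<subseteq> S" if s: "0 \<le> s" "s \<le> 1" for s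
  proof
    fix y assume y: "y \<in> cball (?c s) (?rr s)"
    define e where "e = (1 / ?rr s) *\<^sub>R (y - ?c s)"
    have "norm e \<le> 1" using y rr0[OF s] by (simp add: e_def dist_norm norm_minus_commute)
    moreover have "y = ?c s + ?rr s *\<^sub>R e" using rr0[OF s] by (simp add: e_def)
    ultimately show "y \<in> S" unfolding S_def using s by (intro image_eqI[of _ _ "(s, e)"]) auto
  qed
  let ?\<rho> = "\<rho> / (8 * ?d)" let ?B = "1 / (bump_mass TYPE('n) * ?\<rho> ^ CARD('n))"
  have \<rho>1: "?\<rho> \<le> ?r / 2"
  proof -
    have "?\<rho> \<le> \<rho> / 8" using \<rho>(1) d1 by (intro divide_left_mono) auto
    then show ?thesis using ib(2) \<rho>(2) by linarith
  qed
  have \<rho>2: "?\<rho> \<le> ?R / 2"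
  proof -
    have "?\<rho> \<le> \<rho> / (4 * ?d)" using \<rho>(1) d1 by (intro divide_left_mono) auto
    then show ?thesis using R(1) by (simp add: field_simps)
  qed
  have "\<bar>A - elem_avg K w\<bar> \<le> (norm (?m - ?x) + \<bar>?R / 2 - ?r / 2\<bar>) * ?B * (LINT x|lebesgue_on S. norm (g x))"
    unfolding A_def elem_avg_def
    by (rule average_difference_bound[OF w open_domain Scomp _ _ \<rho>1 \<rho>2]) (use Sint PO path \<rho>(1) d1 in auto)
  also have "\<dots> \<le> (2 * H) * ?B * (LINT x|lebesgue_on S. norm (g x))"
  proof (intro mult_right_mono Bochner_Integration.integral_nonneg)
    have "?x \<in> K" using ib(1,3) by auto
    moreover have "?m \<in> K" using facet_center_mem[OF Ks(1) E(1)] by blast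
    ultimately have "norm (?m - ?x) \<le> diameter K"
      using diameter_bounded_bound[OF compact_imp_bounded[OF full_simplex_compact[OF Ks(1)]]] by (metis dist_norm)
    moreover have "\<bar>?R / 2 - ?r / 2\<bar> \<le> H"
      using R(2) R0 ib(3,4) H(1) inball_diameter_le_diameter[OF Ks(1)] by linarith
    ultimately show "norm (?m - ?x) + \<bar>?R / 2 - ?r / 2\<bar> \<le> 2 * H" using H(1) by linarith
    show "0 \<le> ?B" using bump_mass_pos[where 'n='n] \<rho>(1) by simp
  qed auto
  finally have "\<bar>A - elem_avg K w\<bar>\<^sup>2 \<le> ((2 * H) * ?B * (LINT x|lebesgue_on S. norm (g x)))\<^sup>2" by (intro power_mono) auto
  also have "\<dots> = (4 * H\<^sup>2 * ?B\<^sup>2) * (LINT x|lebesgue_on S. norm (g x))\<^sup>2" by (simp only: power_mult_distrib) simp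
  also have "\<dots> \<le> (4 * H\<^sup>2 * ?B\<^sup>2) * ((2 * (2 * H) ^ CARD('n)) * (sq_int K g + sq_int K' g))"
  proof (intro mult_left_mono)
    have SP: "S \<subseteq> ?P" using Sint interior_subset by blast
    have mP: "?P \<in> sets lebesgue" "S \<in> sets lebesgue" using mesh_in_lebesgue K Scomp compact_in_lebesgue by auto
    have gP: "g square_integrable_on ?P"
      using square_integrable_Un square_integrable_element[OF g] K mesh_in_lebesgue by blast
    have gS: "g square_integrable_on S" using square_integrable_subset[OF gP mP SP] .
    have Sl: "S \<in> lmeasurable" using Scomp lmeasurable_compact by blast
    have "(LINT x|lebesgue_on S. norm (g x))\<^sup>2 \<le> measure lebesgue S * sq_int S g" by (rule square_of_integral_le(2)[OF gS Sl])
    also have "\<dots> \<le> (2 * (2 * H) ^ CARD('n)) * (sq_int K g + sq_int K' g)"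
    proof (intro mult_mono sq_int_nonneg)
      have lm: "K \<in> lmeasurable" "K' \<in> lmeasurable" using full_simplex_compact Ks lmeasurable_compact by blast+
      have "measure lebesgue S \<le> measure lebesgue ?P" using SP Sl lm by (intro measure_mono_fmeasurable) auto
      also have "\<dots> \<le> measure lebesgue K + measure lebesgue K'" using lm by (intro measure_Un_le) auto
      also have "\<dots> \<le> (2 * H) ^ CARD('n) + (2 * H) ^ CARD('n)"
      proof (intro add_mono)
        have "(2 * diameter L) ^ CARD('n) \<le> (2 * H) ^ CARD('n)" if "L \<in> \<T>" "diameter L \<le> H" for L
          using that inball_diameter_pos[OF mesh_simplex[of L]] inball_diameter_le_diameter[OF mesh_simplex[of L]]
          by (intro power_mono) auto
        then show "measure lebesgue K \<le> (2 * H) ^ CARD('n)" "measure lebesgue K' \<le> (2 * H) ^ CARD('n)"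
          using full_simplex_measure(2) Ks K H by (meson order.trans)+
      qed
      finally show "measure lebesgue S \<le> 2 * (2 * H) ^ CARD('n)" by (simp only: mult_2[of "(2 * H) ^ CARD('n)"])
      have "sq_int S g \<le> sq_int ?P g"
      proof -
        have i: "integrable (lebesgue_on ?P) (\<lambda>x. (norm (g x))\<^sup>2)" "integrable (lebesgue_on S) (\<lambda>x. (norm (g x))\<^sup>2)"
          using gP gS by (auto simp: square_integrable_on_def)
        then show ?thesis using SP mP
          by (simp only: lebesgue_integral_eq_integral) (intro integral_subset_le integrable_on_lebesgue_on; auto)
      qed
      also have "sq_int ?P g \<le> sq_int K g + sq_int K' g"
      proof -
        have "integrable (lebesgue_on (\<Union>{K, K'})) (\<lambda>x. (norm (g x))\<^sup>2)" using gP by (simp add: square_integrable_on_def)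
        then have e: "sq_int (\<Union>{K, K'}) g = (\<Sum>L\<in>{K, K'}. sq_int L g)" using K by (intro integral_patch) auto
        have "(\<Sum>L\<in>{K, K'}. sq_int L g) \<le> sq_int K g + sq_int K' g" using sq_int_nonneg[of K' g] by (cases "K = K'") auto
        then show ?thesis using e by simp
      qed
      finally show "sq_int S g \<le> sq_int K g + sq_int K' g" .
      have "0 \<le> H" using H(1) inball_diameter_pos[OF Ks(1)] inball_diameter_le_diameter[OF Ks(1)] by linarith
      then show "0 \<le> 2 * (2 * H) ^ CARD('n)" by simp
    qed
    finally show "(LINT x|lebesgue_on S. norm (g x))\<^sup>2 \<le> (2 * (2 * H) ^ CARD('n)) * (sq_int K g + sq_int K' g)" .
  qed simp
  finally show ?thesis by (simp add: mult_ac)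
qed

lemma elem_avg_integrable:
  assumes f: "f square_integrable_on \<Omega>" and K: "K \<in> \<T>"
  shows "integrable lebesgue (\<lambda>x. bump (fst (inball K)) (snd (inball K) / 2) x * f x)"
proof -
  have "f locally_integrable_on \<Omega>" using f open_domain by (intro square_integrable_imp_locally_integrable) (auto intro: borel_open)
  moreover have "cball (fst (inball K)) (snd (inball K) / 2) \<subseteq> ball (fst (inball K)) (snd (inball K))"
    using inball(3)[OF K] by auto
  then have "cball (fst (inball K)) (snd (inball K) / 2) \<subseteq> interior K"
    using inball(1)[OF K] ball_subset_cball interior_maximal[OF _ open_ball] by (meson order.trans)
  then have "cball (fst (inball K)) (snd (inball K) / 2) \<subseteq> \<Omega>" using interior_element_subset[OF K] by blast
  ultimately show ?thesis
    using bump_integrable_product[of f \<Omega> "fst (inball K)" "snd (inball K) / 2" "\<lambda>_. 1"] inball(3)[OF K] by simp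
qed

lemma elem_avg_cong:
  assumes K: "K \<in> \<T>" and eq: "\<And>x. x \<in> K \<Longrightarrow> f x = h x"
  shows "elem_avg K f = elem_avg K h"
proof -
  have "bump (fst (inball K)) (snd (inball K) / 2) x * f x = bump (fst (inball K)) (snd (inball K) / 2) x * h x" for x
  proof (cases "x \<in> cball (fst (inball K)) (snd (inball K) / 2)")
    case True
    then have "x \<in> K" using inball(1,3)[OF K] by (auto simp: subset_iff)
    then show ?thesis using eq by simp
  next
    case False then show ?thesis using bump_outside[OF _ False] inball(3)[OF K] by simp
  qed
  then have "(\<lambda>x. bump (fst (inball K)) (snd (inball K) / 2) x * f x) = (\<lambda>x. bump (fst (inball K)) (snd (inball K) / 2) x * h x)" by blast
  then show ?thesis by (simp only: elem_avg_def)
qed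

lemma polynomial_avg_integrable:
  assumes p: "p \<in> polynomials_upto l" and K: "K \<in> \<T>"
  shows "integrable lebesgue (\<lambda>x. bump (fst (inball K)) (snd (inball K) / 2) x * p x)"
proof (rule integrable_continuous_compact_support(1)[of _ "cball (fst (inball K)) (snd (inball K) / 2)"])
  show "continuous_on UNIV (\<lambda>x. bump (fst (inball K)) (snd (inball K) / 2) x * p x)"
    by (intro continuous_on_mult continuous_on_polynomials_upto[OF p] continuous_on_C_times[OF C_times_bump])
qed (use bump_outside[of "snd (inball K) / 2" _ "fst (inball K)"] inball(3)[OF K] in auto)

text \<open>The second bound for a jump, in terms of gradients only. It requires that \<open>u - p\<close> and \<open>u - p'\<close> have
  average zero: then each \<open>v - p\<close> differs from minus the average of \<open>u - v\<close> by an oscillation, which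
  its gradient controls, and the averages of \<open>u - v\<close> over the two elements are compared through the
  ball at the common facet.\<close>

lemma jump_gradient:
  assumes K: "K \<in> \<T>" "K' \<in> \<T>" and E: "K \<inter> K' facet_of K" "K \<inter> K' facet_of K'" and z: "z \<in> K \<inter> K'"
    and u: "u square_integrable_on \<Omega>" "has_weak_gradient \<Omega> u g" "g square_integrable_on \<Omega>" and v: "v \<in> fe_space l \<T>"
    and p: "p \<in> polynomials_upto l" "p' \<in> polynomials_upto l"
    and avg: "elem_avg K (\<lambda>x. u x - p x) = 0" "elem_avg K' (\<lambda>x. u x - p' x) = 0"
    and m: "0 \<le> m" "m \<le> \<theta> * measure lebesgue K" "m \<le> \<theta> * measure lebesgue K'" "0 \<le> \<theta>"
    and H: "diameter K \<le> H" "diameter K' \<le> H" and \<rho>: "0 < \<rho>" "\<rho> \<le> inball_diameter K" "\<rho> \<le> inball_diameter K'" "H \<le> \<sigma> * \<rho>"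
  shows "m * (p z - p' z)\<^sup>2 \<le>
    (8 * \<theta> * inverse_const CARD('n) l + 64 * \<theta> * ((16 * real CARD('n) * \<sigma>) ^ CARD('n) / bump_mass TYPE('n))\<^sup>2) * H\<^sup>2 *
    ((sq_int K (\<lambda>x. g x - grad p x) + sq_int K (\<lambda>x. g x - grad v x)) + (sq_int K' (\<lambda>x. g x - grad p' x) + sq_int K' (\<lambda>x. g x - grad v x)))"
proof -
  let ?b = "bump_mass TYPE('n)" and ?d = "real CARD('n)"
  have H0: "0 \<le> H" using H(1) inball_diameter_pos[OF mesh_simplex[OF K(1)]] inball_diameter_le_diameter[OF mesh_simplex[OF K(1)]] by linarith
  define A where "A = (LINT x|lebesgue. bump (facet_center (K \<inter> K')) (facet_radius K K' / 2) x * (u x - v x))"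
  let ?X = "\<lambda>L q. 2 * inverse_const CARD('n) l * (sq_int L (\<lambda>x. g x - grad q x) + sq_int L (\<lambda>x. g x - grad v x))"
  \<comment> \<open>the average of \<open>v - q\<close> is minus the average of \<open>u - v\<close>, so this is its oscillation\<close>
  have osc: "m * ((v z - q z) + elem_avg L (\<lambda>x. u x - v x))\<^sup>2 \<le> \<theta> * (H\<^sup>2 * ?X L q)"
    if L: "L \<in> \<T>" "z \<in> L" "diameter L \<le> H" and q: "q \<in> polynomials_upto l" "elem_avg L (\<lambda>x. u x - q x) = 0"
      and mL: "m \<le> \<theta> * measure lebesgue L" for L q
  proof -
    note Ls = mesh_simplex[OF L(1)]
    obtain f where f: "f \<in> polynomials_upto l" "\<And>x. x \<in> L \<Longrightarrow> v x = f x" "\<And>x. x \<in> interior L \<Longrightarrow> grad v x = grad f x"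
      using fe_piece[OF v L(1)] by metis
    let ?bu = "bump (fst (inball L)) (snd (inball L) / 2)"
    have "elem_avg L (\<lambda>x. u x - v x) = elem_avg L (\<lambda>x. u x - f x)" using f(2) by (intro elem_avg_cong L) auto
    also have "\<dots> = elem_avg L (\<lambda>x. u x - q x) - elem_avg L (\<lambda>x. f x - q x)"
      unfolding elem_avg_def right_diff_distrib
      using elem_avg_integrable[OF u(1) L(1)] polynomial_avg_integrable[OF f(1) L(1)] polynomial_avg_integrable[OF q(1) L(1)]
      by simp
    finally have av: "elem_avg L (\<lambda>x. u x - v x) = - elem_avg L (\<lambda>x. f x - q x)" using q(2) by simp
    have vol: "0 < measure lebesgue L" by (rule full_simplex_measure(1)[OF Ls])
    have X0: "0 \<le> ?X L q" using inverse_const_pos[of "CARD('n)" l] by (intro mult_nonneg_nonneg add_nonneg_nonneg sq_int_nonneg) auto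
    define B where "B = sqrt (H\<^sup>2 * ?X L q / measure lebesgue L)"
    have "\<bar>(f z - q z) - elem_avg L (\<lambda>x. f x - q x)\<bar> \<le> B"
      unfolding elem_avg_def
    proof (rule bump_average_deviation)
      show "continuous_on UNIV (\<lambda>x. f x - q x)" by (intro continuous_on_diff continuous_on_polynomials_upto[OF f(1)] continuous_on_polynomials_upto[OF q(1)])
      show "cball (fst (inball L)) (snd (inball L) / 2) \<subseteq> L" using inball(1,3)[OF L(1)] by (auto simp: subset_iff)
      show "0 < snd (inball L) / 2" using inball(3)[OF L(1)] by simp
      fix y assume y: "y \<in> L"
      have "((f z - q z) - (f y - q y))\<^sup>2 * measure lebesgue L \<le> (diameter L)\<^sup>2 * ?X L q"
        by (rule oscillation_bound[OF L(1,2) y u(3) v q(1) f])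
      also have "\<dots> \<le> H\<^sup>2 * ?X L q"
        using L(3) X0 inball_diameter_pos[OF Ls] inball_diameter_le_diameter[OF Ls] by (intro mult_right_mono power_mono) auto
      finally show "\<bar>(f z - q z) - (f y - q y)\<bar> \<le> B" unfolding B_def using vol
        by (intro real_le_rsqrt) (simp add: field_simps)
    qed
    then have "\<bar>(v z - q z) + elem_avg L (\<lambda>x. u x - v x)\<bar>\<^sup>2 \<le> B\<^sup>2" unfolding av using f(2)[OF L(2)] by (intro power_mono) auto
    then have "((v z - q z) + elem_avg L (\<lambda>x. u x - v x))\<^sup>2 \<le> H\<^sup>2 * ?X L q / measure lebesgue L"
      using X0 vol by (simp add: B_def)
    then have "m * ((v z - q z) + elem_avg L (\<lambda>x. u x - v x))\<^sup>2 \<le> (\<theta> * measure lebesgue L) * (H\<^sup>2 * ?X L q / measure lebesgue L)"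
      using mL m X0 vol by (intro mult_mono) auto
    also have "\<dots> = \<theta> * (H\<^sup>2 * ?X L q)" using vol by simp
    finally show ?thesis .
  qed
  let ?Y = "sq_int K (\<lambda>x. g x - grad v x) + sq_int K' (\<lambda>x. g x - grad v x)"
  let ?k = "8 * \<theta> * ((16 * ?d * \<sigma>) ^ CARD('n) / ?b)\<^sup>2"
  have Y0: "0 \<le> ?Y" by (intro add_nonneg_nonneg sq_int_nonneg)
  have wk: "has_weak_gradient \<Omega> (\<lambda>x. u x - v x) (\<lambda>x. g x - grad v x)"
    by (rule has_weak_gradient_diff[OF u(2) fe_weak_gradient[OF v] open_domain])
  have gi: "(\<lambda>x. g x - grad v x) square_integrable_on \<Omega>" by (intro square_integrable_diff u fe_norms[OF v])
  have mH: "m \<le> \<theta> * (2 * H) ^ CARD('n)"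
  proof -
    have "m \<le> \<theta> * measure lebesgue K" by (rule m)
    also have "\<dots> \<le> \<theta> * (2 * H) ^ CARD('n)"
      using full_simplex_measure(2)[OF mesh_simplex[OF K(1)]] H m(4) inball_diameter_pos[OF mesh_simplex[OF K(1)]]
        inball_diameter_le_diameter[OF mesh_simplex[OF K(1)]]
      by (intro mult_left_mono order.trans[OF full_simplex_measure(2)[OF mesh_simplex[OF K(1)]]] power_mono) auto
    finally show ?thesis .
  qed
  have avgb: "m * (A - B)\<^sup>2 \<le> ?k * H\<^sup>2 * ?Y"
    if b: "(A - B)\<^sup>2 \<le> 8 * H\<^sup>2 * (2 * H) ^ CARD('n) * (1 / (?b * (\<rho> / (8 * ?d)) ^ CARD('n)))\<^sup>2 * ?Y" for B
  proof -
    have bm: "0 < ?b" by (rule bump_mass_pos)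
    have "m * (A - B)\<^sup>2 \<le> (\<theta> * (2 * H) ^ CARD('n)) * (8 * H\<^sup>2 * (2 * H) ^ CARD('n) * (1 / (?b * (\<rho> / (8 * ?d)) ^ CARD('n)))\<^sup>2 * ?Y)"
      using b mH m H0 by (intro mult_mono) auto
    also have "\<dots> = 8 * \<theta> * H\<^sup>2 * ((2 * H) ^ CARD('n) / (\<rho> / (8 * ?d)) ^ CARD('n) / ?b)\<^sup>2 * ?Y"
      by (simp add: power2_eq_square mult_ac)
    also have "\<dots> \<le> 8 * \<theta> * H\<^sup>2 * ((16 * ?d * \<sigma>) ^ CARD('n) / ?b)\<^sup>2 * ?Y"
    proof (intro mult_right_mono mult_left_mono power_mono[of _ _ 2] divide_right_mono Y0)
      have "2 * H / (\<rho> / (8 * ?d)) \<le> 16 * ?d * \<sigma>" using \<rho>(1,4) mult_left_mono[OF \<rho>(4), of "16 * ?d"] by (simp add: field_simps)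
      then show "(2 * H) ^ CARD('n) / (\<rho> / (8 * ?d)) ^ CARD('n) \<le> (16 * ?d * \<sigma>) ^ CARD('n)"
        unfolding power_divide[symmetric] using H0 \<rho>(1) by (intro power_mono) auto
    qed (use m bm H0 \<rho> in auto)
    finally show ?thesis by (simp add: mult_ac)
  qed
  have A1: "m * (A - elem_avg K (\<lambda>x. u x - v x))\<^sup>2 \<le> ?k * H\<^sup>2 * ?Y"
    unfolding A_def by (rule avgb[unfolded A_def, OF facet_average_difference[OF K E wk gi H \<rho>(1-3)]])
  have A2: "m * (A - elem_avg K' (\<lambda>x. u x - v x))\<^sup>2 \<le> ?k * H\<^sup>2 * ?Y"
  proof -
    have E': "K' \<inter> K facet_of K'" "K' \<inter> K facet_of K" using E by (simp_all add: Int_commute)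
    have "facet_radius K' K = facet_radius K K'" by (simp add: facet_radius_def min.commute)
    then show ?thesis
      using avgb[of "elem_avg K' (\<lambda>x. u x - v x)"] facet_average_difference[OF K(2,1) E' wk gi H(2,1) \<rho>(1,3,2)]
      unfolding A_def by (simp only: Int_commute[of K' K] add.commute[of "sq_int K' _"])
  qed
  have "(p z - p' z)\<^sup>2 = (((v z - p' z) + elem_avg K' (\<lambda>x. u x - v x)) + - ((v z - p z) + elem_avg K (\<lambda>x. u x - v x)) +
      - (A - elem_avg K (\<lambda>x. u x - v x)) + (A - elem_avg K' (\<lambda>x. u x - v x)))\<^sup>2"
    by (rule arg_cong[where f = "\<lambda>x. x\<^sup>2"]) simp
  also have "\<dots> \<le> 4 * (((v z - p' z) + elem_avg K' (\<lambda>x. u x - v x))\<^sup>2 + ((v z - p z) + elem_avg K (\<lambda>x. u x - v x))\<^sup>2 +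
      (A - elem_avg K (\<lambda>x. u x - v x))\<^sup>2 + (A - elem_avg K' (\<lambda>x. u x - v x))\<^sup>2)"
    by (rule order.trans[OF sum4_sq_le]) (simp only: power2_minus order.refl)
  finally have "m * (p z - p' z)\<^sup>2 \<le> m * (4 * (((v z - p' z) + elem_avg K' (\<lambda>x. u x - v x))\<^sup>2 + ((v z - p z) + elem_avg K (\<lambda>x. u x - v x))\<^sup>2 +
      (A - elem_avg K (\<lambda>x. u x - v x))\<^sup>2 + (A - elem_avg K' (\<lambda>x. u x - v x))\<^sup>2))" using m(1) by (rule mult_left_mono)
  also have "\<dots> = 4 * (m * ((v z - p' z) + elem_avg K' (\<lambda>x. u x - v x))\<^sup>2 + m * ((v z - p z) + elem_avg K (\<lambda>x. u x - v x))\<^sup>2 +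
      m * (A - elem_avg K (\<lambda>x. u x - v x))\<^sup>2 + m * (A - elem_avg K' (\<lambda>x. u x - v x))\<^sup>2)"
    by (simp only: distrib_left mult.left_commute)
  also have "\<dots> \<le> 4 * (\<theta> * (H\<^sup>2 * ?X K' p') + \<theta> * (H\<^sup>2 * ?X K p) + ?k * H\<^sup>2 * ?Y + ?k * H\<^sup>2 * ?Y)"
    using z by (intro mult_left_mono add_mono osc A1 A2 K H p avg m) auto
  also have "\<dots> \<le> (8 * \<theta> * inverse_const CARD('n) l + 8 * ?k) * H\<^sup>2 *
    ((sq_int K (\<lambda>x. g x - grad p x) + sq_int K (\<lambda>x. g x - grad v x)) + (sq_int K' (\<lambda>x. g x - grad p' x) + sq_int K' (\<lambda>x. g x - grad v x)))"
  proof -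
    let ?a = "sq_int K (\<lambda>x. g x - grad p x)" and ?a' = "sq_int K' (\<lambda>x. g x - grad p' x)"
    have "0 \<le> 8 * ?k * H\<^sup>2 * (?a + ?a')" using m(4) by (intro mult_nonneg_nonneg add_nonneg_nonneg sq_int_nonneg) auto
    then show ?thesis by (simp add: algebra_simps)
  qed
  finally show ?thesis by (simp only: mult.assoc) simp
qed

section \<open>Polynomials with zero average error\<close>

text \<open>Adding a constant makes the average error zero; the inscribed ball is large enough for this constant
  to be bounded by the error itself.\<close>

lemma normalised_polynomial:
  assumes K: "K \<in> \<T>" and u: "u square_integrable_on \<Omega>" and p: "p \<in> polynomials_upto l" and e: "0 \<le> \<epsilon>"
    and \<sigma>: "diameter K \<le> \<sigma> * inball_diameter K"
  obtains p' where "p' \<in> polynomials_upto l" "elem_avg K (\<lambda>x. u x - p' x) = 0"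
    "local_energy \<epsilon> u g K p' \<le> (2 + 2 * ((16 * \<sigma>) ^ CARD('n) / bump_mass TYPE('n))\<^sup>2) * local_energy \<epsilon> u g K p"
proof -
  let ?b = "bump_mass TYPE('n)" and ?bu = "bump (fst (inball K)) (snd (inball K) / 2)"
  note Ks = mesh_simplex[OF K]
  note ib = inball[OF K]
  have bm: "0 < ?b" by (rule bump_mass_pos)
  define c where "c = elem_avg K (\<lambda>x. u x - p x)"
  define p' where "p' x = p x + c" for x
  have p': "p' \<in> polynomials_upto l" unfolding p'_def[abs_def] by (intro polynomials_upto_add p polynomials_upto_const)
  have rho: "0 < inball_diameter K" by (rule inball_diameter_pos[OF Ks])
  have Kl: "K \<in> lmeasurable" using lmeasurable_compact[OF full_simplex_compact[OF Ks]] .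
  have uK: "(\<lambda>x. u x - p x) square_integrable_on K"
    by (intro square_integrable_diff square_integrable_element[OF u K] square_integrable_continuous full_simplex_compact[OF Ks] continuous_on_polynomials_upto[OF p])
  have i1: "integrable lebesgue (\<lambda>x. ?bu x * (u x - p x))"
    using elem_avg_integrable[OF u K] polynomial_avg_integrable[OF p K] by (simp add: right_diff_distrib)
  have "elem_avg K (\<lambda>x. u x - p' x) = (LINT x|lebesgue. ?bu x * (u x - p x) - ?bu x * c)"
    unfolding elem_avg_def p'_def by (simp add: algebra_simps)
  also have "\<dots> = c - c"
    using i1 bump_integrable[of "snd (inball K) / 2" "fst (inball K)"] bump_integral[of "snd (inball K) / 2" "fst (inball K)"] ib(3)
    by (subst Bochner_Integration.integral_diff) (auto simp: c_def elem_avg_def)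
  finally have av: "elem_avg K (\<lambda>x. u x - p' x) = 0" by simp
  let ?s = "inball_diameter K / 8" let ?M = "1 / (?b * ?s ^ CARD('n))"
  have "\<bar>c\<bar> \<le> (LINT x|lebesgue. \<bar>?bu x * (u x - p x)\<bar>)"
    unfolding c_def elem_avg_def using integral_norm_bound[of lebesgue "\<lambda>x. ?bu x * (u x - p x)"] by simp
  also have "\<dots> \<le> (LINT x|lebesgue. ?M * (indicator K x *\<^sub>R norm (u x - p x)))"
  proof (rule integral_mono)
    show "integrable lebesgue (\<lambda>x. \<bar>?bu x * (u x - p x)\<bar>)" using i1 by simp
    show "integrable lebesgue (\<lambda>x. ?M * (indicator K x *\<^sub>R norm (u x - p x)))"
      using integrable_norm[OF square_of_integral_le(1)[OF uK Kl]] Kl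
      by (intro integrable_mult_right) (simp add: integrable_restrict_space fmeasurableD)
    fix x
    show "\<bar>?bu x * (u x - p x)\<bar> \<le> ?M * (indicator K x *\<^sub>R norm (u x - p x))"
    proof (cases "x \<in> cball (fst (inball K)) (snd (inball K) / 2)")
      case True
      then have "x \<in> K" using ib(1,3) by (auto simp: subset_iff)
      have "?bu x \<le> 1 / (?b * (snd (inball K) / 2) ^ CARD('n))" using ib(3) by (intro bump_le) auto
      also have "\<dots> \<le> ?M" using bm rho ib(2,3) by (intro divide_left_mono mult_left_mono power_mono mult_pos_pos zero_less_power) auto
      finally have "?bu x * norm (u x - p x) \<le> ?M * norm (u x - p x)" by (rule mult_right_mono) simp
      then show ?thesis using \<open>x \<in> K\<close> bump_nonneg[of "snd (inball K) / 2" "fst (inball K)" x] ib(3) by (simp add: abs_mult)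
    next
      case False then show ?thesis using bump_outside[OF _ False] ib(3) bm rho by simp
    qed
  qed
  also have "\<dots> = ?M * (LINT x|lebesgue_on K. norm (u x - p x))" using Kl by (simp add: integral_restrict_space fmeasurableD)
  finally have "\<bar>c\<bar>\<^sup>2 \<le> (?M * (LINT x|lebesgue_on K. norm (u x - p x)))\<^sup>2" by (intro power_mono) auto
  also have "\<dots> \<le> ?M\<^sup>2 * (measure lebesgue K * sq_int K (\<lambda>x. u x - p x))"
    unfolding power_mult_distrib using square_of_integral_le(2)[OF uK Kl] by (intro mult_left_mono) auto
  finally have "c\<^sup>2 * measure lebesgue K \<le> ?M\<^sup>2 * (measure lebesgue K * sq_int K (\<lambda>x. u x - p x)) * measure lebesgue K"
    by (intro mult_right_mono) auto
  also have "\<dots> = (?M * measure lebesgue K)\<^sup>2 * sq_int K (\<lambda>x. u x - p x)" by (simp add: power2_eq_square)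
  also have "\<dots> \<le> ((16 * \<sigma>) ^ CARD('n) / ?b)\<^sup>2 * sq_int K (\<lambda>x. u x - p x)"
  proof (intro mult_right_mono power_mono[of _ _ 2] sq_int_nonneg)
    have "?M * measure lebesgue K \<le> ?M * (2 * diameter K) ^ CARD('n)"
      using full_simplex_measure(2)[OF Ks] bm rho by (intro mult_left_mono) auto
    also have "\<dots> = (2 * diameter K / ?s) ^ CARD('n) / ?b" by (simp only: power_divide) (simp add: mult_ac)
    also have "\<dots> \<le> (16 * \<sigma>) ^ CARD('n) / ?b"
    proof (intro divide_right_mono power_mono)
      show "2 * diameter K / ?s \<le> 16 * \<sigma>" using \<sigma> rho by (simp add: field_simps)
      show "0 \<le> 2 * diameter K / ?s" using rho inball_diameter_le_diameter[OF Ks] by simp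
    qed (use bm in auto)
    finally show "?M * measure lebesgue K \<le> (16 * \<sigma>) ^ CARD('n) / ?b" .
    show "0 \<le> ?M * measure lebesgue K" using bm rho by simp
  qed
  finally have c: "c\<^sup>2 * measure lebesgue K \<le> ((16 * \<sigma>) ^ CARD('n) / ?b)\<^sup>2 * sq_int K (\<lambda>x. u x - p x)" .
  have "sq_int K (\<lambda>x. u x - p' x) \<le> 2 * sq_int K (\<lambda>x. u x - p x) + 2 * sq_int K (\<lambda>x :: real^'n. c)"
    by (rule sq_int_diff_le[OF uK square_integrable_continuous]) (auto simp: p'_def full_simplex_compact[OF Ks])
  also have "sq_int K (\<lambda>x :: real^'n. c) = c\<^sup>2 * measure lebesgue K"
    using Kl measure_restrict_space[of K lebesgue K] by (simp add: fmeasurableD)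
  finally have L: "sq_int K (\<lambda>x. u x - p' x) \<le> (2 + 2 * ((16 * \<sigma>) ^ CARD('n) / ?b)\<^sup>2) * sq_int K (\<lambda>x. u x - p x)"
    using c by (simp add: algebra_simps)
  have "grad p' = grad p"
  proof
    fix x
    show "grad p' x = grad p x"
      using GDERIV_add[OF polynomials_upto_GDERIV(1)[OF p, of x] GDERIV_const[of c x]] by (intro grad_eq) (simp add: p'_def[abs_def])
  qed
  then have "\<epsilon> * sq_int K (\<lambda>x. g x - grad p' x) \<le> (2 + 2 * ((16 * \<sigma>) ^ CARD('n) / ?b)\<^sup>2) * (\<epsilon> * sq_int K (\<lambda>x. g x - grad p x))"
    using e mult_right_mono[of 1 "2 + 2 * ((16 * \<sigma>) ^ CARD('n) / ?b)\<^sup>2" "\<epsilon> * sq_int K (\<lambda>x. g x - grad p x)"] sq_int_nonneg[of K "\<lambda>x. g x - grad p x"]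
    by simp
  then have "local_energy \<epsilon> u g K p' \<le> (2 + 2 * ((16 * \<sigma>) ^ CARD('n) / ?b)\<^sup>2) * local_energy \<epsilon> u g K p"
    using L unfolding local_energy_def by (simp add: distrib_left)
  then show ?thesis using that p' av by blast
qed

end

definition node_bound :: "nat \<Rightarrow> nat \<Rightarrow> real" where
  "node_bound d l = real ((l + 1) ^ (d + 1))"

context mesh
begin

section \<open>Nodes and face chains\<close>

lemma finite_mesh_nodes: "finite (mesh_nodes l \<T>)"
  unfolding mesh_nodes_def simplex_nodes_eq using finite_mesh mesh_simplex finite_node_indices(1) by blast

lemma elements_per_node:
  assumes "z \<in> mesh_nodes l \<T>"
  shows "card {K \<in> \<T>. z \<in> K} \<le> max_elements_per_node l \<T>"
  unfolding max_elements_per_node_def using finite_mesh_nodes assms by (intro Max_ge) auto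

lemma vertex_is_node:
  assumes K: "K \<in> \<T>" and a: "a \<in> verts K" and l: "1 \<le> l"
  shows "a \<in> mesh_nodes l \<T>"
proof -
  note Ks = mesh_simplex[OF K]
  let ?k = "\<lambda>c. if c = a then l else 0"
  have "?k \<in> node_indices l K" using a full_simplex_verts(4)[OF Ks] by (auto simp: node_indices_def)
  moreover have "lattice_node l K ?k = (\<Sum>c\<in>verts K. if c = a then a else 0)"
    unfolding lattice_node_def using l by (intro sum.cong) auto
  then have "lattice_node l K ?k = a" using a full_simplex_verts(4)[OF Ks] by simp
  ultimately have "a \<in> simplex_nodes l K" unfolding simplex_nodes_eq by (metis imageI)
  then show ?thesis using K by (auto simp: mesh_nodes_def)
qed

text \<open>Elements that touch share a vertex, and vertices are nodes.\<close>

lemma card_touching_elements: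
  assumes K: "K \<in> \<T>" and l: "1 \<le> l"
  shows "card {L \<in> \<T>. K \<inter> L \<noteq> {}} \<le> (CARD('n) + 1) * max_elements_per_node l \<T>"
proof -
  note Ks = mesh_simplex[OF K]
  have "{L \<in> \<T>. K \<inter> L \<noteq> {}} \<subseteq> (\<Union>a\<in>verts K. {L \<in> \<T>. a \<in> L})"
  proof
    fix L assume "L \<in> {L \<in> \<T>. K \<inter> L \<noteq> {}}"
    then have L: "L \<in> \<T>" "K \<inter> L \<noteq> {}" by auto
    have F: "K \<inter> L face_of K" by (rule Int_face[OF K L(1)])
    obtain x where x: "x \<in> K \<inter> L" using L(2) by blast
    have "verts (K \<inter> L) \<noteq> {}" using bary_on_face(3)[OF Ks F x] by auto
    then obtain a where a: "a \<in> verts (K \<inter> L)" by blast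
    then have "a \<in> K \<inter> L" by (simp add: verts_def extreme_point_of_def)
    then show "L \<in> (\<Union>a\<in>verts K. {L \<in> \<T>. a \<in> L})" using a bary_on_face(1)[OF Ks F x] L(1) by blast
  qed
  then have "card {L \<in> \<T>. K \<inter> L \<noteq> {}} \<le> card (\<Union>a\<in>verts K. {L \<in> \<T>. a \<in> L})"
    using full_simplex_verts(4)[OF Ks] finite_mesh by (intro card_mono) auto
  also have "\<dots> \<le> (\<Sum>a\<in>verts K. card {L \<in> \<T>. a \<in> L})" by (rule card_UN_le[OF full_simplex_verts(4)[OF Ks]])
  also have "\<dots> \<le> (\<Sum>a\<in>verts K. max_elements_per_node l \<T>)"
    using vertex_is_node[OF K _ l] by (intro sum_mono elements_per_node) auto
  also have "\<dots> = (CARD('n) + 1) * max_elements_per_node l \<T>" using full_simplex_verts(2)[OF Ks] by simp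
  finally show ?thesis .
qed

text \<open>The difference is telescoped along a face chain. Its elements are distinct and contain \<open>z\<close>, so their
  number is at most the maximal number of elements at a node, and each contributes to at most two jumps.\<close>

lemma face_chain_bound:
  fixes f R :: "(real^'n) set \<Rightarrow> real"
  assumes fc: "face_connected l \<Omega> \<T>" and z: "z \<in> mesh_nodes l \<T>" and K: "K \<in> \<T>" "z \<in> K" "K' \<in> \<T>" "z \<in> K'"
    and m: "0 \<le> m" "0 \<le> A" and R: "\<And>L. L \<in> \<T> \<Longrightarrow> 0 \<le> R L"
    and jump: "\<And>L L'. L \<in> \<T> \<Longrightarrow> L' \<in> \<T> \<Longrightarrow> z \<in> L \<Longrightarrow> z \<in> L' \<Longrightarrow> L \<noteq> L' \<Longrightarrow> L \<inter> L' \<in> interelement_faces \<Omega> \<T> \<Longrightarrow>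
      m * (f L - f L')\<^sup>2 \<le> A * (R L + R L')"
  shows "m * (f K - f K')\<^sup>2 \<le> real (max_elements_per_node l \<T>) * (2 * A * (\<Sum>L | L \<in> \<T> \<and> z \<in> L. R L))"
proof -
  obtain Ks where Ks: "Ks \<noteq> []" "hd Ks = K" "last Ks = K'" "distinct Ks" "set Ks \<subseteq> \<T>"
    and ch: "\<And>j. Suc j < length Ks \<Longrightarrow> Ks ! j \<inter> Ks ! Suc j \<in> interelement_faces \<Omega> \<T>"
      "\<And>j. Suc j < length Ks \<Longrightarrow> z \<in> Ks ! j \<inter> Ks ! Suc j"
  proof -
    have "\<exists>Ks. Ks \<noteq> [] \<and> hd Ks = K \<and> last Ks = K' \<and> distinct Ks \<and> set Ks \<subseteq> \<T> \<and>
      (\<forall>j. Suc j < length Ks \<longrightarrow> Ks ! j \<inter> Ks ! Suc j \<in> interelement_faces \<Omega> \<T> \<and> z \<in> Ks ! j \<inter> Ks ! Suc j)"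
      using fc[unfolded face_connected_def, rule_format, OF z K(1,3)] K(2,4) by simp
    then show ?thesis using that by metis
  qed
  let ?N = "length Ks - 1" let ?S = "{L. L \<in> \<T> \<and> z \<in> L}"
  have zin: "z \<in> Ks ! j" if "j < length Ks" for j
  proof (cases "Suc j < length Ks")
    case True then show ?thesis using ch(2) by blast
  next
    case False
    then have "j = length Ks - 1" using that by simp
    then show ?thesis using Ks(1,3) K(4) by (simp add: last_conv_nth)
  qed
  have sub: "set Ks \<subseteq> ?S" using Ks(5) zin by (auto simp: in_set_conv_nth)
  have finS: "finite ?S" using finite_mesh by simp
  have "?N \<le> card (set Ks)" using Ks(4) by (simp add: distinct_card)
  also have "\<dots> \<le> card ?S" by (rule card_mono[OF finS sub])
  also have "\<dots> \<le> max_elements_per_node l \<T>" by (rule elements_per_node[OF z])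
  finally have N: "real ?N \<le> real (max_elements_per_node l \<T>)" by simp
  have R0: "0 \<le> R (Ks ! j)" if "j < length Ks" for j using R Ks(5) that by (meson nth_mem subsetD)
  have sumR: "(\<Sum>j<length Ks. R (Ks ! j)) \<le> (\<Sum>L\<in>?S. R L)"
  proof -
    have "(\<Sum>j<length Ks. R (Ks ! j)) = (\<Sum>L\<in>set Ks. R L)"
      using sum_list_distinct_conv_sum_set[OF Ks(4), of R] by (simp add: sum_list_sum_nth atLeast0LessThan)
    also have "\<dots> \<le> (\<Sum>L\<in>?S. R L)" using R by (intro sum_mono2[OF finS sub]) auto
    finally show ?thesis .
  qed
  have "f K - f K' = (\<Sum>j<?N. f (Ks ! j) - f (Ks ! Suc j))"
    using Ks(1-3) by (subst sum_lessThan_telescope') (simp add: hd_conv_nth last_conv_nth)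
  then have "m * (f K - f K')\<^sup>2 = m * (\<Sum>j<?N. f (Ks ! j) - f (Ks ! Suc j))\<^sup>2" by simp
  also have "\<dots> \<le> m * ((\<Sum>j<?N. (f (Ks ! j) - f (Ks ! Suc j))\<^sup>2) * real ?N)"
    using sum_squared_le_sum_of_squares[of "\<lambda>j. f (Ks ! j) - f (Ks ! Suc j)" "{..<?N}"] m by (intro mult_left_mono) auto
  also have "\<dots> = real ?N * (\<Sum>j<?N. m * (f (Ks ! j) - f (Ks ! Suc j))\<^sup>2)" by (simp add: sum_distrib_left mult_ac)
  also have "\<dots> \<le> real ?N * (\<Sum>j<?N. A * (R (Ks ! j) + R (Ks ! Suc j)))"
  proof (intro mult_left_mono sum_mono)
    fix j assume "j \<in> {..<?N}"
    then have j: "Suc j < length Ks" "j < length Ks" by auto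
    then have "Ks ! j \<noteq> Ks ! Suc j" using Ks(4) by (simp add: nth_eq_iff_index_eq)
    then show "m * (f (Ks ! j) - f (Ks ! Suc j))\<^sup>2 \<le> A * (R (Ks ! j) + R (Ks ! Suc j))"
      using j Ks(5) zin ch(1)[OF j(1)] by (intro jump) (auto simp: subset_iff)
  qed simp
  also have "\<dots> = real ?N * (A * ((\<Sum>j<?N. R (Ks ! j)) + (\<Sum>j<?N. R (Ks ! Suc j))))"
    by (simp only: sum_distrib_left[symmetric] sum.distrib)
  also have "\<dots> \<le> real ?N * (A * ((\<Sum>L\<in>?S. R L) + (\<Sum>L\<in>?S. R L)))"
  proof (intro mult_left_mono add_mono m)
    have "(\<Sum>j<?N. R (Ks ! j)) \<le> (\<Sum>j<length Ks. R (Ks ! j))" using R0 by (intro sum_mono2) auto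
    then show "(\<Sum>j<?N. R (Ks ! j)) \<le> (\<Sum>L\<in>?S. R L)" using sumR by linarith
    have "(\<Sum>j<length Ks. R (Ks ! j)) = R (Ks ! 0) + (\<Sum>j<?N. R (Ks ! Suc j))"
      using Ks(1) sum.lessThan_Suc_shift[of "\<lambda>j. R (Ks ! j)" ?N] by simp
    then show "(\<Sum>j<?N. R (Ks ! Suc j)) \<le> (\<Sum>L\<in>?S. R L)" using sumR R0[of 0] Ks(1) by simp
  qed simp
  also have "\<dots> \<le> real (max_elements_per_node l \<T>) * (A * ((\<Sum>L\<in>?S. R L) + (\<Sum>L\<in>?S. R L)))"
    using N m R by (intro mult_right_mono mult_nonneg_nonneg add_nonneg_nonneg sum_nonneg) auto
  finally show ?thesis by (simp add: mult_ac)
qed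

section \<open>Interpolation of discontinuous piecewise polynomials\<close>

lemma sq_int_bound:
  fixes f :: "real^'n \<Rightarrow> 'b::euclidean_space"
  assumes f: "f square_integrable_on K" and K: "K \<in> lmeasurable" and M: "\<And>x. x \<in> K \<Longrightarrow> (norm (f x))\<^sup>2 \<le> M"
  shows "sq_int K f \<le> M * measure lebesgue K"
proof -
  have "sq_int K f \<le> (LINT x|lebesgue_on K. M)"
    using f M by (intro integral_mono finite_measure.integrable_const finite_measure_lebesgue_on K)
      (auto simp: square_integrable_on_def space_restrict_space)
  also have "\<dots> = M * measure lebesgue K" using K measure_restrict_space[of K lebesgue K] by (simp add: fmeasurableD)
  finally show ?thesis .
qed

lemma local_energy_triangle:
  assumes K: "K \<in> \<T>" and u: "u square_integrable_on \<Omega>" "g square_integrable_on \<Omega>"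
    and p: "p \<in> polynomials_upto l" "q \<in> polynomials_upto l" and e: "0 \<le> \<epsilon>"
  shows "local_energy \<epsilon> u g K q \<le> 2 * local_energy \<epsilon> u g K p +
    2 * (sq_int K (\<lambda>x. q x - p x) + \<epsilon> * sq_int K (\<lambda>x. grad q x - grad p x))"
proof -
  note C = full_simplex_compact[OF mesh_simplex[OF K]]
  note cp = continuous_on_polynomials_upto[OF p(1)] continuous_on_polynomials_upto[OF p(2)]
    continuous_on_grad_polynomials_upto[OF p(1)] continuous_on_grad_polynomials_upto[OF p(2)]
  have 1: "sq_int K (\<lambda>x. u x - q x) \<le> 2 * sq_int K (\<lambda>x. u x - p x) + 2 * sq_int K (\<lambda>x. q x - p x)"
    by (rule sq_int_diff_le[OF square_integrable_diff[OF square_integrable_element[OF u(1) K] square_integrable_continuous[OF cp(1) C]]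
          square_integrable_diff[OF square_integrable_continuous[OF cp(2) C] square_integrable_continuous[OF cp(1) C]]]) simp
  have 2: "sq_int K (\<lambda>x. g x - grad q x) \<le> 2 * sq_int K (\<lambda>x. g x - grad p x) + 2 * sq_int K (\<lambda>x. grad q x - grad p x)"
    by (rule sq_int_diff_le[OF square_integrable_diff[OF square_integrable_element[OF u(2) K] square_integrable_continuous[OF cp(3) C]]
          square_integrable_diff[OF square_integrable_continuous[OF cp(4) C] square_integrable_continuous[OF cp(3) C]]]) simp
  show ?thesis using 1 mult_left_mono[OF 2 e] by (simp add: local_energy_def algebra_simps)
qed

text \<open>A polynomial is controlled by its nodal values: on \<open>K\<close> the Lagrange functions are bounded, and their
  gradients are bounded by a multiple of the reciprocal inball diameter.\<close>

lemma nodal_difference_bound: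
  assumes K: "K \<in> \<T>" and l: "1 \<le> l" and p: "p \<in> polynomials_upto l" "q \<in> polynomials_upto l" and e: "0 \<le> \<epsilon>"
  shows "sq_int K (\<lambda>x. q x - p x) + \<epsilon> * sq_int K (\<lambda>x. grad q x - grad p x) \<le>
    (node_bound CARD('n) l * (real l ^ (l + 2))\<^sup>2) * (\<Sum>k\<in>node_indices l K.
       measure lebesgue K * (1 + \<epsilon> / (inball_diameter K)\<^sup>2) * (q (lattice_node l K k) - p (lattice_node l K k))\<^sup>2)"
proof -
  note Ks = mesh_simplex[OF K]
  note C = full_simplex_compact[OF Ks]
  let ?B = "real l ^ (l + 2)" and ?I = "node_indices l K" and ?\<rho> = "inball_diameter K"
  define c where "c k = q (lattice_node l K k) - p (lattice_node l K k)" for k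
  let ?s = "\<Sum>k\<in>?I. (c k)\<^sup>2"
  have rho: "0 < ?\<rho>" by (rule inball_diameter_pos[OF Ks])
  have N: "real (card ?I) \<le> node_bound CARD('n) l" using finite_node_indices(2)[OF Ks, of l] unfolding node_bound_def by (simp only: of_nat_le_iff)
  have rep: "q x - p x = (\<Sum>k\<in>?I. c k * lagrange_fun l K k x)" for x
    using polynomial_nodal_representation[OF Ks l polynomials_upto_diff[OF p(2,1)]] unfolding c_def .
  have gq: "grad q x - grad p x = (\<Sum>k\<in>?I. c k *\<^sub>R grad (lagrange_fun l K k) x)" for x
  proof -
    have 1: "GDERIV (\<lambda>x. q x - p x) x :> grad q x - grad p x"
      by (intro GDERIV_diff polynomials_upto_GDERIV(1)[OF p(1)] polynomials_upto_GDERIV(1)[OF p(2)])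
    have "((\<lambda>x. \<Sum>k\<in>?I. c k * lagrange_fun l K k x) has_derivative
        (\<lambda>h. \<Sum>k\<in>?I. c k * (h \<bullet> grad (lagrange_fun l K k) x))) (at x)"
      by (intro has_derivative_sum has_derivative_mult_right
          polynomials_upto_GDERIV(1)[OF lagrange_fun_polynomial[OF Ks], unfolded gderiv_def])
    then have 2: "GDERIV (\<lambda>x. q x - p x) x :> (\<Sum>k\<in>?I. c k *\<^sub>R grad (lagrange_fun l K k) x)"
      unfolding gderiv_def rep by (simp add: inner_sum_right)
    show ?thesis using GDERIV_unique[OF 1 2] .
  qed
  have b1: "(norm (q x - p x))\<^sup>2 \<le> node_bound CARD('n) l * ?B\<^sup>2 * ?s" if x: "x \<in> K" for x
  proof -
    have "(norm (q x - p x))\<^sup>2 = (\<Sum>k\<in>?I. c k * lagrange_fun l K k x)\<^sup>2" by (simp add: rep)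
    also have "\<dots> \<le> (\<Sum>k\<in>?I. (c k * lagrange_fun l K k x)\<^sup>2) * real (card ?I)"
      by (rule sum_squared_le_sum_of_squares)
    also have "\<dots> \<le> (\<Sum>k\<in>?I. (c k)\<^sup>2 * ?B\<^sup>2) * node_bound CARD('n) l"
    proof (intro mult_mono sum_mono N sum_nonneg)
      fix k assume "k \<in> ?I"
      from lagrange_fun_bounds(1)[OF Ks l this x] have "(lagrange_fun l K k x)\<^sup>2 \<le> ?B\<^sup>2"
        using power_mono[of "\<bar>lagrange_fun l K k x\<bar>" ?B 2] by simp
      then show "(c k * lagrange_fun l K k x)\<^sup>2 \<le> (c k)\<^sup>2 * ?B\<^sup>2" by (simp only: power_mult_distrib) (intro mult_left_mono; simp)
    qed auto
    finally show ?thesis by (simp only: sum_distrib_right[symmetric] mult_ac)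
  qed
  have b2: "(norm (grad q x - grad p x))\<^sup>2 \<le> node_bound CARD('n) l * ?B\<^sup>2 * ?s / ?\<rho>\<^sup>2" if x: "x \<in> K" for x
  proof -
    have "norm (grad q x - grad p x) \<le> (\<Sum>k\<in>?I. \<bar>c k\<bar> * norm (grad (lagrange_fun l K k) x))"
      unfolding gq using norm_sum[of "\<lambda>k. c k *\<^sub>R grad (lagrange_fun l K k) x" ?I] by simp
    then have "(norm (grad q x - grad p x))\<^sup>2 \<le> (\<Sum>k\<in>?I. \<bar>c k\<bar> * norm (grad (lagrange_fun l K k) x))\<^sup>2"
      by (intro power_mono) auto
    also have "\<dots> \<le> (\<Sum>k\<in>?I. (\<bar>c k\<bar> * norm (grad (lagrange_fun l K k) x))\<^sup>2) * real (card ?I)"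
      by (rule sum_squared_le_sum_of_squares)
    also have "\<dots> \<le> (\<Sum>k\<in>?I. (c k)\<^sup>2 * (?B / ?\<rho>)\<^sup>2) * node_bound CARD('n) l"
    proof (intro mult_mono sum_mono N sum_nonneg)
      fix k assume "k \<in> ?I"
      from lagrange_fun_bounds(2)[OF Ks l this x] have "norm (grad (lagrange_fun l K k) x) \<le> ?B / ?\<rho>"
        using rho by (simp add: field_simps)
      then have "(norm (grad (lagrange_fun l K k) x))\<^sup>2 \<le> (?B / ?\<rho>)\<^sup>2" by (intro power_mono) auto
      then show "(\<bar>c k\<bar> * norm (grad (lagrange_fun l K k) x))\<^sup>2 \<le> (c k)\<^sup>2 * (?B / ?\<rho>)\<^sup>2"
        by (simp only: power_mult_distrib power2_abs) (intro mult_left_mono; simp)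
    qed auto
    finally show ?thesis by (simp only: sum_distrib_right[symmetric] power_divide) (simp add: mult_ac)
  qed
  have Kl: "K \<in> lmeasurable" using lmeasurable_compact[OF C] .
  have "sq_int K (\<lambda>x. q x - p x) \<le> (node_bound CARD('n) l * ?B\<^sup>2 * ?s) * measure lebesgue K"
    by (rule sq_int_bound[OF square_integrable_continuous[OF continuous_on_diff C] Kl b1])
      (use continuous_on_polynomials_upto p in auto)
  moreover have "sq_int K (\<lambda>x. grad q x - grad p x) \<le> (node_bound CARD('n) l * ?B\<^sup>2 * ?s / ?\<rho>\<^sup>2) * measure lebesgue K"
    by (rule sq_int_bound[OF square_integrable_continuous[OF continuous_on_diff C] Kl b2])
      (use continuous_on_grad_polynomials_upto p in auto)
  then have "\<epsilon> * sq_int K (\<lambda>x. grad q x - grad p x) \<le> \<epsilon> * ((node_bound CARD('n) l * ?B\<^sup>2 * ?s / ?\<rho>\<^sup>2) * measure lebesgue K)"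
    using e by (rule mult_left_mono)
  ultimately have "sq_int K (\<lambda>x. q x - p x) + \<epsilon> * sq_int K (\<lambda>x. grad q x - grad p x) \<le>
     (node_bound CARD('n) l * ?B\<^sup>2 * ?s) * measure lebesgue K + \<epsilon> * ((node_bound CARD('n) l * ?B\<^sup>2 * ?s / ?\<rho>\<^sup>2) * measure lebesgue K)" by linarith
  also have "\<dots> = (node_bound CARD('n) l * ?B\<^sup>2) * (measure lebesgue K * (1 + \<epsilon> / ?\<rho>\<^sup>2) * ?s)"
    by (simp add: distrib_left distrib_right mult_ac)
  finally show ?thesis by (simp only: sum_distrib_left c_def)
qed

text \<open>The interpolant takes at each node the value of the local polynomial of one element containing the
  node. On any other element \<open>K\<close> at that node it differs from \<open>p K\<close> there by a sum of jumps along a face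
  chain. In the sum over all elements, each quantity \<open>R L\<close> is counted at most once for every node of every
  element touching \<open>L\<close>.\<close>

lemma quasi_interpolation:
  fixes p :: "(real^'n) set \<Rightarrow> real^'n \<Rightarrow> real" and R :: "(real^'n) set \<Rightarrow> real"
  assumes fc: "face_connected l \<Omega> \<T>" and l: "1 \<le> l" and u: "u square_integrable_on \<Omega>" "g square_integrable_on \<Omega>"
    and e: "0 \<le> \<epsilon>" and p: "\<And>K. K \<in> \<T> \<Longrightarrow> p K \<in> polynomials_upto l" and R: "\<And>K. K \<in> \<T> \<Longrightarrow> 0 \<le> R K" and A: "0 \<le> A"
    and pR: "\<And>K. K \<in> \<T> \<Longrightarrow> local_energy \<epsilon> u g K (p K) \<le> A' * R K"
    and jump: "\<And>K L L' z. K \<in> \<T> \<Longrightarrow> L \<in> \<T> \<Longrightarrow> L' \<in> \<T> \<Longrightarrow> z \<in> K \<Longrightarrow> z \<in> L \<Longrightarrow> z \<in> L' \<Longrightarrow> L \<noteq> L' \<Longrightarrow>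
      L \<inter> L' \<in> interelement_faces \<Omega> \<T> \<Longrightarrow>
      measure lebesgue K * (1 + \<epsilon> / (inball_diameter K)\<^sup>2) * (p L z - p L' z)\<^sup>2 \<le> A * (R L + R L')"
  shows "\<exists>v\<in>fe_space l \<T>. (\<Sum>K\<in>\<T>. local_energy \<epsilon> u g K v) \<le>
    (2 * A' + 4 * A * (node_bound CARD('n) l * real l ^ (l + 2) * real (max_elements_per_node l \<T>))\<^sup>2 * (real CARD('n) + 1)) * (\<Sum>K\<in>\<T>. R K)"
proof -
  let ?n = "real (max_elements_per_node l \<T>)" and ?N = "node_bound CARD('n) l" and ?B = "real l ^ (l + 2)" and ?d = "real CARD('n)"
  define V where "V z = p (SOME K. K \<in> \<T> \<and> z \<in> K) z" for z
  obtain v where v: "v \<in> fe_space l \<T>" "\<And>K x. K \<in> \<T> \<Longrightarrow> x \<in> K \<Longrightarrow> v x = nodal_interpolant l K V x"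
    using nodal_interpolation[OF mesh_triangulation, of l V] mesh_simplex by blast
  have N0: "0 \<le> ?N" by (simp add: node_bound_def)
  let ?S = "\<lambda>z. \<Sum>L | L \<in> \<T> \<and> z \<in> L. R L" let ?T = "\<lambda>K. \<Sum>L | L \<in> \<T> \<and> K \<inter> L \<noteq> {}. R L"
  have T0: "0 \<le> ?T K" for K using R by (intro sum_nonneg) auto
  have loc: "local_energy \<epsilon> u g K v \<le> 2 * A' * R K + 4 * A * ?N\<^sup>2 * ?B\<^sup>2 * ?n * ?T K" if K: "K \<in> \<T>" for K
  proof -
    note Ks = mesh_simplex[OF K]
    let ?I = "node_indices l K" and ?q = "nodal_interpolant l K V"
    have q: "?q \<in> polynomials_upto l" by (rule nodal_interpolant_polynomial[OF Ks])
    have node: "measure lebesgue K * (1 + \<epsilon> / (inball_diameter K)\<^sup>2) * (?q (lattice_node l K k) - p K (lattice_node l K k))\<^sup>2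
       \<le> ?n * (2 * A * ?T K)" if k: "k \<in> ?I" for k
    proof -
      let ?z = "lattice_node l K k"
      have zK: "?z \<in> K" by (rule bary_lattice_node(2)[OF Ks l k])
      have z: "?z \<in> mesh_nodes l \<T>" using K k by (auto simp: mesh_nodes_def simplex_nodes_eq)
      have "?q ?z = (\<Sum>k'\<in>?I. if k' = k then V ?z else 0)"
        unfolding nodal_interpolant_def by (rule sum.cong) (auto simp: lagrange_fun_node[OF Ks l _ k])
      then have qz: "?q ?z = V ?z" using k finite_node_indices(1)[OF Ks] by simp
      let ?L = "SOME L. L \<in> \<T> \<and> ?z \<in> L"
      have L: "?L \<in> \<T> \<and> ?z \<in> ?L" using K zK by (rule_tac someI[of _ K]) simp
      have "measure lebesgue K * (1 + \<epsilon> / (inball_diameter K)\<^sup>2) * (p ?L ?z - p K ?z)\<^sup>2 \<le> ?n * (2 * A * ?S ?z)"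
        by (rule face_chain_bound[OF fc z _ _ K zK _ A R, where f = "\<lambda>L. p L ?z"]) (use L jump[OF K _ _ zK] e in auto)
      also have "\<dots> \<le> ?n * (2 * A * ?T K)"
        using zK R A finite_mesh by (intro mult_left_mono sum_mono2) auto
      finally show ?thesis by (simp only: qz V_def)
    qed
    have "local_energy \<epsilon> u g K v = local_energy \<epsilon> u g K ?q"
      using local_energy_cong[OF square_integrable_element[OF u(1) K] square_integrable_element[OF u(2) K] v(1) K q] v(2)[OF K] by blast
    also have "\<dots> \<le> 2 * local_energy \<epsilon> u g K (p K) + 2 * (sq_int K (\<lambda>x. ?q x - p K x) + \<epsilon> * sq_int K (\<lambda>x. grad ?q x - grad (p K) x))"
      by (rule local_energy_triangle[OF K u p[OF K] q e])
    also have "\<dots> \<le> 2 * (A' * R K) + 2 * ((?N * ?B\<^sup>2) * (\<Sum>k\<in>?I. ?n * (2 * A * ?T K)))"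
    proof (intro add_mono mult_left_mono pR K)
      have "(\<Sum>k\<in>?I. measure lebesgue K * (1 + \<epsilon> / (inball_diameter K)\<^sup>2) * (?q (lattice_node l K k) - p K (lattice_node l K k))\<^sup>2)
          \<le> (\<Sum>k\<in>?I. ?n * (2 * A * ?T K))" by (intro sum_mono node)
      then have "(?N * ?B\<^sup>2) * (\<Sum>k\<in>?I. measure lebesgue K * (1 + \<epsilon> / (inball_diameter K)\<^sup>2) * (?q (lattice_node l K k) - p K (lattice_node l K k))\<^sup>2)
          \<le> (?N * ?B\<^sup>2) * (\<Sum>k\<in>?I. ?n * (2 * A * ?T K))" using N0 by (intro mult_left_mono) auto
      then show "sq_int K (\<lambda>x. ?q x - p K x) + \<epsilon> * sq_int K (\<lambda>x. grad ?q x - grad (p K) x) \<le> (?N * ?B\<^sup>2) * (\<Sum>k\<in>?I. ?n * (2 * A * ?T K))"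
        using nodal_difference_bound[OF K l p[OF K] q e] by (rule order.trans[rotated])
    qed auto
    also have "\<dots> \<le> 2 * (A' * R K) + 2 * ((?N * ?B\<^sup>2) * (?N * (?n * (2 * A * ?T K))))"
    proof (intro add_left_mono mult_left_mono)
      have "real (card ?I) \<le> ?N" using finite_node_indices(2)[OF Ks, of l] unfolding node_bound_def by (simp only: of_nat_le_iff)
      then have "real (card ?I) * (?n * (2 * A * ?T K)) \<le> ?N * (?n * (2 * A * ?T K))"
        using A T0[of K] by (intro mult_right_mono mult_nonneg_nonneg) auto
      then show "(\<Sum>k\<in>?I. ?n * (2 * A * ?T K)) \<le> ?N * (?n * (2 * A * ?T K))" by simp
    qed (use N0 in auto)
    also have "\<dots> = 2 * A' * R K + 4 * A * ?N\<^sup>2 * ?B\<^sup>2 * ?n * ?T K"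
      by (simp add: power2_eq_square mult_ac)
    finally show ?thesis .
  qed
  have sumT: "(\<Sum>K\<in>\<T>. ?T K) \<le> (?d + 1) * ?n * (\<Sum>L\<in>\<T>. R L)"
  proof -
    have "(\<Sum>K\<in>\<T>. ?T K) = (\<Sum>K\<in>\<T>. \<Sum>L\<in>\<T>. if K \<inter> L \<noteq> {} then R L else 0)"
      using finite_mesh by (intro sum.cong refl sum.inter_filter)
    also have "\<dots> = (\<Sum>L\<in>\<T>. \<Sum>K\<in>\<T>. if K \<inter> L \<noteq> {} then R L else 0)" by (rule sum.swap)
    also have "\<dots> = (\<Sum>L\<in>\<T>. real (card {K\<in>\<T>. L \<inter> K \<noteq> {}}) * R L)"
      using finite_mesh by (intro sum.cong refl) (simp add: sum.inter_filter[symmetric] Int_commute)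
    also have "\<dots> \<le> (\<Sum>L\<in>\<T>. ((?d + 1) * ?n) * R L)"
    proof (intro sum_mono mult_right_mono R)
      fix L assume "L \<in> \<T>"
      then have "real (card {K\<in>\<T>. L \<inter> K \<noteq> {}}) \<le> real ((CARD('n) + 1) * max_elements_per_node l \<T>)"
        using card_touching_elements[OF _ l] by (simp only: of_nat_le_iff)
      then show "real (card {K\<in>\<T>. L \<inter> K \<noteq> {}}) \<le> (?d + 1) * ?n" by (simp add: algebra_simps)
    qed auto
    also have "\<dots> = (?d + 1) * ?n * (\<Sum>L\<in>\<T>. R L)" by (simp only: sum_distrib_left)
    finally show ?thesis .
  qed
  have "(\<Sum>K\<in>\<T>. local_energy \<epsilon> u g K v) \<le> (\<Sum>K\<in>\<T>. 2 * A' * R K + 4 * A * ?N\<^sup>2 * ?B\<^sup>2 * ?n * ?T K)" by (intro sum_mono loc)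
  also have "\<dots> = 2 * A' * (\<Sum>K\<in>\<T>. R K) + 4 * A * ?N\<^sup>2 * ?B\<^sup>2 * ?n * (\<Sum>K\<in>\<T>. ?T K)"
    by (simp only: sum.distrib sum_distrib_left)
  also have "\<dots> \<le> 2 * A' * (\<Sum>K\<in>\<T>. R K) + 4 * A * ?N\<^sup>2 * ?B\<^sup>2 * ?n * ((?d + 1) * ?n * (\<Sum>L\<in>\<T>. R L))"
    using sumT A N0 by (intro add_left_mono mult_left_mono mult_nonneg_nonneg) auto
  also have "\<dots> = (2 * A' + 4 * A * (?N * ?B * ?n)\<^sup>2 * (?d + 1)) * (\<Sum>K\<in>\<T>. R K)"
  proof -
    have "2 * A' * S + 4 * A * N\<^sup>2 * B\<^sup>2 * n * (D * n * S) = (2 * A' + 4 * A * (N * B * n)\<^sup>2 * D) * S" for N B n D S :: real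
      by (simp add: power2_eq_square algebra_simps)
    then show ?thesis .
  qed
  finally show ?thesis using v(1) by blast
qed

end

text \<open>The factor of \<open>quasi_interpolation\<close>, with \<open>A'\<close> for the elementwise approximation and \<open>A\<close> for the
  jumps.\<close>

definition interpolation_const :: "nat \<Rightarrow> nat \<Rightarrow> nat \<Rightarrow> real \<Rightarrow> real \<Rightarrow> real" where
  "interpolation_const d l n A' A = 2 * A' + 4 * A * (node_bound d l * real l ^ (l + 2) * real n)\<^sup>2 * (real d + 1)"

lemma interpolation_const_nonneg: "0 \<le> A' \<Longrightarrow> 0 \<le> A \<Longrightarrow> 0 \<le> interpolation_const d l n A' A"
  by (simp add: interpolation_const_def)

definition energy_const :: "'n::finite itself \<Rightarrow> real \<Rightarrow> real" where
  "energy_const n \<sigma> = 2 + 2 * ((16 * \<sigma>) ^ CARD('n) / bump_mass n)\<^sup>2"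

definition jump_const :: "'n::finite itself \<Rightarrow> nat \<Rightarrow> real \<Rightarrow> real \<Rightarrow> real" where
  "jump_const n l \<theta> \<sigma> = 8 * \<theta> * inverse_const CARD('n) l + 64 * \<theta> * ((16 * real CARD('n) * \<sigma>) ^ CARD('n) / bump_mass n)\<^sup>2"

context mesh
begin

section \<open>Best errors\<close>

lemma interelement_faces_subset: "interelement_faces \<Omega> \<T> \<subseteq> faces \<T>"
  by (auto simp: interelement_faces_def)

lemma finite_interelement_faces: "finite (interelement_faces \<Omega> \<T>)"
proof (rule finite_subset[OF interelement_faces_subset])
  have "faces \<T> = (\<Union>K\<in>\<T>. {E. E facet_of K})" by (auto simp: faces_def)
  then show "finite (faces \<T>)" by (simp add: finite_mesh mesh_simplex card_facets(1))
qed

lemma zero_in_fe_space: "(\<lambda>_. 0) \<in> fe_space l \<T>"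
  unfolding fe_space_def using polynomials_upto_const[of 0 l] by (auto intro!: bexI[of _ "\<lambda>_. 0"])

text \<open>The part of the local best errors, with approximants \<open>w E\<close>, that the element \<open>K\<close> contributes through
  its interelement faces.\<close>

definition face_sum :: "real \<Rightarrow> (real^'n \<Rightarrow> real) \<Rightarrow> (real^'n \<Rightarrow> real^'n) \<Rightarrow> ((real^'n) set \<Rightarrow> real^'n \<Rightarrow> real) \<Rightarrow> (real^'n) set \<Rightarrow> real" where
  "face_sum \<epsilon> u g w K = (\<Sum>E | E \<in> interelement_faces \<Omega> \<T> \<and> E \<subseteq> frontier K. local_energy \<epsilon> u g K (w E))"

lemma face_sum_ge:
  assumes "E \<in> interelement_faces \<Omega> \<T>" "E \<subseteq> frontier K" "0 \<le> \<epsilon>"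
  shows "local_energy \<epsilon> u g K (w E) \<le> face_sum \<epsilon> u g w K"
  unfolding face_sum_def using assms by (intro member_le_sum) (auto simp: finite_interelement_faces local_energy_nonneg)

lemma face_sum_nonneg: "0 \<le> \<epsilon> \<Longrightarrow> 0 \<le> face_sum \<epsilon> u g w K"
  unfolding face_sum_def by (intro sum_nonneg local_energy_nonneg)

lemma sum_face_sum:
  "(\<Sum>K\<in>\<T>. face_sum \<epsilon> u g w K) =
    (\<Sum>E\<in>interelement_faces \<Omega> \<T>. \<Sum>K | K \<in> \<T> \<and> E \<subseteq> frontier K. local_energy \<epsilon> u g K (w E))"
  unfolding face_sum_def by (rule sum.swap_restrict[OF finite_mesh finite_interelement_faces])

lemma energy_norm_face_patch:
  assumes u: "u square_integrable_on \<Omega>" "has_weak_gradient \<Omega> u g" "g square_integrable_on \<Omega>"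
    and v: "v \<in> fe_space l \<T>" and e: "0 \<le> \<epsilon>"
  shows "(energy_norm \<epsilon> (face_patch \<T> E) (\<lambda>x. u x - restrict v (face_patch \<T> E) x))\<^sup>2 =
    (\<Sum>K | K \<in> \<T> \<and> E \<subseteq> frontier K. local_energy \<epsilon> u g K v)"
  using energy_norm_patch[OF u v, of "{K \<in> \<T>. E \<subseteq> frontier K}" "restrict v (face_patch \<T> E)" \<epsilon> "face_patch \<T> E"] e
  by (auto simp: face_patch_def)

lemma energy_norm_domain:
  assumes u: "u square_integrable_on \<Omega>" "has_weak_gradient \<Omega> u g" "g square_integrable_on \<Omega>"
    and v: "v \<in> fe_space l \<T>" and e: "0 \<le> \<epsilon>"
  shows "(energy_norm \<epsilon> \<Omega> (\<lambda>x. u x - v x))\<^sup>2 = (\<Sum>K\<in>\<T>. local_energy \<epsilon> u g K v)"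
  by (rule energy_norm_patch[OF u v _ _ e]) auto

lemma energy_norm_nonneg: "0 \<le> \<epsilon> \<Longrightarrow> 0 \<le> energy_norm \<epsilon> \<omega> (w :: real^'n \<Rightarrow> real)"
  by (simp add: energy_norm_def)

lemma global_best_error_le:
  "0 \<le> \<epsilon> \<Longrightarrow> v \<in> fe_space l \<T> \<Longrightarrow> global_best_error l \<Omega> \<T> \<epsilon> u \<le> energy_norm \<epsilon> \<Omega> (\<lambda>x. u x - v x)"
  unfolding global_best_error_def by (intro cINF_lower bdd_belowI2[of _ 0] energy_norm_nonneg)

lemma global_best_error_nonneg: "0 \<le> \<epsilon> \<Longrightarrow> 0 \<le> global_best_error l \<Omega> \<T> \<epsilon> u"
  unfolding global_best_error_def
proof (rule cINF_greatest)
  show "fe_space l \<T> \<noteq> {}" using zero_in_fe_space[of l] by blast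
qed (rule energy_norm_nonneg)

abbreviation patch_error :: "nat \<Rightarrow> real \<Rightarrow> (real^'n \<Rightarrow> real) \<Rightarrow> (real^'n) set \<Rightarrow> real" where
  "patch_error l \<epsilon> u E \<equiv> (INF P\<in>restricted_space (fe_space l \<T>) (face_patch \<T> E).
     (energy_norm \<epsilon> (face_patch \<T> E) (\<lambda>x. u x - P x))\<^sup>2)"

lemma patch_error_le:
  "v \<in> fe_space l \<T> \<Longrightarrow> patch_error l \<epsilon> u E \<le> (energy_norm \<epsilon> (face_patch \<T> E) (\<lambda>x. u x - restrict v (face_patch \<T> E) x))\<^sup>2"
  by (rule cINF_lower2[of _ _ "restrict v (face_patch \<T> E)"]) (auto simp: restricted_space_def intro!: bdd_belowI2[of _ 0])

lemma patch_error_nonneg: "0 \<le> patch_error l \<epsilon> u E"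
  using zero_in_fe_space[of l] by (intro cINF_greatest) (auto simp: restricted_space_def)

lemma patch_error_approx:
  assumes "0 < \<delta>"
  shows "\<exists>v\<in>fe_space l \<T>. (energy_norm \<epsilon> (face_patch \<T> E) (\<lambda>x. u x - restrict v (face_patch \<T> E) x))\<^sup>2 < patch_error l \<epsilon> u E + \<delta>"
proof -
  let ?f = "\<lambda>P. (energy_norm \<epsilon> (face_patch \<T> E) (\<lambda>x. u x - P x))\<^sup>2"
  let ?R = "restricted_space (fe_space l \<T>) (face_patch \<T> E)"
  have "?f ` ?R \<noteq> {}" using zero_in_fe_space[of l] by (auto simp: restricted_space_def)
  moreover have "Inf (?f ` ?R) < Inf (?f ` ?R) + \<delta>" using assms by simp
  ultimately obtain y where y: "y \<in> ?f ` ?R" "y < Inf (?f ` ?R) + \<delta>" by (rule cInf_lessD[THEN bexE])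
  then obtain v where "v \<in> fe_space l \<T>" "y = ?f (restrict v (face_patch \<T> E))" by (auto simp: restricted_space_def)
  then show ?thesis using y(2) by blast
qed

lemma local_best_errors_nonneg: "0 \<le> local_best_errors l \<Omega> \<T> \<epsilon> u"
  unfolding local_best_errors_def using patch_error_nonneg by (intro real_sqrt_ge_zero sum_nonneg) auto

text \<open>Restrictions of a global approximant compete in the local problems, and each element occurs in the
  patches of at most \<open>d + 1\<close> faces.\<close>

lemma local_best_errors_le:
  assumes u: "u \<in> H1 \<Omega>" and e: "0 \<le> \<epsilon>"
  shows "local_best_errors l \<Omega> \<T> \<epsilon> u \<le> (real CARD('n) + 1) * global_best_error l \<Omega> \<T> \<epsilon> u"
proof -
  obtain g where g: "u square_integrable_on \<Omega>" "has_weak_gradient \<Omega> u g" "g square_integrable_on \<Omega>"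
    using u by (auto simp: H1_def)
  let ?d = "real CARD('n) + 1"
  have "local_best_errors l \<Omega> \<T> \<epsilon> u / ?d \<le> energy_norm \<epsilon> \<Omega> (\<lambda>x. u x - v x)" if v: "v \<in> fe_space l \<T>" for v
  proof -
    have "(\<Sum>E\<in>interelement_faces \<Omega> \<T>. patch_error l \<epsilon> u E) \<le>
        (\<Sum>E\<in>interelement_faces \<Omega> \<T>. \<Sum>K | K \<in> \<T> \<and> E \<subseteq> frontier K. local_energy \<epsilon> u g K v)"
      unfolding energy_norm_face_patch[OF g v e, symmetric] by (intro sum_mono patch_error_le v)
    also have "\<dots> = (\<Sum>K\<in>\<T>. face_sum \<epsilon> u g (\<lambda>_. v) K)" by (rule sum_face_sum[symmetric])
    also have "\<dots> \<le> (\<Sum>K\<in>\<T>. ?d * local_energy \<epsilon> u g K v)"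
    proof (rule sum_mono)
      fix K assume K: "K \<in> \<T>"
      have "{E. E \<in> interelement_faces \<Omega> \<T> \<and> E \<subseteq> frontier K} \<subseteq> {E. E facet_of K}"
        using interelement_faces_subset face_frontier_iff[OF _ K] by blast
      then have "card {E. E \<in> interelement_faces \<Omega> \<T> \<and> E \<subseteq> frontier K} \<le> CARD('n) + 1"
        using card_facets[OF mesh_simplex[OF K]] card_mono order.trans by blast
      then have "real (card {E. E \<in> interelement_faces \<Omega> \<T> \<and> E \<subseteq> frontier K}) \<le> ?d" by linarith
      then show "face_sum \<epsilon> u g (\<lambda>_. v) K \<le> ?d * local_energy \<epsilon> u g K v"
        unfolding face_sum_def using local_energy_nonneg[OF e, of u g K v] by (simp add: mult_right_mono)
    qed
    also have "\<dots> = ?d * (energy_norm \<epsilon> \<Omega> (\<lambda>x. u x - v x))\<^sup>2"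
      unfolding energy_norm_domain[OF g v e] by (simp only: sum_distrib_left)
    also have "\<dots> \<le> (?d * energy_norm \<epsilon> \<Omega> (\<lambda>x. u x - v x))\<^sup>2"
    proof -
      have "?d * 1 \<le> ?d * ?d" by (intro mult_left_mono) auto
      then show ?thesis unfolding power_mult_distrib power2_eq_square[of ?d] by (intro mult_right_mono) auto
    qed
    finally have "local_best_errors l \<Omega> \<T> \<epsilon> u \<le> ?d * energy_norm \<epsilon> \<Omega> (\<lambda>x. u x - v x)"
      unfolding local_best_errors_def using energy_norm_nonneg[OF e] by (intro real_le_lsqrt) (auto intro!: sum_nonneg patch_error_nonneg)
    then show ?thesis by (simp add: field_simps)
  qed
  then have "local_best_errors l \<Omega> \<T> \<epsilon> u / ?d \<le> global_best_error l \<Omega> \<T> \<epsilon> u"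
    unfolding global_best_error_def using zero_in_fe_space[of l] by (intro cINF_greatest) auto
  then show ?thesis by (simp add: field_simps)
qed

text \<open>Infima over the local spaces are replaced by near-minimisers, whose total excess is arbitrarily small
  since there are finitely many faces.\<close>

lemma global_best_error_le_local:
  assumes g: "u square_integrable_on \<Omega>" "has_weak_gradient \<Omega> u g" "g square_integrable_on \<Omega>"
    and e: "0 \<le> \<epsilon>" and C: "0 \<le> C"
    and bound: "\<And>w. (\<And>E. w E \<in> fe_space l \<T>) \<Longrightarrow>
      \<exists>v\<in>fe_space l \<T>. (\<Sum>K\<in>\<T>. local_energy \<epsilon> u g K v) \<le> C * (\<Sum>K\<in>\<T>. face_sum \<epsilon> u g w K)"
  shows "global_best_error l \<Omega> \<T> \<epsilon> u \<le> sqrt C * local_best_errors l \<Omega> \<T> \<epsilon> u"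
proof -
  let ?I = "interelement_faces \<Omega> \<T>" and ?G = "global_best_error l \<Omega> \<T> \<epsilon> u"
  let ?S = "\<Sum>E\<in>?I. patch_error l \<epsilon> u E"
  have S0: "0 \<le> ?S" by (intro sum_nonneg patch_error_nonneg)
  have *: "?G\<^sup>2 \<le> C * ?S + \<eta>" if \<eta>: "0 < \<eta>" for \<eta>
  proof -
    \<comment> \<open>the summand \<open>1\<close> keeps the denominator positive\<close>
    define \<delta> where "\<delta> = \<eta> / (C * real (card ?I) + 1)"
    have den: "0 < C * real (card ?I) + 1" using C by (intro add_nonneg_pos) auto
    have \<delta>: "0 < \<delta>" using \<eta> den by (simp add: \<delta>_def)
    let ?near = "\<lambda>E v. v \<in> fe_space l \<T> \<and>
      (energy_norm \<epsilon> (face_patch \<T> E) (\<lambda>x. u x - restrict v (face_patch \<T> E) x))\<^sup>2 < patch_error l \<epsilon> u E + \<delta>"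
    have "\<forall>E. \<exists>v. ?near E v" using patch_error_approx[OF \<delta>] by blast
    from choice[OF this] obtain w where "\<forall>E. ?near E (w E)" by (rule exE)
    then have w: "\<And>E. w E \<in> fe_space l \<T>"
      "\<And>E. (energy_norm \<epsilon> (face_patch \<T> E) (\<lambda>x. u x - restrict (w E) (face_patch \<T> E) x))\<^sup>2 < patch_error l \<epsilon> u E + \<delta>"
      by simp_all
    have "\<exists>v\<in>fe_space l \<T>. (\<Sum>K\<in>\<T>. local_energy \<epsilon> u g K v) \<le> C * (\<Sum>K\<in>\<T>. face_sum \<epsilon> u g w K)"
      by (rule bound) (rule w(1))
    then obtain v where v: "v \<in> fe_space l \<T>" "(\<Sum>K\<in>\<T>. local_energy \<epsilon> u g K v) \<le> C * (\<Sum>K\<in>\<T>. face_sum \<epsilon> u g w K)"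
      by (rule bexE)
    have "?G\<^sup>2 \<le> (energy_norm \<epsilon> \<Omega> (\<lambda>x. u x - v x))\<^sup>2"
      by (intro power_mono global_best_error_le global_best_error_nonneg e v(1))
    also have "\<dots> \<le> C * (\<Sum>K\<in>\<T>. face_sum \<epsilon> u g w K)" using v energy_norm_domain[OF g v(1) e] by simp
    also have "(\<Sum>K\<in>\<T>. face_sum \<epsilon> u g w K) =
        (\<Sum>E\<in>?I. (energy_norm \<epsilon> (face_patch \<T> E) (\<lambda>x. u x - restrict (w E) (face_patch \<T> E) x))\<^sup>2)"
      unfolding sum_face_sum using energy_norm_face_patch[OF g w(1) e] by simp
    also have "C * \<dots> \<le> C * (\<Sum>E\<in>?I. patch_error l \<epsilon> u E + \<delta>)"
      by (intro mult_left_mono sum_mono less_imp_le[OF w(2)] C)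
    also have "\<dots> = C * ?S + (C * real (card ?I)) * \<delta>" by (simp add: sum.distrib distrib_left)
    also have "\<dots> \<le> C * ?S + (C * real (card ?I) + 1) * \<delta>" using \<delta> by (intro add_left_mono mult_right_mono) auto
    also have "\<dots> = C * ?S + \<eta>" using den by (simp add: \<delta>_def)
    finally show ?thesis .
  qed
  have "?G\<^sup>2 \<le> C * ?S" by (rule field_le_epsilon) (rule *)
  then have "?G \<le> sqrt (C * ?S)" by (rule real_le_rsqrt)
  then show ?thesis by (simp add: local_best_errors_def real_sqrt_mult)
qed

section \<open>Small and general parameters\<close>

lemma volume_ratio_bound:
  assumes K: "K \<in> \<T>" "K' \<in> \<T>" "K \<inter> K' \<noteq> {}"
  shows "measure lebesgue K \<le> (volume_ratio \<T>)\<^sup>2 * measure lebesgue K'"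
proof -
  let ?f = "\<lambda>(K, K'). sqrt (measure lebesgue K) / sqrt (measure lebesgue K')"
  let ?A = "{sqrt (measure lebesgue K) / sqrt (measure lebesgue K') | K K'. K \<in> \<T> \<and> K' \<in> \<T> \<and> K \<inter> K' \<noteq> {}}"
  have "?A \<subseteq> ?f ` (\<T> \<times> \<T>)" by auto
  then have "finite ?A" using finite_mesh finite_subset by blast
  then have le: "sqrt (measure lebesgue K) / sqrt (measure lebesgue K') \<le> volume_ratio \<T>"
    unfolding volume_ratio_def using K by (intro Max_ge) auto
  have pos: "0 < measure lebesgue K'" "0 < measure lebesgue K" using full_simplex_measure(1)[OF mesh_simplex] K by blast+
  have "(sqrt (measure lebesgue K) / sqrt (measure lebesgue K'))\<^sup>2 \<le> (volume_ratio \<T>)\<^sup>2"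
    using le pos by (intro power_mono) auto
  then have "measure lebesgue K / measure lebesgue K' \<le> (volume_ratio \<T>)\<^sup>2" using pos by (simp add: power_divide)
  then show ?thesis using pos by (simp add: field_simps)
qed

lemma shape_parameter_bound:
  assumes K: "K \<in> \<T>" "K' \<in> \<T>" "K \<inter> K' \<noteq> {}"
  shows "diameter K' \<le> shape_parameter \<T> * inball_diameter K"
proof -
  let ?f = "\<lambda>(K, K'). diameter K' / inball_diameter K"
  let ?A = "{diameter K' / inball_diameter K | K K'. K \<in> \<T> \<and> K' \<in> \<T> \<and> K \<inter> K' \<noteq> {}}"
  have "?A \<subseteq> ?f ` (\<T> \<times> \<T>)" by auto
  then have "finite ?A" using finite_mesh finite_subset by blast
  then have "diameter K' / inball_diameter K \<le> shape_parameter \<T>"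
    unfolding shape_parameter_def using K by (intro Max_ge) auto
  then show ?thesis using inball_diameter_pos[OF mesh_simplex[OF K(1)]] by (simp add: field_simps)
qed

lemma element_piece_energy:
  assumes g: "u square_integrable_on \<Omega>" "g square_integrable_on \<Omega>" and e: "0 \<le> \<epsilon>"
    and faces: "\<forall>K\<in>\<T>. \<exists>E\<in>interelement_faces \<Omega> \<T>. E facet_of K"
    and w: "\<And>E. w E \<in> fe_space l \<T>" and K: "K \<in> \<T>"
  shows "\<exists>p\<in>polynomials_upto l. local_energy \<epsilon> u g K p \<le> face_sum \<epsilon> u g w K"
proof -
  obtain E where E: "E \<in> interelement_faces \<Omega> \<T>" "E facet_of K" using faces K by blast
  obtain p where p: "p \<in> polynomials_upto l" "\<And>x. x \<in> K \<Longrightarrow> w E x = p x" using fe_piece[OF w K] by metis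
  have "local_energy \<epsilon> u g K p = local_energy \<epsilon> u g K (w E)"
    using local_energy_cong[OF square_integrable_element[OF g(1) K] square_integrable_element[OF g(2) K] w K p] by simp
  also have "\<dots> \<le> face_sum \<epsilon> u g w K"
    using face_sum_ge[OF E(1) _ e] facet_subset_frontier[OF mesh_simplex[OF K] E(2)] by blast
  finally show ?thesis using p(1) by blast
qed

lemma face_energies:
  assumes E: "K \<inter> K' \<in> interelement_faces \<Omega> \<T>" and K: "K \<in> \<T>" "K' \<in> \<T>" and e: "0 \<le> \<epsilon>"
  shows "K \<inter> K' facet_of K" "K \<inter> K' facet_of K'"
    "local_energy \<epsilon> u g K (w (K \<inter> K')) \<le> face_sum \<epsilon> u g w K" "local_energy \<epsilon> u g K' (w (K \<inter> K')) \<le> face_sum \<epsilon> u g w K'"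
proof -
  have f: "K \<inter> K' \<in> faces \<T>" using E interelement_faces_subset by blast
  show *: "K \<inter> K' facet_of K" "K \<inter> K' facet_of K'" using face_is_facet[OF f] K by auto
  then show "local_energy \<epsilon> u g K (w (K \<inter> K')) \<le> face_sum \<epsilon> u g w K" "local_energy \<epsilon> u g K' (w (K \<inter> K')) \<le> face_sum \<epsilon> u g w K'"
    using face_sum_ge[OF E _ e] face_frontier_iff[OF f] K by blast+
qed

lemma jump_L2_energy:
  assumes E: "K \<inter> K' \<in> interelement_faces \<Omega> \<T>" and K: "K \<in> \<T>" "K' \<in> \<T>" "z \<in> K" "z \<in> K'" and e: "0 \<le> \<epsilon>"
    and u: "u square_integrable_on \<Omega>" and w: "\<And>E. w E \<in> fe_space l \<T>"
    and p: "p \<in> polynomials_upto l" "p' \<in> polynomials_upto l"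
    and pR: "local_energy \<epsilon> u g K p \<le> A' * face_sum \<epsilon> u g w K" "local_energy \<epsilon> u g K' p' \<le> A' * face_sum \<epsilon> u g w K'"
    and m: "m \<le> \<theta> * measure lebesgue K" "m \<le> \<theta> * measure lebesgue K'" "0 \<le> \<theta>"
  shows "m * (p z - p' z)\<^sup>2 \<le> 4 * \<theta> * inverse_const CARD('n) l * (A' + 1) * (face_sum \<epsilon> u g w K + face_sum \<epsilon> u g w K')"
proof -
  have s: "sq_int L (\<lambda>x. u x - q x) \<le> local_energy \<epsilon> u g L q" for L q
    using e sq_int_nonneg[of L "\<lambda>x. g x - grad q x"] by (simp add: local_energy_def)
  let ?v = "w (K \<inter> K')"
  have "m * (p z - p' z)\<^sup>2 \<le> 4 * \<theta> * inverse_const CARD('n) l *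
    ((sq_int K (\<lambda>x. u x - p x) + sq_int K (\<lambda>x. u x - ?v x)) + (sq_int K' (\<lambda>x. u x - p' x) + sq_int K' (\<lambda>x. u x - ?v x)))"
    by (rule jump_L2[OF K(1,3,2,4) u w p m])
  also have "\<dots> \<le> 4 * \<theta> * inverse_const CARD('n) l *
    ((A' * face_sum \<epsilon> u g w K + face_sum \<epsilon> u g w K) + (A' * face_sum \<epsilon> u g w K' + face_sum \<epsilon> u g w K'))"
    using m(3) inverse_const_pos[of "CARD('n)" l]
    by (intro mult_left_mono add_mono order.trans[OF s] pR face_energies(3,4)[OF E K(1,2) e] mult_nonneg_nonneg) auto
  finally show ?thesis by (simp add: algebra_simps)
qed

text \<open>Here \<open>1 + \<epsilon> / \<rho>\<^sup>2 \<le> 1 + c\<close>, so the bound of the jumps in the mean square suffices, and the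
  constants come from the inverse estimate, the volume ratio and \<open>c\<close>.\<close>

lemma small_parameter_bound:
  assumes fc: "face_connected l \<Omega> \<T>" and l: "1 \<le> l" and e: "0 < \<epsilon>" and c: "0 < c"
    and faces: "\<forall>K\<in>\<T>. \<exists>E\<in>interelement_faces \<Omega> \<T>. E facet_of K"
    and small: "\<epsilon> \<le> c * Min ((\<lambda>K. (inball_diameter K)\<^sup>2) ` \<T>)"
    and u: "u \<in> H1 \<Omega>"
  shows "global_best_error l \<Omega> \<T> \<epsilon> u \<le> sqrt (interpolation_const CARD('n) l (max_elements_per_node l \<T>) 1
     (8 * ((1 + c) * (volume_ratio \<T>)\<^sup>2) * inverse_const CARD('n) l)) * local_best_errors l \<Omega> \<T> \<epsilon> u"
proof -
  obtain g where g: "u square_integrable_on \<Omega>" "has_weak_gradient \<Omega> u g" "g square_integrable_on \<Omega>"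
    using u by (auto simp: H1_def)
  have e0: "0 \<le> \<epsilon>" using e by simp
  let ?\<theta> = "(1 + c) * (volume_ratio \<T>)\<^sup>2"
  let ?A = "8 * ?\<theta> * inverse_const CARD('n) l"
  have \<theta>: "0 \<le> ?\<theta>" using c by simp
  have A: "0 \<le> ?A" using c inverse_const_pos[of "CARD('n)" l] by (intro mult_nonneg_nonneg) auto
  show ?thesis
  proof (rule global_best_error_le_local[OF g e0])
    show "0 \<le> interpolation_const CARD('n) l (max_elements_per_node l \<T>) 1 ?A" using A by (rule interpolation_const_nonneg[rotated]) simp
    fix w :: "(real^'n) set \<Rightarrow> real^'n \<Rightarrow> real" assume w: "\<And>E. w E \<in> fe_space l \<T>"
    have "\<forall>K\<in>\<T>. \<exists>q. q \<in> polynomials_upto l \<and> local_energy \<epsilon> u g K q \<le> face_sum \<epsilon> u g w K"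
      using element_piece_energy[where w = w, OF g(1,3) e0 faces w] by blast
    from bchoice[OF this] obtain p where "\<forall>K\<in>\<T>. p K \<in> polynomials_upto l \<and> local_energy \<epsilon> u g K (p K) \<le> face_sum \<epsilon> u g w K"
      by (rule exE)
    then have p: "\<And>K. K \<in> \<T> \<Longrightarrow> p K \<in> polynomials_upto l" "\<And>K. K \<in> \<T> \<Longrightarrow> local_energy \<epsilon> u g K (p K) \<le> face_sum \<epsilon> u g w K"
      by simp_all
    show "\<exists>v\<in>fe_space l \<T>. (\<Sum>K\<in>\<T>. local_energy \<epsilon> u g K v) \<le>
        interpolation_const CARD('n) l (max_elements_per_node l \<T>) 1 ?A * (\<Sum>K\<in>\<T>. face_sum \<epsilon> u g w K)"
      unfolding interpolation_const_def
    proof (rule quasi_interpolation[OF fc l g(1,3) e0 p(1) face_sum_nonneg[OF e0] A])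
      show "local_energy \<epsilon> u g K (p K) \<le> 1 * face_sum \<epsilon> u g w K" if "K \<in> \<T>" for K using p(2)[OF that] by simp
      fix K L L' z assume K: "K \<in> \<T>" "L \<in> \<T>" "L' \<in> \<T>" "z \<in> K" "z \<in> L" "z \<in> L'" and E: "L \<inter> L' \<in> interelement_faces \<Omega> \<T>"
      let ?m = "measure lebesgue K * (1 + \<epsilon> / (inball_diameter K)\<^sup>2)"
      have rho: "0 < inball_diameter K" by (rule inball_diameter_pos[OF mesh_simplex[OF K(1)]])
      have "\<epsilon> \<le> c * (inball_diameter K)\<^sup>2"
      proof -
        have "Min ((\<lambda>K. (inball_diameter K)\<^sup>2) ` \<T>) \<le> (inball_diameter K)\<^sup>2" using finite_mesh K(1) by (intro Min_le) auto
        then show ?thesis using small c mult_left_mono[of "Min ((\<lambda>K. (inball_diameter K)\<^sup>2) ` \<T>)" "(inball_diameter K)\<^sup>2" c] by linarith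
      qed
      then have "1 + \<epsilon> / (inball_diameter K)\<^sup>2 \<le> 1 + c" using rho by (simp add: field_simps)
      then have mm: "?m \<le> measure lebesgue K * (1 + c)" by (intro mult_left_mono) auto
      have m: "?m \<le> ?\<theta> * measure lebesgue M" if "M \<in> \<T>" "z \<in> M" for M
      proof -
        have "measure lebesgue K * (1 + c) \<le> ((volume_ratio \<T>)\<^sup>2 * measure lebesgue M) * (1 + c)"
          using volume_ratio_bound[of K M] K(1,4) that c by (intro mult_right_mono) auto
        then show ?thesis using mm by (simp add: mult_ac)
      qed
      have "?m * (p L z - p L' z)\<^sup>2 \<le> 4 * ?\<theta> * inverse_const CARD('n) l * (1 + 1) * (face_sum \<epsilon> u g w L + face_sum \<epsilon> u g w L')"
        by (rule jump_L2_energy[where w = w, OF E K(2,3,5,6) e0 g(1) w p(1)[OF K(2)] p(1)[OF K(3)] _ _ m[OF K(2,5)] m[OF K(3,6)] \<theta>])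
          (use p(2) K in auto)
      then show "?m * (p L z - p L' z)\<^sup>2 \<le> ?A * (face_sum \<epsilon> u g w L + face_sum \<epsilon> u g w L')" by (simp add: mult_ac)
    qed
  qed
qed

text \<open>For general \<open>\<epsilon>\<close> the factor \<open>1 + \<epsilon> / \<rho>\<^sup>2\<close> is split: the jumps are bounded in the mean square for the
  summand \<open>1\<close> and by gradients for \<open>\<epsilon> / \<rho>\<^sup>2\<close>. The second bound has the factor \<open>H\<^sup>2\<close>, which turns
  \<open>\<epsilon> / \<rho>\<^sup>2\<close> into at most \<open>\<sigma>\<^sup>2 \<epsilon>\<close>.\<close>

lemma general_bound:
  assumes fc: "face_connected l \<Omega> \<T>" and l: "1 \<le> l" and e: "0 < \<epsilon>"
    and faces: "\<forall>K\<in>\<T>. \<exists>E\<in>interelement_faces \<Omega> \<T>. E facet_of K"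
    and u: "u \<in> H1 \<Omega>"
  shows "global_best_error l \<Omega> \<T> \<epsilon> u \<le> sqrt (interpolation_const CARD('n) l (max_elements_per_node l \<T>) (energy_const TYPE('n) (shape_parameter \<T>))
     ((4 * (volume_ratio \<T>)\<^sup>2 * inverse_const CARD('n) l + jump_const TYPE('n) l ((volume_ratio \<T>)\<^sup>2) (shape_parameter \<T>) * (shape_parameter \<T>)\<^sup>2)
        * (energy_const TYPE('n) (shape_parameter \<T>) + 1))) * local_best_errors l \<Omega> \<T> \<epsilon> u"
proof -
  obtain g where g: "u square_integrable_on \<Omega>" "has_weak_gradient \<Omega> u g" "g square_integrable_on \<Omega>"
    using u by (auto simp: H1_def)
  have e0: "0 \<le> \<epsilon>" using e by simp
  let ?\<sigma> = "shape_parameter \<T>" and ?\<theta> = "(volume_ratio \<T>)\<^sup>2" and ?n = "max_elements_per_node l \<T>"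
  let ?A' = "energy_const TYPE('n) ?\<sigma>" let ?J = "jump_const TYPE('n) l ?\<theta> ?\<sigma>"
  let ?A = "(4 * ?\<theta> * inverse_const CARD('n) l + ?J * ?\<sigma>\<^sup>2) * (?A' + 1)"
  have A': "0 \<le> ?A'" by (simp add: energy_const_def)
  have J: "0 \<le> ?J" using inverse_const_pos[of "CARD('n)" l] by (simp add: jump_const_def)
  have A: "0 \<le> ?A" using A' J inverse_const_pos[of "CARD('n)" l] by (intro mult_nonneg_nonneg add_nonneg_nonneg) auto
  show ?thesis
  proof (rule global_best_error_le_local[OF g e0])
    show "0 \<le> interpolation_const CARD('n) l ?n ?A' ?A" using A' A by (rule interpolation_const_nonneg)
    fix w :: "(real^'n) set \<Rightarrow> real^'n \<Rightarrow> real" assume w: "\<And>E. w E \<in> fe_space l \<T>"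
    let ?R = "face_sum \<epsilon> u g w"
    have "\<forall>K\<in>\<T>. \<exists>q. q \<in> polynomials_upto l \<and> elem_avg K (\<lambda>x. u x - q x) = 0 \<and> local_energy \<epsilon> u g K q \<le> ?A' * ?R K"
    proof
      fix K assume K: "K \<in> \<T>"
      obtain p where p: "p \<in> polynomials_upto l" "local_energy \<epsilon> u g K p \<le> ?R K" 
        using element_piece_energy[where w = w, OF g(1,3) e0 faces w K] by blast
      have "K \<inter> K \<noteq> {}" using full_simplex_interior_nonempty[OF mesh_simplex[OF K]] interior_subset by blast
      from shape_parameter_bound[OF K K this]
      obtain q where q: "q \<in> polynomials_upto l" "elem_avg K (\<lambda>x. u x - q x) = 0" "local_energy \<epsilon> u g K q \<le> ?A' * local_energy \<epsilon> u g K p"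
        using normalised_polynomial[OF K g(1) p(1) e0, of ?\<sigma> g] unfolding energy_const_def by blast
      have "?A' * local_energy \<epsilon> u g K p \<le> ?A' * ?R K" using p(2) A' by (rule mult_left_mono)
      then show "\<exists>q. q \<in> polynomials_upto l \<and> elem_avg K (\<lambda>x. u x - q x) = 0 \<and> local_energy \<epsilon> u g K q \<le> ?A' * ?R K"
        using q order.trans by blast
    qed
    from bchoice[OF this] obtain p where "\<forall>K\<in>\<T>. p K \<in> polynomials_upto l \<and> elem_avg K (\<lambda>x. u x - p K x) = 0 \<and>
      local_energy \<epsilon> u g K (p K) \<le> ?A' * ?R K" by (rule exE)
    then have p: "\<And>K. K \<in> \<T> \<Longrightarrow> p K \<in> polynomials_upto l" "\<And>K. K \<in> \<T> \<Longrightarrow> elem_avg K (\<lambda>x. u x - p K x) = 0"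
      "\<And>K. K \<in> \<T> \<Longrightarrow> local_energy \<epsilon> u g K (p K) \<le> ?A' * ?R K" by simp_all
    show "\<exists>v\<in>fe_space l \<T>. (\<Sum>K\<in>\<T>. local_energy \<epsilon> u g K v) \<le> interpolation_const CARD('n) l ?n ?A' ?A * (\<Sum>K\<in>\<T>. ?R K)"
      unfolding interpolation_const_def
    proof (rule quasi_interpolation[OF fc l g(1,3) e0 p(1) face_sum_nonneg[OF e0] A p(3)])
      fix K L L' z assume K: "K \<in> \<T>" "L \<in> \<T>" "L' \<in> \<T>" "z \<in> K" "z \<in> L" "z \<in> L'" and E: "L \<inter> L' \<in> interelement_faces \<Omega> \<T>"
      let ?m = "measure lebesgue K" and ?v = "w (L \<inter> L')"
      have rho: "0 < inball_diameter M" if "M \<in> \<T>" for M using inball_diameter_pos[OF mesh_simplex[OF that]] .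
      have m: "?m \<le> ?\<theta> * measure lebesgue M" if "M \<in> \<T>" "z \<in> M" for M
        using volume_ratio_bound[of K M] K(1,4) that by auto
      have 1: "?m * (p L z - p L' z)\<^sup>2 \<le> 4 * ?\<theta> * inverse_const CARD('n) l * (?A' + 1) * (?R L + ?R L')"
        by (rule jump_L2_energy[where w = w, OF E K(2,3,5,6) e0 g(1) w p(1)[OF K(2)] p(1)[OF K(3)] p(3)[OF K(2)] p(3)[OF K(3)] m[OF K(2,5)] m[OF K(3,6)]]) simp
      define H where "H = max (diameter L) (diameter L')"
      define \<rho> where "\<rho> = min (inball_diameter L) (inball_diameter L')"
      have H\<sigma>: "H \<le> ?\<sigma> * inball_diameter M" if "M \<in> \<T>" "z \<in> M" for M
        unfolding H_def using shape_parameter_bound[of M L] shape_parameter_bound[of M L'] that K by auto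
      have H\<rho>: "H \<le> ?\<sigma> * \<rho>" unfolding \<rho>_def using H\<sigma>[of L] H\<sigma>[of L'] K by (auto simp: min_def)
      have \<rho>0: "0 < \<rho>" using rho K by (simp add: \<rho>_def)
      have H0: "0 \<le> H" using rho[OF K(2)] inball_diameter_le_diameter[OF mesh_simplex[OF K(2)]] by (simp add: H_def)
      let ?Y = "(sq_int L (\<lambda>x. g x - grad (p L) x) + sq_int L (\<lambda>x. g x - grad ?v x)) + (sq_int L' (\<lambda>x. g x - grad (p L') x) + sq_int L' (\<lambda>x. g x - grad ?v x))"
      note fe = face_energies(1,2)[OF E K(2,3) e0] face_energies(3,4)[where w = w and u = u and g = g, OF E K(2,3) e0]
      have 2: "?m * (p L z - p L' z)\<^sup>2 \<le> ?J * H\<^sup>2 * ?Y"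
        unfolding jump_const_def
        by (rule jump_gradient[OF K(2,3) fe(1,2) _ g w p(1)[OF K(2)] p(1)[OF K(3)] p(2)[OF K(2)] p(2)[OF K(3)] _ m[OF K(2,5)] m[OF K(3,6)] _ _ _ \<rho>0 _ _ H\<rho>])
          (use K in \<open>auto simp: H_def \<rho>_def\<close>)
      have s: "\<epsilon> * sq_int M (\<lambda>x. g x - grad q x) \<le> local_energy \<epsilon> u g M q" for M q
        using sq_int_nonneg[of M "\<lambda>x. u x - q x"] by (simp add: local_energy_def)
      have eY: "\<epsilon> * ?Y \<le> (?A' + 1) * (?R L + ?R L')"
      proof -
        have "\<epsilon> * ?Y = (\<epsilon> * sq_int L (\<lambda>x. g x - grad (p L) x) + \<epsilon> * sq_int L (\<lambda>x. g x - grad ?v x)) +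
            (\<epsilon> * sq_int L' (\<lambda>x. g x - grad (p L') x) + \<epsilon> * sq_int L' (\<lambda>x. g x - grad ?v x))" by (simp only: distrib_left)
        also have "\<dots> \<le> (?A' * ?R L + ?R L) + (?A' * ?R L' + ?R L')"
          by (intro add_mono order.trans[OF s] p(3) K fe(3,4))
        finally show ?thesis by (simp add: algebra_simps)
      qed
      have h\<sigma>: "H\<^sup>2 / (inball_diameter K)\<^sup>2 \<le> ?\<sigma>\<^sup>2"
      proof -
        have "H / inball_diameter K \<le> ?\<sigma>" using H\<sigma>[OF K(1,4)] rho[OF K(1)] by (simp add: field_simps)
        then have "(H / inball_diameter K)\<^sup>2 \<le> ?\<sigma>\<^sup>2" using H0 rho[OF K(1)] by (intro power_mono) auto
        then show ?thesis by (simp add: power_divide)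
      qed
      have 3: "?J * ((H\<^sup>2 / (inball_diameter K)\<^sup>2) * (\<epsilon> * ?Y)) \<le> ?J * (?\<sigma>\<^sup>2 * ((?A' + 1) * (?R L + ?R L')))"
        by (rule mult_left_mono[OF mult_mono[OF h\<sigma> eY] J])
          (use e0 in \<open>auto intro!: mult_nonneg_nonneg add_nonneg_nonneg sq_int_nonneg simp del: norm_eq_zero\<close>)
      have "(\<epsilon> / (inball_diameter K)\<^sup>2) * (?m * (p L z - p L' z)\<^sup>2) \<le> (\<epsilon> / (inball_diameter K)\<^sup>2) * (?J * H\<^sup>2 * ?Y)"
        using 2 e0 by (intro mult_left_mono) auto
      also have "\<dots> = ?J * ((H\<^sup>2 / (inball_diameter K)\<^sup>2) * (\<epsilon> * ?Y))" by simp
      also note 3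
      finally have 4: "(\<epsilon> / (inball_diameter K)\<^sup>2) * (?m * (p L z - p L' z)\<^sup>2) \<le> ?J * (?\<sigma>\<^sup>2 * ((?A' + 1) * (?R L + ?R L')))" .
      have "?m * (1 + \<epsilon> / (inball_diameter K)\<^sup>2) * (p L z - p L' z)\<^sup>2 =
          ?m * (p L z - p L' z)\<^sup>2 + (\<epsilon> / (inball_diameter K)\<^sup>2) * (?m * (p L z - p L' z)\<^sup>2)" by (simp add: distrib_left distrib_right)
      also have "\<dots> \<le> 4 * ?\<theta> * inverse_const CARD('n) l * (?A' + 1) * (?R L + ?R L') + ?J * (?\<sigma>\<^sup>2 * ((?A' + 1) * (?R L + ?R L')))"
        using 1 4 by (rule add_mono)
      also have "\<dots> = ?A * (?R L + ?R L')" by (simp only: distrib_right mult.assoc)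
      finally show "?m * (1 + \<epsilon> / (inball_diameter K)\<^sup>2) * (p L z - p L' z)\<^sup>2 \<le> ?A * (?R L + ?R L')" .
    qed
  qed
qed

end

theorem theorem5p3:
  shows "\<exists>(F :: nat \<Rightarrow> nat \<Rightarrow> real \<Rightarrow> real \<Rightarrow> real) (G :: nat \<Rightarrow> nat \<Rightarrow> real \<Rightarrow> real \<Rightarrow> real).
    \<forall>(\<Omega> :: (real^'n) set) (\<T> :: (real^'n) set set) (\<l> :: nat).
      polyhedral_domain \<Omega> \<and> conforming_simplicial_mesh \<Omega> \<T> \<and> 1 \<le> \<l> \<and> face_connected \<l> \<Omega> \<T> \<and>
      (\<forall>K\<in>\<T>. \<exists>E\<in>interelement_faces \<Omega> \<T>. E facet_of K)
      \<longrightarrow>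
      (\<exists>C>0. C \<le> F \<l> (max_elements_per_node \<l> \<T>) (volume_ratio \<T>) (shape_parameter \<T>) \<and>
         (\<forall>\<epsilon>>0. \<forall>u\<in>H1 \<Omega>.
            global_best_error \<l> \<Omega> \<T> \<epsilon> u \<le> C * local_best_errors \<l> \<Omega> \<T> \<epsilon> u \<and>
            C * local_best_errors \<l> \<Omega> \<T> \<epsilon> u
              \<le> C * (real CARD('n) + 1) * global_best_error \<l> \<Omega> \<T> \<epsilon> u)) \<and>
      (\<forall>c>0. \<exists>C>0. C \<le> G \<l> (max_elements_per_node \<l> \<T>) (volume_ratio \<T>) c \<and>
         (\<forall>\<epsilon>>0. \<epsilon> \<le> c * Min ((\<lambda>K. (inball_diameter K)\<^sup>2) ` \<T>) \<longrightarrow>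
           (\<forall>u\<in>H1 \<Omega>.
              global_best_error \<l> \<Omega> \<T> \<epsilon> u \<le> C * local_best_errors \<l> \<Omega> \<T> \<epsilon> u \<and>
              C * local_best_errors \<l> \<Omega> \<T> \<epsilon> u
                \<le> C * (real CARD('n) + 1) * global_best_error \<l> \<Omega> \<T> \<epsilon> u)))"
proof -
  let ?d = "CARD('n)"
  \<comment> \<open>the summand \<open>1\<close> makes the constants positive\<close>
  define F where "F l n \<mu> \<sigma> = 1 + sqrt (interpolation_const ?d l n (energy_const TYPE('n) \<sigma>)
     ((4 * \<mu>\<^sup>2 * inverse_const ?d l + jump_const TYPE('n) l (\<mu>\<^sup>2) \<sigma> * \<sigma>\<^sup>2) * (energy_const TYPE('n) \<sigma> + 1)))"
    for l n and \<mu> \<sigma> :: real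
  define G where "G l n \<mu> c = 1 + sqrt (interpolation_const ?d l n 1 (8 * ((1 + c) * \<mu>\<^sup>2) * inverse_const ?d l))"
    for l n and \<mu> c :: real
  have conclude: "\<exists>C>0. C \<le> 1 + sqrt B \<and> (\<forall>\<epsilon>>0. P \<epsilon> \<longrightarrow> (\<forall>u\<in>H1 \<Omega>.
        global_best_error l \<Omega> \<T> \<epsilon> u \<le> C * local_best_errors l \<Omega> \<T> \<epsilon> u \<and>
        C * local_best_errors l \<Omega> \<T> \<epsilon> u \<le> C * (real CARD('n) + 1) * global_best_error l \<Omega> \<T> \<epsilon> u))"
    if m: "mesh \<Omega> \<T>" and B: "0 \<le> B" and up: "\<And>\<epsilon> u. 0 < \<epsilon> \<Longrightarrow> P \<epsilon> \<Longrightarrow> u \<in> H1 \<Omega> \<Longrightarrow>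
      global_best_error l \<Omega> \<T> \<epsilon> u \<le> sqrt B * local_best_errors l \<Omega> \<T> \<epsilon> u"
    for \<Omega> :: "(real^'n) set" and \<T> l B P
  proof (intro exI[of _ "1 + sqrt B"] conjI allI impI ballI)
    interpret mesh \<Omega> \<T> by (rule m)
    show "0 < 1 + sqrt B" using B by (intro add_pos_nonneg) auto
    fix \<epsilon> :: real and u assume e: "0 < \<epsilon>" and P: "P \<epsilon>" and u: "u \<in> H1 \<Omega>"
    have "sqrt B * local_best_errors l \<Omega> \<T> \<epsilon> u \<le> (1 + sqrt B) * local_best_errors l \<Omega> \<T> \<epsilon> u"
      using local_best_errors_nonneg by (intro mult_right_mono) auto
    then show "global_best_error l \<Omega> \<T> \<epsilon> u \<le> (1 + sqrt B) * local_best_errors l \<Omega> \<T> \<epsilon> u"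
      using up[OF e P u] by linarith
    have "local_best_errors l \<Omega> \<T> \<epsilon> u \<le> (real CARD('n) + 1) * global_best_error l \<Omega> \<T> \<epsilon> u"
      using local_best_errors_le[OF u] e by simp
    then show "(1 + sqrt B) * local_best_errors l \<Omega> \<T> \<epsilon> u \<le> (1 + sqrt B) * (real CARD('n) + 1) * global_best_error l \<Omega> \<T> \<epsilon> u"
      unfolding mult.assoc using B by (intro mult_left_mono add_nonneg_nonneg) auto
  qed simp
  show ?thesis
  proof (rule exI[of _ F], rule exI[of _ G], intro allI impI, elim conjE, intro conjI allI impI)
    fix \<Omega> :: "(real^'n) set" and \<T> and l :: nat
    assume *: "polyhedral_domain \<Omega>" "conforming_simplicial_mesh \<Omega> \<T>" "1 \<le> l" "face_connected l \<Omega> \<T>"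
      "\<forall>K\<in>\<T>. \<exists>E\<in>interelement_faces \<Omega> \<T>. E facet_of K"
    interpret mesh \<Omega> \<T> using * by unfold_locales
    let ?n = "max_elements_per_node l \<T>" and ?\<mu> = "volume_ratio \<T>" and ?\<sigma> = "shape_parameter \<T>"
    have nn: "0 \<le> energy_const TYPE('n) \<sigma>" "0 \<le> jump_const TYPE('n) l (\<mu>\<^sup>2) \<sigma>" "0 \<le> inverse_const ?d l" for \<mu> \<sigma>
      using inverse_const_pos[of ?d l] by (auto simp: energy_const_def jump_const_def)
    show "\<exists>C>0. C \<le> F l ?n ?\<mu> ?\<sigma> \<and> (\<forall>\<epsilon>>0. \<forall>u\<in>H1 \<Omega>.
            global_best_error l \<Omega> \<T> \<epsilon> u \<le> C * local_best_errors l \<Omega> \<T> \<epsilon> u \<and>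
            C * local_best_errors l \<Omega> \<T> \<epsilon> u \<le> C * (real CARD('n) + 1) * global_best_error l \<Omega> \<T> \<epsilon> u)"
    proof -
      have "0 \<le> interpolation_const ?d l ?n (energy_const TYPE('n) ?\<sigma>)
         ((4 * ?\<mu>\<^sup>2 * inverse_const ?d l + jump_const TYPE('n) l (?\<mu>\<^sup>2) ?\<sigma> * ?\<sigma>\<^sup>2) * (energy_const TYPE('n) ?\<sigma> + 1))"
        by (intro interpolation_const_nonneg nn mult_nonneg_nonneg add_nonneg_nonneg) auto
      from conclude[OF mesh_axioms this, of "\<lambda>_. True" l] general_bound[OF *(4,3) _ *(5)]
      show ?thesis unfolding F_def by simp
    qed
    fix c :: real assume c: "0 < c"
    show "\<exists>C>0. C \<le> G l ?n ?\<mu> c \<and> (\<forall>\<epsilon>>0. \<epsilon> \<le> c * Min ((\<lambda>K. (inball_diameter K)\<^sup>2) ` \<T>) \<longrightarrow> (\<forall>u\<in>H1 \<Omega>.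
            global_best_error l \<Omega> \<T> \<epsilon> u \<le> C * local_best_errors l \<Omega> \<T> \<epsilon> u \<and>
            C * local_best_errors l \<Omega> \<T> \<epsilon> u \<le> C * (real CARD('n) + 1) * global_best_error l \<Omega> \<T> \<epsilon> u))"
      unfolding G_def
    proof (rule conclude[OF mesh_axioms])
      show "0 \<le> interpolation_const ?d l ?n 1 (8 * ((1 + c) * ?\<mu>\<^sup>2) * inverse_const ?d l)"
        using c by (intro interpolation_const_nonneg nn mult_nonneg_nonneg) auto
    qed (rule small_parameter_bound[OF *(4,3) _ c *(5)])
  qed
qed

end
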